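(* Let $k\in[1,n/2)$ be an integer. (1) Assume $p>1$. The $2k$-order PDE $$(-\Delta)^k u(x)=c(x)u^p(x),\quad x\in\mathbb{R}^n,$$ has positive solutions for some double bounded $c(x)$ if and only if $p>\frac{n}{n-2k}$. (2) Assume $p,q>0$ and $pq>1$. The system $$(-\Delta)^k u(x)=c_1(x)v^q(x),\qquad (-\Delta)^k v(x)=c_2(x)u^p(x),\quad x\in\mathbb{R}^n,$$ has positive solutions $u,v$ for some double bounded $c_1(x)$ and $c_2(x)$ if and only if $$\max\Big\{\frac{2k(p+1)}{pq-1},\ \frac{2k(q+1)}{pq-1}\Big\}<n-2k.$$
   Context: A function $c:\mathbb{R}^n\to\mathbb{R}$ is called double bounded if there is a constant $C>0$ such that $\frac1C\le c(x)\le C$ for all $x\in\mathbb{R}^n$. *)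

theory Defs
  imports "HOL-Analysis.Analysis"
begin

definition partial_derivative :: "'n::finite \<Rightarrow> (real ^ 'n \<Rightarrow> real) \<Rightarrow> real ^ 'n \<Rightarrow> real" where
  "partial_derivative i f x = deriv (\<lambda>t. f (x + t *\<^sub>R axis i 1)) 0"

text \<open>The value of \<^const>\<open>deriv\<close> is unspecified where the derivative does not exist,
  so \<open>partial_derivative\<close> and the operators built from it are only meaningful on
  functions of class \<open>C\<^sup>m\<close> for large enough \<open>m\<close>.\<close>

fun C_class :: "nat \<Rightarrow> (real ^ 'n::finite \<Rightarrow> real) \<Rightarrow> bool" where
  "C_class 0 f \<longleftrightarrow> continuous_on UNIV f"
| "C_class (Suc m) f \<longleftrightarrow> (\<forall>x. f differentiable (at x)) \<and> (\<forall>i. C_class m (partial_derivative i f))"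

definition laplacian :: "(real ^ 'n::finite \<Rightarrow> real) \<Rightarrow> real ^ 'n \<Rightarrow> real" where
  "laplacian f x = (\<Sum>i\<in>UNIV. partial_derivative i (partial_derivative i f) x)"

definition neg_laplacian_power :: "nat \<Rightarrow> (real ^ 'n::finite \<Rightarrow> real) \<Rightarrow> real ^ 'n \<Rightarrow> real" where
  "neg_laplacian_power k = (\<lambda>f x. - laplacian f x) ^^ k"

definition double_bounded :: "(real ^ 'n::finite \<Rightarrow> real) \<Rightarrow> bool" where
  "double_bounded c \<longleftrightarrow> (\<exists>C>0. \<forall>x. 1 / C \<le> c x \<and> c x \<le> C)"

text \<open>Solutions are classical: of class \<open>C\<^sup>2\<^sup>k\<close> on the whole space, with the equations
  holding at every point.\<close>

definition positive_solution ::
  "nat \<Rightarrow> real \<Rightarrow> (real ^ 'n::finite \<Rightarrow> real) \<Rightarrow> (real ^ 'n \<Rightarrow> real) \<Rightarrow> bool" where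
  "positive_solution k p c u \<longleftrightarrow>
     C_class (2 * k) u \<and> (\<forall>x. u x > 0) \<and>
     (\<forall>x. neg_laplacian_power k u x = c x * u x powr p)"

definition positive_system_solution ::
  "nat \<Rightarrow> real \<Rightarrow> real \<Rightarrow> (real ^ 'n::finite \<Rightarrow> real) \<Rightarrow> (real ^ 'n \<Rightarrow> real)
     \<Rightarrow> (real ^ 'n \<Rightarrow> real) \<Rightarrow> (real ^ 'n \<Rightarrow> real) \<Rightarrow> bool" where
  "positive_system_solution k p q c1 c2 u v \<longleftrightarrow>
     C_class (2 * k) u \<and> C_class (2 * k) v \<and> (\<forall>x. u x > 0) \<and> (\<forall>x. v x > 0) \<and>
     (\<forall>x. neg_laplacian_power k u x = c1 x * v x powr q) \<and>
     (\<forall>x. neg_laplacian_power k v x = c2 x * u x powr p)"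

end

theory Submission
  imports Defs
begin

text \<open>
  With \<open>s = 1 + \<bar>x\<bar>\<^sup>2\<close>, every \<open>(-\<Delta>)\<^sup>k s powr (-a)\<close> with \<open>0 < 2a < n - 2k\<close> is a combination with positive
  coefficients of powers of \<open>s\<close> whose leading one is \<open>s powr (-a-k)\<close>. Taking for \<open>u\<close> and \<open>v\<close> such powers with
  \<open>a = k(q+1)/(pq-1)\<close> and \<open>a = k(p+1)/(pq-1)\<close> gives existence.

  For nonexistence let \<open>p \<le> q\<close>, hence \<open>q > 1\<close>, and \<open>\<alpha> = 2k(q+1)/(pq-1)\<close>. Radial test functions bound \<open>\<integral> v powr q\<close>
  and \<open>\<integral> u powr p\<close> over a ball by \<open>\<integral> u\<close> and \<open>\<integral> v\<close> over a larger one, and Hoelder's inequality bounds \<open>\<integral> v\<close> by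
  \<open>\<integral> v powr q\<close>. Since \<open>p\<close> may be less than 1, \<open>\<integral> u\<close> is interpolated between \<open>\<integral> u powr p\<close> and \<open>\<integral> u powr s\<close>
  for some \<open>s > 1\<close>, the latter being controlled by \<open>\<integral> u\<close> through a truncated fundamental solution. The outcome is
  \<open>X(r) \<le> A d powr (-\<mu>) X(r+2d) powr \<gamma>\<close> with \<open>\<gamma> < 1\<close> for \<open>X(r) = \<integral>\<^bsub>B(r)\<^esub> u\<close>, which forces a universal
  bound on \<open>X(1)\<close>. By scaling, \<open>\<integral>\<^bsub>B(R)\<^esub> u \<le> K R powr (n-\<alpha>)\<close> and
  \<open>\<integral>\<^bsub>B(R)\<^esub> v powr q \<le> K' R powr (n-2k-\<alpha>)\<close>. If \<open>\<alpha> > n-2k\<close>, let \<open>R \<rightarrow> \<infinity>\<close>. If \<open>\<alpha> = n-2k\<close>, then \<open>v powr q\<close> is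
  integrable, so its mass in the annuli \<open>\<epsilon>R \<le> \<bar>x\<bar> \<le> R\<close> vanishes in the limit, which improves the bound to 0.
\<close>

section \<open>Derivatives and the Laplacian\<close>

text \<open>For \<open>k > 1\<close> nonnegativity of \<open>(-\<Delta>)^k u\<close> gives no
  maximum principle for \<open>u\<close>, and the intermediate iterates carry no known sign.
  Nonexistence therefore works only with integrals against explicit radial functions, and each
  estimate is paid for by a larger ball and a negative power of the gap \<open>d\<close>. These
  losses can be absorbed because \<open>pq > 1\<close> makes the final recursion sublinear:
  \<open>\<gamma> = 1 - p'\<tau>(1 - 1/(pq))\<close>, where \<open>p' < 1\<close> is the lower
  exponent of the interpolation and \<open>\<tau>\<close> its weight.

  The fundamental solution is singular at its pole, whereas test functions must be twice
  differentiable there. It is replaced by \<open>(\<bar>x\<bar>^2 + e) powr -(n/2 - k)\<close>,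
  whose iterated Laplacian is explicit; the same closed formula with another exponent serves the
  existence half. The constants do not depend on \<open>e\<close>, and \<open>e\<close> is fixed
  only after \<open>u\<close>, so that no limit \<open>e \<rightarrow> 0\<close> has to be taken.

  The scalar equation is treated as the system with \<open>p = q\<close> and
  \<open>u = v\<close>.\<close>

lemma partial_derivativeI:
  assumes "((\<lambda>t. f (x + t *\<^sub>R axis i 1)) has_real_derivative D) (at 0)"
  shows "partial_derivative i f x = D"
  unfolding partial_derivative_def by (rule DERIV_imp_deriv) (rule assms)

lemma has_partial_derivative:
  assumes "f differentiable (at x)"
  shows "((\<lambda>t. f (x + t *\<^sub>R axis i 1)) has_real_derivative partial_derivative i f x) (at 0)"
proof -
  have "(\<lambda>t. f (x + t *\<^sub>R axis i 1)) differentiable (at (0::real))"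
    by (rule differentiable_compose[of f]) (use assms in auto)
  then show ?thesis
    unfolding partial_derivative_def
    by (simp add: DERIV_deriv_iff_real_differentiable)
qed

lemma C_class_imp_continuous: "C_class m f \<Longrightarrow> continuous_on UNIV f"
  by (cases m) (auto simp: continuous_on_eq_continuous_within intro: differentiable_imp_continuous_within)

lemma C_class_SucD: "C_class (Suc m) f \<Longrightarrow> C_class m f"
proof (induction m arbitrary: f)
  case 0
  then show ?case using C_class_imp_continuous[OF 0] by simp
qed auto

lemma C_class_mono: "C_class m f \<Longrightarrow> m' \<le> m \<Longrightarrow> C_class m' f"
  by (induction m) (auto simp: le_Suc_eq dest: C_class_SucD simp del: C_class.simps)

lemma C_class_add: "C_class m f \<Longrightarrow> C_class m g \<Longrightarrow> C_class m (\<lambda>x. f x + g x)"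
proof (induction m arbitrary: f g)
  case 0
  then show ?case by (auto intro: continuous_on_add)
next
  case (Suc m)
  have "partial_derivative i (\<lambda>x. f x + g x) = (\<lambda>x. partial_derivative i f x + partial_derivative i g x)" for i
    using Suc.prems by (auto intro!: ext partial_derivativeI DERIV_add has_partial_derivative)
  then show ?case using Suc by auto
qed

lemma partial_derivative_affine:
  assumes "\<And>x. f differentiable (at x)"
  shows "partial_derivative i (\<lambda>x. c * f (y + r *\<^sub>R x)) = (\<lambda>x. (c * r) * partial_derivative i f (y + r *\<^sub>R x))"
proof (rule ext, rule partial_derivativeI)
  fix x
  have "((\<lambda>t. f (y + r *\<^sub>R x + (r * t) *\<^sub>R axis i 1)) has_real_derivative partial_derivative i f (y + r *\<^sub>R x) * r) (at 0)"
    by (rule DERIV_chain2[where f = "\<lambda>s. f (y + r *\<^sub>R x + s *\<^sub>R axis i 1)" and g = "\<lambda>t. r * t"])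
       (auto intro!: derivative_eq_intros simp: has_partial_derivative[OF assms])
  from DERIV_cmult[OF this, of c]
  show "((\<lambda>t. c * f (y + r *\<^sub>R (x + t *\<^sub>R axis i 1))) has_real_derivative c * r * partial_derivative i f (y + r *\<^sub>R x)) (at 0)"
    by (simp add: scaleR_add_right add.assoc mult_ac)
qed

lemma C_class_affine: "C_class m f \<Longrightarrow> C_class m (\<lambda>x. c * f (y + r *\<^sub>R x))"
proof (induction m arbitrary: f c)
  case 0
  then show ?case
    by (auto intro!: continuous_intros continuous_on_compose2[of UNIV f])
next
  case (Suc m)
  have f: "\<And>x. f differentiable (at x)" and C: "\<And>i. C_class m (partial_derivative i f)"
    using Suc.prems by auto
  have aff: "(\<lambda>x. y + r *\<^sub>R x) differentiable (at x)" for x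
    by (rule differentiableI[where f' = "\<lambda>h. r *\<^sub>R h"]) (auto intro!: derivative_eq_intros)
  have "(\<lambda>x. c * f (y + r *\<^sub>R x)) differentiable (at x)" for x
    by (rule differentiable_mult[OF differentiable_const differentiable_compose[of f, OF f aff]])
  moreover have "C_class m (partial_derivative i (\<lambda>x. c * f (y + r *\<^sub>R x)))" for i
    unfolding partial_derivative_affine[OF f] by (rule Suc.IH[OF C])
  ultimately show ?case by simp
qed

lemma C_class_cmult: "C_class m f \<Longrightarrow> C_class m (\<lambda>x. c * f x)"
  using C_class_affine[of m f c 0 1] by simp

lemma C_class_sum:
  fixes f :: "'a \<Rightarrow> real ^ 'n::finite \<Rightarrow> real"
  shows "finite I \<Longrightarrow> (\<And>i. i \<in> I \<Longrightarrow> C_class m (f i)) \<Longrightarrow> C_class m (\<lambda>x. \<Sum>i\<in>I. f i x)"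
proof (induction I rule: finite_induct)
  case empty
  have "C_class m (\<lambda>x :: real ^ 'n. 0)"
  proof (induction m)
    case (Suc m)
    have "partial_derivative i (\<lambda>x :: real ^ 'n. 0) = (\<lambda>x. 0)" for i :: 'n
      by (auto intro!: ext partial_derivativeI)
    then show ?case using Suc by auto
  qed auto
  then show ?case by simp
qed (auto intro: C_class_add)

lemma C_class_neg_laplacian:
  "C_class (Suc (Suc m)) f \<Longrightarrow> C_class m (\<lambda>x. - laplacian f x)"
  using C_class_cmult[of m "laplacian f" "-1"] C_class_sum[of UNIV m "\<lambda>i. partial_derivative i (partial_derivative i f)"]
  by (simp add: laplacian_def[abs_def])

lemma neg_laplacian_power_0 [simp]: "neg_laplacian_power 0 f = f"
  by (simp add: neg_laplacian_power_def)

text \<open>The factor applied first is peeled off, so that inductions on \<open>k\<close>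
  generalise over the function. \<open>radial_chain\<close> unfolds at the matching end.\<close>

lemma neg_laplacian_power_Suc: "neg_laplacian_power (Suc k) f = neg_laplacian_power k (\<lambda>x. - laplacian f x)"
  by (simp add: neg_laplacian_power_def funpow_Suc_right del: funpow.simps)

lemma continuous_neg_laplacian_power:
  "C_class (2 * k) f \<Longrightarrow> continuous_on UNIV (neg_laplacian_power k f)"
proof (induction k arbitrary: f)
  case (Suc k)
  then show ?case using C_class_neg_laplacian[of "2 * k" f] by (simp add: neg_laplacian_power_Suc)
qed auto

lemma laplacian_affine:
  assumes "C_class (Suc (Suc m)) f"
  shows "laplacian (\<lambda>x. c * f (y + r *\<^sub>R x)) = (\<lambda>x. (c * r\<^sup>2) * laplacian f (y + r *\<^sub>R x))"
proof -
  have "partial_derivative i (partial_derivative i (\<lambda>x. c * f (y + r *\<^sub>R x)))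
      = (\<lambda>x. (c * r * r) * partial_derivative i (partial_derivative i f) (y + r *\<^sub>R x))" for i
    using assms by (simp add: partial_derivative_affine)
  then show ?thesis
    by (simp add: laplacian_def[abs_def] sum_distrib_left power2_eq_square mult.assoc)
qed

lemma neg_laplacian_power_affine:
  assumes "C_class (2 * k) f"
  shows "neg_laplacian_power k (\<lambda>x. c * f (y + r *\<^sub>R x)) = (\<lambda>x. (c * r ^ (2 * k)) * neg_laplacian_power k f (y + r *\<^sub>R x))"
  using assms
proof (induction k arbitrary: f c)
  case (Suc k)
  have C: "C_class (Suc (Suc (2 * k))) f" using Suc.prems by simp
  have "(\<lambda>x. - laplacian (\<lambda>x. c * f (y + r *\<^sub>R x)) x) = (\<lambda>x. (c * r\<^sup>2) * ((\<lambda>x. - laplacian f x) (y + r *\<^sub>R x)))"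
    by (simp add: laplacian_affine[OF C])
  then show ?case
    by (simp only: neg_laplacian_power_Suc Suc.IH[OF C_class_neg_laplacian[OF C]])
       (simp add: power_add power2_eq_square mult.assoc)
qed simp

section \<open>Change of variables and integration by parts\<close>

lemma
  fixes f :: "'a::euclidean_space \<Rightarrow> real"
  assumes r: "r > 0" and f: "f \<in> borel_measurable borel"
  shows integral_lborel_affine: "(\<integral>x. f (y + r *\<^sub>R x) \<partial>lborel) = (\<integral>x. f x \<partial>lborel) / r ^ DIM('a)"
    and integrable_lborel_affine: "integrable lborel (\<lambda>x. f (y + r *\<^sub>R x)) \<longleftrightarrow> integrable lborel f"
proof -
  let ?T = "\<lambda>x. y + r *\<^sub>R x"
  have eq: "lborel = density (distr lborel borel ?T) (\<lambda>_. ennreal (r ^ DIM('a)))"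
    using lborel_affine[of r y] r by simp
  have T: "?T \<in> lborel \<rightarrow>\<^sub>M borel" by simp
  have "(\<integral>x. f x \<partial>lborel) = r ^ DIM('a) * (\<integral>x. f (?T x) \<partial>lborel)"
    by (subst eq, subst integral_real_density) (use f r T in \<open>auto simp: integral_distr\<close>)
  then show "(\<integral>x. f (?T x) \<partial>lborel) = (\<integral>x. f x \<partial>lborel) / r ^ DIM('a)" using r by simp
  have "integrable lborel f \<longleftrightarrow> integrable lborel (\<lambda>x. r ^ DIM('a) * f (?T x))"
    by (subst eq, subst integrable_real_density) (use f r T in \<open>auto simp: integrable_distr_eq\<close>)
  then show "integrable lborel (\<lambda>x. f (?T x)) \<longleftrightarrow> integrable lborel f" using r by simp
qed

lemma integrable_continuous_cball_support:
  fixes h :: "'a::euclidean_space \<Rightarrow> real"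
  assumes "continuous_on UNIV h" and s: "\<And>x. x \<notin> cball y r \<Longrightarrow> h x = 0"
  shows "integrable lborel h"
proof -
  have "integrable lborel (\<lambda>x. indicator (cball y r) x *\<^sub>R h x)"
    by (intro borel_integrable_compact continuous_on_subset[OF assms(1)]) auto
  also have "(\<lambda>x. indicator (cball y r) x *\<^sub>R h x) = h"
    using s by (auto simp: indicator_def fun_eq_iff)
  finally show ?thesis .
qed

text \<open>By translation invariance every difference quotient of \<open>h\<close> in direction
  \<open>e\<close> has integral 0, and the quotients converge to \<open>h'\<close> boundedly on a
  fixed ball. This replaces the divergence theorem and any Fubini argument along the line.\<close>

lemma integral_directional_derivative_eq_0:
  fixes h h' :: "real ^ 'n::finite \<Rightarrow> real" and e :: "real ^ 'n"
  assumes der: "\<And>x. ((\<lambda>t. h (x + t *\<^sub>R e)) has_real_derivative h' x) (at 0)"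
    and e: "norm e = 1"
    and ch: "continuous_on UNIV h" and ch': "continuous_on UNIV h'"
    and s: "\<And>x. x \<notin> cball y r \<Longrightarrow> h x = 0" and s': "\<And>x. x \<notin> cball y r \<Longrightarrow> h' x = 0"
  shows "integral\<^sup>L lborel h' = 0"
proof -
  have "bounded (h' ` cball y r)"
    by (intro compact_imp_bounded compact_continuous_image continuous_on_subset[OF ch']) auto
  then obtain M where M: "\<And>x. x \<in> cball y r \<Longrightarrow> \<bar>h' x\<bar> \<le> M" and M0: "M > 0"
    unfolding bounded_pos by force
  have M: "\<bar>h' x\<bar> \<le> M" for x using M[of x] s'[of x] M0 by (cases "x \<in> cball y r") auto
  have int_h: "integrable lborel h"
    by (rule integrable_continuous_cball_support[OF ch s])
  define q where "q j x = (h (x + inverse (real (Suc j)) *\<^sub>R e) - h x) / inverse (real (Suc j))" for j x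
  have qint: "integral\<^sup>L lborel (q j) = 0" for j
  proof -
    let ?a = "inverse (real (Suc j)) *\<^sub>R e"
    have 1: "integrable lborel (\<lambda>x. h (x + ?a))"
      using integrable_lborel_affine[of 1 h ?a] int_h ch by (simp add: add.commute borel_measurable_continuous_onI)
    have 2: "integral\<^sup>L lborel (\<lambda>x. h (x + ?a)) = integral\<^sup>L lborel h"
      using integral_lborel_affine[of 1 h ?a] ch by (simp add: add.commute borel_measurable_continuous_onI)
    show ?thesis unfolding q_def using 1 2 int_h by simp
  qed
  \<comment> \<open>The increments have length at most 1, so all quotients vanish outside the ball
    enlarged by 1, and inside it the mean value theorem bounds them by \<open>M\<close>.\<close>
  have "(\<lambda>j. integral\<^sup>L lborel (q j)) \<longlonglongrightarrow> integral\<^sup>L lborel h'"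
  proof (rule integral_dominated_convergence[where w = "\<lambda>x. M * indicator (cball y (r + 1)) x"])
    show "h' \<in> borel_measurable lborel" using ch' by (simp add: borel_measurable_continuous_onI)
    show "q j \<in> borel_measurable lborel" for j
      unfolding q_def using borel_measurable_continuous_onI[OF ch] by measurable
    show "integrable lborel (\<lambda>x. M * indicator (cball y (r + 1)) x)"
      by (intro integrable_mult_right integrable_real_indicator) (use emeasure_lborel_cball_finite in \<open>auto simp: less_top\<close>)
    show "AE x in lborel. (\<lambda>j. q j x) \<longlonglongrightarrow> h' x"
    proof (rule AE_I2)
      fix x
      have "((\<lambda>t. (h (x + t *\<^sub>R e) - h x) / t) \<longlongrightarrow> h' x) (at 0)"
        using der[of x] by (simp add: DERIV_def)
      moreover have "filterlim (\<lambda>j. inverse (real (Suc j))) (at 0) sequentially"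
        by (rule filterlim_atI[OF LIMSEQ_inverse_real_of_nat]) (simp add: inverse_eq_divide)
      ultimately show "(\<lambda>j. q j x) \<longlonglongrightarrow> h' x"
        unfolding q_def by (rule filterlim_compose[of "\<lambda>t. (h (x + t *\<^sub>R e) - h x) / t"])
    qed
    show "AE x in lborel. norm (q j x) \<le> M * indicator (cball y (r + 1)) x" for j
    proof (rule AE_I2)
      fix x
      define t where "t = inverse (real (Suc j))"
      have t: "0 < t" "t \<le> 1" by (auto simp: t_def field_simps)
      have qx: "q j x = (h (x + t *\<^sub>R e) - h x) / t" by (simp only: q_def t_def)
      \<comment> \<open>The hypothesis \<open>der\<close> concerns \<open>t = 0\<close> only; moving
        the base point to \<open>x + s e\<close> gives the derivative at every \<open>s\<close> on
        the line.\<close>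
      have d: "((\<lambda>t. h (x + t *\<^sub>R e)) has_real_derivative h' (x + s *\<^sub>R e)) (at s)" for s
      proof -
        have "((\<lambda>t. h ((x + s *\<^sub>R e) + (t - s) *\<^sub>R e)) has_real_derivative h' (x + s *\<^sub>R e) * 1) (at s)"
          by (rule DERIV_chain2[where g = "\<lambda>t. t - s" and f = "\<lambda>t. h ((x + s *\<^sub>R e) + t *\<^sub>R e)"])
             (auto intro!: derivative_eq_intros simp: der)
        then show ?thesis by (simp add: algebra_simps)
      qed
      show "norm (q j x) \<le> M * indicator (cball y (r + 1)) x"
      proof (cases "x \<in> cball y (r + 1)")
        case True
        obtain z where "h (x + t *\<^sub>R e) - h (x + 0 *\<^sub>R e) = (t - 0) * h' (x + z *\<^sub>R e)"
          using MVT2[of 0 t "\<lambda>t. h (x + t *\<^sub>R e)" "\<lambda>s. h' (x + s *\<^sub>R e)"] t d by auto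
        then have "q j x = h' (x + z *\<^sub>R e)" using t by (simp add: qx)
        then show ?thesis using True M by simp
      next
        case False
        have "dist (x + t *\<^sub>R e) x \<le> 1" using t e by (simp add: dist_norm)
        then have "x + t *\<^sub>R e \<notin> cball y r" using False
          dist_triangle[of y x "x + t *\<^sub>R e"] unfolding mem_cball by linarith
        then have "q j x = 0" using False s[of x] s[of "x + t *\<^sub>R e"] by (simp add: qx)
        then show ?thesis using False by simp
      qed
    qed
  qed
  then have "(\<lambda>j. 0) \<longlonglongrightarrow> integral\<^sup>L lborel h'" by (simp add: qint)
  then show ?thesis by (simp add: LIMSEQ_const_iff)
qed

section \<open>Radial test functions\<close>

text \<open>\<open>G\<close> is the profile of \<open>-\<Delta>\<close> applied to the function \<open>F(\<bar>x\<bar>\<^sup>2)\<close> on \<open>\<real>\<^sup>N\<close>: the argument of a profile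
  is the squared distance to the centre, which keeps the centre a smooth point.\<close>

definition radial_step :: "real \<Rightarrow> (real \<Rightarrow> real) \<Rightarrow> (real \<Rightarrow> real) \<Rightarrow> bool" where
  "radial_step N F G \<longleftrightarrow> (\<exists>F' F''.
     (\<forall>t\<ge>0. (F has_real_derivative F' t) (at t) \<and> (F' has_real_derivative F'' t) (at t)) \<and>
     continuous_on {0..} F'' \<and> (\<forall>t\<ge>0. G t = - (4 * t * F'' t + 2 * N * F' t)))"

lemma radial_directional_derivative:
  fixes z :: "real ^ 'n::finite"
  assumes "(F has_real_derivative D) (at (z \<bullet> z))"
  shows "((\<lambda>t. F ((z + t *\<^sub>R axis i 1) \<bullet> (z + t *\<^sub>R axis i 1))) has_real_derivative D * (2 * z $ i)) (at 0)"
proof (rule DERIV_chain2[where f = F and g = "\<lambda>t. (z + t *\<^sub>R axis i 1) \<bullet> (z + t *\<^sub>R axis i 1)"])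
  have eq: "(z + t *\<^sub>R axis i 1) \<bullet> (z + t *\<^sub>R axis i 1) = z \<bullet> z + 2 * t * z $ i + t\<^sup>2" for t
    by (simp add: inner_add_left inner_add_right inner_axis inner_commute[of "axis i 1" z]
        power2_eq_square algebra_simps)
  show "((\<lambda>t. (z + t *\<^sub>R axis i 1) \<bullet> (z + t *\<^sub>R axis i 1)) has_real_derivative 2 * z $ i) (at 0)"
    unfolding eq by (auto intro!: derivative_eq_intros)
qed (use assms in simp)

lemma has_real_derivative_vec_nth:
  "((\<lambda>t. (z + t *\<^sub>R axis i 1 :: real ^ 'n::finite) $ i) has_real_derivative 1) (at 0)"
  by (auto intro!: derivative_eq_intros)

lemma radial_step_laplacian:
  fixes x :: "real ^ 'n::finite"
  assumes "radial_step (real CARD('n)) F G"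
  shows "- laplacian (\<lambda>y. F ((y - x) \<bullet> (y - x))) y = G ((y - x) \<bullet> (y - x))"
proof -
  obtain F' F'' where
    F: "\<And>t. t \<ge> 0 \<Longrightarrow> (F has_real_derivative F' t) (at t)"
      "\<And>t. t \<ge> 0 \<Longrightarrow> (F' has_real_derivative F'' t) (at t)"
    and G: "\<And>t. t \<ge> 0 \<Longrightarrow> G t = - (4 * t * F'' t + 2 * real CARD('n) * F' t)"
    using assms by (auto simp: radial_step_def)
  let ?\<sigma> = "\<lambda>y. (y - x) \<bullet> (y - x)"
  have d1: "partial_derivative i (\<lambda>y. F (?\<sigma> y)) = (\<lambda>y. F' (?\<sigma> y) * (2 * (y - x) $ i))" for i
  proof (rule ext, rule partial_derivativeI)
    fix y
    have "((\<lambda>t. F (((y - x) + t *\<^sub>R axis i 1) \<bullet> ((y - x) + t *\<^sub>R axis i 1)))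
       has_real_derivative F' (?\<sigma> y) * (2 * (y - x) $ i)) (at 0)"
      by (rule radial_directional_derivative[OF F(1)]) simp
    then show "((\<lambda>t. F (?\<sigma> (y + t *\<^sub>R axis i 1))) has_real_derivative F' (?\<sigma> y) * (2 * (y - x) $ i)) (at 0)"
      by (simp add: diff_add_eq)
  qed
  have d2: "partial_derivative i (\<lambda>y. F' (?\<sigma> y) * (2 * (y - x) $ i)) y
      = F'' (?\<sigma> y) * (2 * (y - x) $ i) * (2 * (y - x) $ i) + F' (?\<sigma> y) * 2" for i
  proof (rule partial_derivativeI)
    have "((\<lambda>t. F' (((y - x) + t *\<^sub>R axis i 1) \<bullet> ((y - x) + t *\<^sub>R axis i 1)) * (2 * ((y - x) + t *\<^sub>R axis i 1) $ i))
       has_real_derivative (F'' (?\<sigma> y) * (2 * (y - x) $ i)) * (2 * ((y - x) + 0 *\<^sub>R axis i 1) $ i)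
          + (2 * 1) * F' (((y - x) + 0 *\<^sub>R axis i 1) \<bullet> ((y - x) + 0 *\<^sub>R axis i 1))) (at 0)"
      by (rule DERIV_mult[OF radial_directional_derivative[OF F(2)] DERIV_cmult[OF has_real_derivative_vec_nth]]) simp
    then show "((\<lambda>t. F' (?\<sigma> (y + t *\<^sub>R axis i 1)) * (2 * (y + t *\<^sub>R axis i 1 - x) $ i))
       has_real_derivative F'' (?\<sigma> y) * (2 * (y - x) $ i) * (2 * (y - x) $ i) + F' (?\<sigma> y) * 2) (at 0)"
      by (simp add: diff_add_eq mult_ac)
  qed
  have "laplacian (\<lambda>y. F (?\<sigma> y)) y
      = (\<Sum>i\<in>UNIV. 4 * F'' (?\<sigma> y) * ((y - x) $ i * (y - x) $ i) + 2 * F' (?\<sigma> y))"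
    unfolding laplacian_def d1 d2 by (intro sum.cong) (auto simp: algebra_simps)
  also have "\<dots> = 4 * F'' (?\<sigma> y) * ?\<sigma> y + real CARD('n) * (2 * F' (?\<sigma> y))"
    by (simp only: sum.distrib sum_distrib_left[symmetric] sum_constant of_nat_id inner_vec_def inner_real_def)
  finally show ?thesis using G[of "?\<sigma> y"] by (simp add: mult_ac)
qed

text \<open>Green's second identity. \<open>h i\<close> is the i-th component of the field "F grad w
  - w grad F", and \<open>h' i\<close> its i-th derivative, so the sum of the \<open>h' i\<close> is
  the divergence, which integrates to 0 because \<open>F\<close> has bounded support.\<close>

lemma radial_step_Green:
  fixes x :: "real ^ 'n::finite"
  assumes w: "C_class 2 w" and step: "radial_step (real CARD('n)) F G"
    and T: "\<And>t. t \<ge> T \<Longrightarrow> F t = 0"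
  shows "(\<integral>y. F ((y - x) \<bullet> (y - x)) * - laplacian w y \<partial>lborel) = (\<integral>y. G ((y - x) \<bullet> (y - x)) * w y \<partial>lborel)"
proof -
  obtain F' F'' where
    F: "\<And>t. t \<ge> 0 \<Longrightarrow> (F has_real_derivative F' t) (at t)"
      "\<And>t. t \<ge> 0 \<Longrightarrow> (F' has_real_derivative F'' t) (at t)"
    and cF'': "continuous_on {0..} F''"
    and G: "\<And>t. t \<ge> 0 \<Longrightarrow> G t = - (4 * t * F'' t + 2 * real CARD('n) * F' t)"
    using step by (auto simp: radial_step_def)
  let ?\<sigma> = "\<lambda>y. (y - x) \<bullet> (y - x)"
  \<comment> \<open>\<open>T\<close> may be negative, hence the maximum. Outside the closed ball the
    squared distance exceeds \<open>max T 0\<close> strictly, so it suffices that \<open>F'\<close>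
    and \<open>F''\<close> vanish on an open half-line.\<close>
  define R where "R = sqrt (max T 0)"
  have out: "?\<sigma> y > max T 0" if "y \<notin> cball x R" for y
  proof -
    have "R < norm (y - x)" using that by (simp add: dist_norm norm_minus_commute)
    then have "R\<^sup>2 < (norm (y - x))\<^sup>2" by (rule power_strict_mono) (auto simp: R_def)
    then show ?thesis by (simp add: R_def power2_norm_eq_inner)
  qed
  have F'0: "F' t = 0" if "t > max T 0" for t
  proof -
    have "(F has_real_derivative 0) (at t)"
      by (rule has_field_derivative_transform_within_open[of "\<lambda>_. 0" 0 t "{max T 0<..}"])
         (use that T in auto)
    then show ?thesis using F(1)[of t] that DERIV_unique by auto
  qed
  have F''0: "F'' t = 0" if "t > max T 0" for t
  proof -
    have "(F' has_real_derivative 0) (at t)"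
      by (rule has_field_derivative_transform_within_open[of "\<lambda>_. 0" 0 t "{max T 0<..}"])
         (use that F'0 in auto)
    then show ?thesis using F(2)[of t] that DERIV_unique by auto
  qed
  have c\<sigma>: "continuous_on UNIV ?\<sigma>" by (intro continuous_intros)
  have cF0: "continuous_on {0..} F" "continuous_on {0..} F'"
    using F has_field_derivative_at_within by (blast intro: DERIV_continuous_on[of _ F F'] DERIV_continuous_on[of _ F' F''] dest: atLeast_iff[THEN iffD1])+
  have cF: "continuous_on UNIV (\<lambda>y. F (?\<sigma> y))"
    by (rule continuous_on_compose2[OF cF0(1) c\<sigma>]) auto
  have cF': "continuous_on UNIV (\<lambda>y. F' (?\<sigma> y))"
    by (rule continuous_on_compose2[OF cF0(2) c\<sigma>]) auto
  have cF'': "continuous_on UNIV (\<lambda>y. F'' (?\<sigma> y))"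
    by (rule continuous_on_compose2[OF cF'' c\<sigma>]) auto
  have w1: "w differentiable (at y)" "partial_derivative i w differentiable (at y)"
       "continuous_on UNIV (partial_derivative i (partial_derivative i w))" for i y
    using w by (auto simp: numeral_2_eq_2)
  have cw: "continuous_on UNIV w" "continuous_on UNIV (partial_derivative i w)" for i
    using w1 by (auto simp: continuous_on_eq_continuous_within intro: differentiable_imp_continuous_within)
  define h where "h i y = F (?\<sigma> y) * partial_derivative i w y - w y * (F' (?\<sigma> y) * (2 * (y - x) $ i))" for i y
  define h' where "h' i y = F (?\<sigma> y) * partial_derivative i (partial_derivative i w) y
     - w y * (F'' (?\<sigma> y) * (2 * (y - x) $ i) * (2 * (y - x) $ i) + F' (?\<sigma> y) * 2)" for i y
  have ch': "continuous_on UNIV (h' i)" for i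
    unfolding h'_def by (intro continuous_intros cF cF' cF'' cw w1)
  have h'0: "h' i y = 0" if "y \<notin> cball x R" for i y
    using out[OF that] T by (simp add: h'_def F'0 F''0)
  have int0: "integral\<^sup>L lborel (h' i) = 0" for i
  proof (rule integral_directional_derivative_eq_0[where e = "axis i 1" and h = "h i" and y = x and r = R])
    fix y :: "real ^ 'n"
    have e1: "((\<lambda>t. F (((y - x) + t *\<^sub>R axis i 1) \<bullet> ((y - x) + t *\<^sub>R axis i 1)))
       has_real_derivative F' (?\<sigma> y) * (2 * (y - x) $ i)) (at 0)"
      by (rule radial_directional_derivative[OF F(1)]) simp
    have e2: "((\<lambda>t. F' (((y - x) + t *\<^sub>R axis i 1) \<bullet> ((y - x) + t *\<^sub>R axis i 1)))
       has_real_derivative F'' (?\<sigma> y) * (2 * (y - x) $ i)) (at 0)"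
      by (rule radial_directional_derivative[OF F(2)]) simp
    have sh: "(y - x) + t *\<^sub>R axis i 1 = y + t *\<^sub>R axis i 1 - x" for t by simp
    have e1: "((\<lambda>t. F (?\<sigma> (y + t *\<^sub>R axis i 1))) has_real_derivative F' (?\<sigma> y) * (2 * (y - x) $ i)) (at 0)"
      using e1 unfolding sh .
    have e2: "((\<lambda>t. F' (?\<sigma> (y + t *\<^sub>R axis i 1))) has_real_derivative F'' (?\<sigma> y) * (2 * (y - x) $ i)) (at 0)"
      using e2 unfolding sh .
    have e3: "((\<lambda>t. (y + t *\<^sub>R axis i 1 - x) $ i) has_real_derivative 1) (at 0)"
      using has_real_derivative_vec_nth[of "y - x" i] unfolding sh .
    note dd = DERIV_diff[OF DERIV_mult[OF e1 has_partial_derivative[OF w1(2)[of i y], of i]]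
        DERIV_mult[OF has_partial_derivative[OF w1(1)[of y], of i] DERIV_mult[OF e2 DERIV_cmult[OF e3, of 2]]]]
    show "((\<lambda>t. h i (y + t *\<^sub>R axis i 1)) has_real_derivative h' i y) (at 0)"
      unfolding h_def by (rule DERIV_cong[OF dd]) (simp add: h'_def algebra_simps)
  next
    show "continuous_on UNIV (h i)"
      unfolding h_def by (intro continuous_intros cF cF' cw)
    show "h i y = 0" if "y \<notin> cball x R" for y
      using out[OF that] T by (simp add: h_def F'0)
  qed (use ch' h'0 in auto)
  have "integrable lborel (h' i)" for i
    by (rule integrable_continuous_cball_support[OF ch' h'0])
  then have "(\<integral>y. (\<Sum>i\<in>UNIV. h' i y) \<partial>lborel) = 0"
    by (simp add: int0)
  moreover have "(\<Sum>i\<in>UNIV. h' i y) = F (?\<sigma> y) * laplacian w y + G (?\<sigma> y) * w y" for y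
  proof -
    have "(\<Sum>i\<in>UNIV. h' i y) = F (?\<sigma> y) * laplacian w y
       - w y * (\<Sum>i\<in>UNIV. 4 * F'' (?\<sigma> y) * ((y - x) $ i * (y - x) $ i) + 2 * F' (?\<sigma> y))"
      unfolding h'_def laplacian_def sum_subtractf sum_distrib_left
      by (intro arg_cong2[of _ _ _ _ minus] sum.cong) (auto simp: algebra_simps)
    also have "(\<Sum>i\<in>UNIV. 4 * F'' (?\<sigma> y) * ((y - x) $ i * (y - x) $ i) + 2 * F' (?\<sigma> y))
       = 4 * F'' (?\<sigma> y) * ?\<sigma> y + real CARD('n) * (2 * F' (?\<sigma> y))"
      by (simp only: sum.distrib sum_distrib_left[symmetric] sum_constant of_nat_id inner_vec_def inner_real_def)
    finally show ?thesis unfolding G[OF inner_ge_zero] by (simp add: ring_distribs mult_ac)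
  qed
  ultimately have eq: "(\<integral>y. F (?\<sigma> y) * laplacian w y + G (?\<sigma> y) * w y \<partial>lborel) = 0"
    by simp
  have cl: "continuous_on UNIV (laplacian w)"
    unfolding laplacian_def by (intro continuous_intros w1)
  have F0: "F (?\<sigma> y) = 0" and G0: "G (?\<sigma> y) = 0" if "y \<notin> cball x R" for y
    using out[OF that] T F'0 F''0 G by auto
  have i1: "integrable lborel (\<lambda>y. F (?\<sigma> y) * laplacian w y)"
    by (rule integrable_continuous_cball_support[where y = x and r = R, OF continuous_on_mult[OF cF cl]])
       (simp add: F0 del: mem_cball)
  have cG: "continuous_on UNIV (\<lambda>y. G (?\<sigma> y))"
    unfolding G[OF inner_ge_zero] by (intro continuous_intros cF' cF'')
  have i2: "integrable lborel (\<lambda>y. G (?\<sigma> y) * w y)"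
    by (rule integrable_continuous_cball_support[where y = x and r = R, OF continuous_on_mult[OF cG cw(1)]])
       (simp add: G0 del: mem_cball)
  show ?thesis using eq i1 i2 by simp
qed

text \<open>The vanishing condition is imposed on each profile that is differentiated, as Green's
  identity requires for every step; it is not imposed on the last profile \<open>G\<close>.\<close>

fun radial_chain :: "real \<Rightarrow> real \<Rightarrow> nat \<Rightarrow> (real \<Rightarrow> real) \<Rightarrow> (real \<Rightarrow> real) \<Rightarrow> bool" where
  "radial_chain N T 0 F G \<longleftrightarrow> F = G"
| "radial_chain N T (Suc k) F G \<longleftrightarrow>
     (\<exists>H. radial_chain N T k F H \<and> radial_step N H G \<and> (\<forall>t\<ge>T. H t = 0))"

lemma radial_chain_Green:
  fixes x :: "real ^ 'n::finite"
  assumes "C_class (2 * k) w" and "radial_chain (real CARD('n)) T k F G"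
  shows "(\<integral>y. F ((y - x) \<bullet> (y - x)) * neg_laplacian_power k w y \<partial>lborel)
       = (\<integral>y. G ((y - x) \<bullet> (y - x)) * w y \<partial>lborel)"
  using assms
proof (induction k arbitrary: w G)
  case (Suc k)
  obtain H where H: "radial_chain (real CARD('n)) T k F H" "radial_step (real CARD('n)) H G" "\<And>t. t \<ge> T \<Longrightarrow> H t = 0"
    using Suc.prems by auto
  have C: "C_class (2 * k) (\<lambda>x. - laplacian w x)"
    using Suc.prems(1) C_class_neg_laplacian[of "2 * k" w] by simp
  have C2: "C_class 2 w"
    by (rule C_class_mono[OF Suc.prems(1)]) simp
  show ?case
    unfolding neg_laplacian_power_Suc Suc.IH[OF C H(1)]
    by (rule radial_step_Green[OF C2 H(2,3)])
qed simp

section \<open>Profiles with a regularized singularity\<close>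

text \<open>The order \<open>\<beta>\<close> bounds the singularity at the centre uniformly in the regularization \<open>e\<close>, since \<open>e \<le> t + e\<close>;
  \<open>J\<close> counts the order of vanishing at the boundary \<open>t = \<kappa>\<close> of the support. Rule \<open>cong\<close> works on the open set
  \<open>t > -e\<close> so that derivatives at \<open>t = 0\<close> are two-sided.\<close>

inductive profile :: "real \<Rightarrow> nat \<Rightarrow> (real \<Rightarrow> real \<Rightarrow> real \<Rightarrow> real) \<Rightarrow> bool" for \<beta> J where
  mono: "b \<le> \<beta> \<Longrightarrow> J \<le> j \<Longrightarrow> profile \<beta> J (\<lambda>e \<kappa> t. c * e ^ l * (t + e) powr (- b - real l) * max 0 (\<kappa> - t) ^ j)"
| add: "profile \<beta> J \<Phi> \<Longrightarrow> profile \<beta> J \<Psi> \<Longrightarrow> profile \<beta> J (\<lambda>e \<kappa> t. \<Phi> e \<kappa> t + \<Psi> e \<kappa> t)"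
| cong: "profile \<beta> J \<Phi> \<Longrightarrow> (\<And>e \<kappa> t. e > 0 \<Longrightarrow> t > - e \<Longrightarrow> \<Psi> e \<kappa> t = \<Phi> e \<kappa> t) \<Longrightarrow> profile \<beta> J \<Psi>"

lemma profile_weaken: "profile \<beta> J \<Phi> \<Longrightarrow> \<beta> \<le> \<beta>' \<Longrightarrow> J' \<le> J \<Longrightarrow> profile \<beta>' J' \<Phi>"
proof (induction rule: profile.induct)
  case (mono b j c l)
  show ?case by (rule profile.mono) (use mono in auto)
next
  case (add \<Phi> \<Psi>)
  then show ?case by (intro profile.add)
next
  case (cong \<Phi> \<Psi>)
  show ?case by (rule profile.cong[OF cong.IH[OF cong.prems] cong.hyps(2)])
qed

lemma profile_cmult: "profile \<beta> J \<Phi> \<Longrightarrow> profile \<beta> J (\<lambda>e \<kappa> t. d * \<Phi> e \<kappa> t)"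
proof (induction rule: profile.induct)
  case (mono b j c l)
  show ?case by (rule profile.cong[OF profile.mono[OF mono, of "d * c" l]]) simp
next
  case (add \<Phi> \<Psi>)
  show ?case by (rule profile.cong[OF profile.add[OF add.IH]]) (simp add: algebra_simps)
next
  case (cong \<Phi> \<Psi>)
  show ?case by (rule profile.cong[OF cong.IH]) (simp add: cong.hyps)
qed

text \<open>Write \<open>t = (t + e) - e\<close>. The first part raises the exponent of
  \<open>t + e\<close> by one. The second adds a factor \<open>e\<close>, which the class counts as
  another power of \<open>t + e\<close>, so both parts lose one order of singularity.\<close>

lemma profile_mult_t: "profile \<beta> J \<Phi> \<Longrightarrow> profile (\<beta> - 1) J (\<lambda>e \<kappa> t. t * \<Phi> e \<kappa> t)"
proof (induction rule: profile.induct)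
  case (mono b j c l)
  have b: "b - 1 \<le> \<beta> - 1" using mono by simp
  show ?case
  proof (rule profile.cong[OF profile.add[OF profile.mono[OF b mono(2), of c l] profile.mono[OF b mono(2), of "- c" "Suc l"]]])
    fix e \<kappa> t :: real
    assume "e > 0" "t > - e"
    moreover have "- (b - 1) - real l = (- b - real l) + 1" by simp
    ultimately have "(t + e) powr (- (b - 1) - real l) = (t + e) powr (- b - real l) * (t + e)"
      by (simp only: powr_add) simp
    then show "t * (c * e ^ l * (t + e) powr (- b - real l) * max 0 (\<kappa> - t) ^ j) =
       c * e ^ l * (t + e) powr (- (b - 1) - real l) * max 0 (\<kappa> - t) ^ j +
       - c * e ^ Suc l * (t + e) powr (- (b - 1) - real (Suc l)) * max 0 (\<kappa> - t) ^ j"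
      by (simp add: algebra_simps)
  qed
next
  case (add \<Phi> \<Psi>)
  show ?case by (rule profile.cong[OF profile.add[OF add.IH]]) (simp add: algebra_simps)
next
  case (cong \<Phi> \<Psi>)
  show ?case by (rule profile.cong[OF cong.IH]) (simp add: cong.hyps)
qed

lemma profile_mult_tau: "profile \<beta> J \<Phi> \<Longrightarrow> profile \<beta> (J + i) (\<lambda>e \<kappa> t. \<Phi> e \<kappa> t * max 0 (\<kappa> - t) ^ i)"
proof (induction rule: profile.induct)
  case (mono b j c l)
  have j: "J + i \<le> j + i" using mono by simp
  show ?case by (rule profile.cong[OF profile.mono[OF mono(1) j, of c l]]) (simp add: power_add)
next
  case (add \<Phi> \<Psi>)
  show ?case by (rule profile.cong[OF profile.add[OF add.IH]]) (simp add: algebra_simps)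
next
  case (cong \<Phi> \<Psi>)
  show ?case by (rule profile.cong[OF cong.IH]) (simp add: cong.hyps)
qed

text \<open>The exponent is at least 2, which removes the kink: at \<open>t = \<kappa>\<close> the
  difference quotient is at most the absolute value of the increment, as long as that is at most
  1.\<close>

lemma has_derivative_max_power:
  "((\<lambda>t::real. max 0 (\<kappa> - t) ^ Suc (Suc j)) has_real_derivative - real (Suc (Suc j)) * max 0 (\<kappa> - t) ^ Suc j) (at t)"
proof (cases "t = \<kappa>")
  case False
  then consider "t < \<kappa>" | "t > \<kappa>" by linarith
  then show ?thesis
  proof cases
    case 1
    have "((\<lambda>t. (\<kappa> - t) ^ Suc (Suc j)) has_real_derivative - real (Suc (Suc j)) * (\<kappa> - t) ^ Suc j) (at t)"
      by (rule derivative_eq_intros refl)+ (simp add: algebra_simps)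
    then have "((\<lambda>t. max 0 (\<kappa> - t) ^ Suc (Suc j)) has_real_derivative - real (Suc (Suc j)) * (\<kappa> - t) ^ Suc j) (at t)"
      by (rule has_field_derivative_transform_within_open[where S = "{..<\<kappa>}"]) (use 1 in auto)
    then show ?thesis using 1 by simp
  next
    case 2
    have "((\<lambda>t. max 0 (\<kappa> - t) ^ Suc (Suc j)) has_real_derivative 0) (at t)"
      by (rule has_field_derivative_transform_within_open[where S = "{\<kappa><..}" and f = "\<lambda>_. 0"]) (use 2 in auto)
    then show ?thesis using 2 by simp
  qed
next
  case True
  have "((\<lambda>h. max 0 (- h) ^ Suc (Suc j) / h) \<longlongrightarrow> 0) (at (0::real))"
  proof (rule Lim_null_comparison)
    have "\<forall>\<^sub>F h in at (0::real). \<bar>h\<bar> \<le> 1"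
      by (rule eventually_at_ball'[of 1, THEN eventually_mono]) (auto simp: dist_real_def)
    then show "\<forall>\<^sub>F h in at 0. norm (max 0 (- h) ^ Suc (Suc j) / h) \<le> \<bar>h\<bar>"
    proof eventually_elim
      case (elim h)
      have "max 0 (- h) ^ Suc (Suc j) \<le> \<bar>h\<bar> ^ Suc (Suc j)" by (intro power_mono) auto
      also have "\<dots> = (\<bar>h\<bar> * \<bar>h\<bar>) * \<bar>h\<bar> ^ j" by simp
      also have "\<dots> \<le> (\<bar>h\<bar> * \<bar>h\<bar>) * 1" using elim by (intro mult_left_mono power_le_one) auto
      finally show ?case by (cases "h = 0") (auto simp: field_simps)
    qed
    show "((\<lambda>h. \<bar>h\<bar>) \<longlongrightarrow> 0) (at (0::real))" by (intro tendsto_eq_intros) auto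
  qed
  then show ?thesis using True by (simp add: DERIV_def)
qed

lemma profile_has_derivative:
  "profile \<beta> J \<Phi> \<Longrightarrow> 2 \<le> J \<Longrightarrow>
   \<exists>\<Phi>'. profile (\<beta> + 1) (J - 1) \<Phi>' \<and>
     (\<forall>e \<kappa> t. e > 0 \<longrightarrow> t > - e \<longrightarrow> (\<Phi> e \<kappa> has_real_derivative \<Phi>' e \<kappa> t) (at t))"
proof (induction rule: profile.induct)
  case (mono b j c l)
  obtain j' where j': "j = Suc (Suc j')" using mono by (metis Suc_le_D le_trans numeral_2_eq_2 Suc_le_D Suc_le_mono)
  have b1: "b + 1 \<le> \<beta> + 1" and b2: "b \<le> \<beta> + 1" and J1: "J - 1 \<le> j" and J2: "J - 1 \<le> Suc j'"
    using mono j' by auto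
  let ?p = "- (b + real l)"
  let ?\<Phi>' = "\<lambda>e \<kappa> t. (c * ?p) * e ^ l * (t + e) powr (- (b + 1) - real l) * max 0 (\<kappa> - t) ^ j
     + (- c * real j) * e ^ l * (t + e) powr (- b - real l) * max 0 (\<kappa> - t) ^ Suc j'"
  have A: "profile (\<beta> + 1) (J - 1) ?\<Phi>'"
    by (intro profile.add profile.mono b1 b2 J1 J2)
  have B: "((\<lambda>t. c * e ^ l * (t + e) powr (- b - real l) * max 0 (\<kappa> - t) ^ j) has_real_derivative ?\<Phi>' e \<kappa> t) (at t)"
    if "e > 0" "t > - e" for e \<kappa> t
  proof -
    have "((\<lambda>t. (t + e) powr (- b - real l)) has_real_derivative ?p * (t + e) powr (- (b + 1) - real l)) (at t)"
      (is "(_ has_real_derivative ?D) _")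
    proof -
      have "((\<lambda>t. (t + e) powr (- b - real l)) has_real_derivative
          (- b - real l) * (t + e) powr ((- b - real l) - real 1) * 1) (at t)"
        by (rule DERIV_fun_powr) (use that in \<open>auto intro!: derivative_eq_intros\<close>)
      moreover have "(- b - real l) - real 1 = - (b + 1) - real l" "- b - real l = ?p" by simp_all
      ultimately show ?thesis by (simp only: mult_1_right)
    qed
    from DERIV_mult[OF DERIV_cmult[OF this, of "c * e ^ l"] has_derivative_max_power[of \<kappa> j']]
    show ?thesis unfolding j' by (rule DERIV_cong) algebra
  qed
  show ?case by (intro exI[of _ ?\<Phi>'] conjI allI impI A B)
next
  case (add \<Phi> \<Psi>)
  obtain \<Phi>' \<Psi>' where *: "profile (\<beta> + 1) (J - 1) \<Phi>'" "profile (\<beta> + 1) (J - 1) \<Psi>'"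
     "\<And>e \<kappa> t. e > 0 \<Longrightarrow> t > - e \<Longrightarrow> (\<Phi> e \<kappa> has_real_derivative \<Phi>' e \<kappa> t) (at t)"
     "\<And>e \<kappa> t. e > 0 \<Longrightarrow> t > - e \<Longrightarrow> (\<Psi> e \<kappa> has_real_derivative \<Psi>' e \<kappa> t) (at t)"
    using add by blast
  have "profile (\<beta> + 1) (J - 1) (\<lambda>e \<kappa> t. \<Phi>' e \<kappa> t + \<Psi>' e \<kappa> t)" by (intro profile.add *)
  moreover have "((\<lambda>t. \<Phi> e \<kappa> t + \<Psi> e \<kappa> t) has_real_derivative \<Phi>' e \<kappa> t + \<Psi>' e \<kappa> t) (at t)" if "e > 0" "t > - e" for e \<kappa> t
    by (intro DERIV_add * that)
  ultimately show ?case by (intro exI[of _ "\<lambda>e \<kappa> t. \<Phi>' e \<kappa> t + \<Psi>' e \<kappa> t"]) blast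
next
  case (cong \<Phi> \<Psi>)
  obtain \<Phi>' where *: "profile (\<beta> + 1) (J - 1) \<Phi>'"
     "\<And>e \<kappa> t. e > 0 \<Longrightarrow> t > - e \<Longrightarrow> (\<Phi> e \<kappa> has_real_derivative \<Phi>' e \<kappa> t) (at t)"
    using cong by blast
  have "(\<Psi> e \<kappa> has_real_derivative \<Phi>' e \<kappa> t) (at t)" if "e > 0" "t > - e" for e \<kappa> t
    by (rule has_field_derivative_transform_within_open[OF *(2)[OF that], where S = "{- e<..}"])
       (use that cong.hyps in auto)
  then show ?case using * by blast
qed

lemma profile_continuous:
  "profile \<beta> J \<Phi> \<Longrightarrow> e > 0 \<Longrightarrow> continuous_on {- e<..} (\<Phi> e \<kappa>)"
proof (induction rule: profile.induct)
  case (mono b j c l)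
  then show ?case by (auto intro!: continuous_intros)
next
  case (cong \<Phi> \<Psi>)
  have "continuous_on {- e<..} (\<Psi> e \<kappa>) \<longleftrightarrow> continuous_on {- e<..} (\<Phi> e \<kappa>)"
    by (rule continuous_on_cong) (use cong in auto)
  then show ?case using cong by blast
qed (auto intro: continuous_on_add)

lemma profile_eq_0:
  "profile \<beta> J \<Phi> \<Longrightarrow> 1 \<le> J \<Longrightarrow> e > 0 \<Longrightarrow> t > - e \<Longrightarrow> t \<ge> \<kappa> \<Longrightarrow> \<Phi> e \<kappa> t = 0"
proof (induction rule: profile.induct)
  case (mono b j c l)
  then have "max 0 (\<kappa> - t) ^ j = 0" by simp
  then show ?case by simp
qed auto

lemma profile_bound:
  "profile \<beta> J \<Phi> \<Longrightarrow> 1 \<le> J \<Longrightarrow>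
   \<exists>C\<ge>0. \<forall>e \<kappa> t. 0 < e \<longrightarrow> e \<le> 1 \<longrightarrow> \<kappa> \<le> 4 \<longrightarrow> 0 \<le> t \<longrightarrow> \<bar>\<Phi> e \<kappa> t\<bar> \<le> C * (t + e) powr - \<beta>"
proof (induction rule: profile.induct)
  case (mono b j c l)
  \<comment> \<open>Where the cutoff is nonzero, \<open>t < \<kappa> \<le> 4\<close> and
    \<open>e \<le> 1\<close>, so \<open>t + e \<le> 5\<close>; this pays for replacing
    \<open>b\<close> by the larger \<open>\<beta>\<close>. The bound 4 is the squared radius of the
    ball of radius 2 that contains all later estimates.\<close>
  define C where "C = \<bar>c\<bar> * 5 powr (\<beta> - b) * 4 ^ j"
  have "\<bar>c * e ^ l * (t + e) powr (- b - real l) * max 0 (\<kappa> - t) ^ j\<bar> \<le> C * (t + e) powr - \<beta>"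
    if *: "0 < e" "e \<le> 1" "\<kappa> \<le> 4" "0 \<le> t" for e \<kappa> t
  proof (cases "t < \<kappa>")
    case False
    then have "max 0 (\<kappa> - t) = 0" by simp
    then show ?thesis using mono by (simp add: C_def zero_power)
  next
    case True
    have s: "0 < t + e" "t + e \<le> 5" using * True by auto
    have "e ^ l \<le> (t + e) ^ l" using * by (intro power_mono) auto
    then have "e ^ l * (t + e) powr (- b - real l) \<le> (t + e) powr real l * (t + e) powr (- b - real l)"
      using s by (intro mult_right_mono) (auto simp: powr_realpow)
    also have "\<dots> = (t + e) powr (\<beta> - b) * (t + e) powr - \<beta>" by (simp add: powr_add[symmetric])
    also have "\<dots> \<le> 5 powr (\<beta> - b) * (t + e) powr - \<beta>"
      using s mono by (intro mult_right_mono powr_mono2) auto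
    finally have 1: "e ^ l * (t + e) powr (- b - real l) \<le> 5 powr (\<beta> - b) * (t + e) powr - \<beta>" .
    have 2: "max 0 (\<kappa> - t) ^ j \<le> 4 ^ j" using * by (intro power_mono) auto
    have "\<bar>c * e ^ l * (t + e) powr (- b - real l) * max 0 (\<kappa> - t) ^ j\<bar>
      = \<bar>c\<bar> * ((e ^ l * (t + e) powr (- b - real l)) * max 0 (\<kappa> - t) ^ j)"
      using * by (simp add: abs_mult)
    also have "\<dots> \<le> \<bar>c\<bar> * ((5 powr (\<beta> - b) * (t + e) powr - \<beta>) * 4 ^ j)"
      using * by (intro mult_left_mono mult_mono 1 2) auto
    finally show ?thesis by (simp add: C_def mult_ac)
  qed
  then show ?case by (intro exI[of _ C]) (auto simp: C_def)
next
  case (add \<Phi> \<Psi>)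
  obtain C D where C: "C \<ge> 0" "D \<ge> 0"
     "\<And>e \<kappa> t. 0 < e \<Longrightarrow> e \<le> 1 \<Longrightarrow> \<kappa> \<le> 4 \<Longrightarrow> 0 \<le> t \<Longrightarrow> \<bar>\<Phi> e \<kappa> t\<bar> \<le> C * (t + e) powr - \<beta>"
     "\<And>e \<kappa> t. 0 < e \<Longrightarrow> e \<le> 1 \<Longrightarrow> \<kappa> \<le> 4 \<Longrightarrow> 0 \<le> t \<Longrightarrow> \<bar>\<Psi> e \<kappa> t\<bar> \<le> D * (t + e) powr - \<beta>"
    using add by blast
  have "\<bar>\<Phi> e \<kappa> t + \<Psi> e \<kappa> t\<bar> \<le> (C + D) * (t + e) powr - \<beta>"
    if "0 < e" "e \<le> 1" "\<kappa> \<le> 4" "0 \<le> t" for e \<kappa> t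
    using C(3,4)[OF that] by (simp add: distrib_right)
  then show ?case using C(1,2) by (intro exI[of _ "C + D"]) auto
next
  case (cong \<Phi> \<Psi>)
  then show ?case by simp
qed

text \<open>Two derivatives raise the singularity by two, but the second derivative occurs only
  multiplied by \<open>t\<close>, which gives one order back. So the Laplacian costs one order in
  \<open>t\<close>, that is two in the distance, and two orders of vanishing at the
  boundary.\<close>

lemma profile_radial_step:
  assumes "profile \<beta> J \<Phi>" "3 \<le> J"
  obtains \<Psi> where "profile (\<beta> + 1) (J - 2) \<Psi>" "\<And>e \<kappa>. e > 0 \<Longrightarrow> radial_step N (\<Phi> e \<kappa>) (\<Psi> e \<kappa>)"
proof -
  obtain \<Phi>' where 1: "profile (\<beta> + 1) (J - 1) \<Phi>'"
     "\<And>e \<kappa> t. e > 0 \<Longrightarrow> t > - e \<Longrightarrow> (\<Phi> e \<kappa> has_real_derivative \<Phi>' e \<kappa> t) (at t)"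
    using profile_has_derivative[OF assms(1)] assms(2) by auto
  have J1: "2 \<le> J - 1" using assms(2) by simp
  obtain \<Phi>'' where 2: "profile (\<beta> + 1 + 1) (J - 1 - 1) \<Phi>''"
     "\<And>e \<kappa> t. e > 0 \<Longrightarrow> t > - e \<Longrightarrow> (\<Phi>' e \<kappa> has_real_derivative \<Phi>'' e \<kappa> t) (at t)"
    using profile_has_derivative[OF 1(1) J1] by blast
  let ?\<Psi> = "\<lambda>e \<kappa> t. - 4 * (t * \<Phi>'' e \<kappa> t) + - 2 * N * \<Phi>' e \<kappa> t"
  have "profile (\<beta> + 1) (J - 2) ?\<Psi>"
    by (intro profile.add profile_cmult profile_weaken[OF profile_mult_t[OF 2(1)]] profile_weaken[OF 1(1)]) auto
  moreover have "radial_step N (\<Phi> e \<kappa>) (?\<Psi> e \<kappa>)" if "e > 0" for e \<kappa>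
    unfolding radial_step_def
    using 1(2)[OF that] 2(2)[OF that] that
    by (intro exI[of _ "\<Phi>' e \<kappa>"] exI[of _ "\<Phi>'' e \<kappa>"])
       (auto intro: continuous_on_subset[OF profile_continuous[OF 2(1) that]])
  ultimately show ?thesis using that by blast
qed

lemma profile_radial_chain:
  assumes "profile \<beta> J \<Phi>" "2 * k + 1 \<le> J"
  shows "\<exists>\<Psi>. profile (\<beta> + real k) (J - 2 * k) \<Psi> \<and>
    (\<forall>e \<kappa> T. e > 0 \<longrightarrow> 0 \<le> T \<longrightarrow> \<kappa> \<le> T \<longrightarrow> radial_chain N T k (\<Phi> e \<kappa>) (\<Psi> e \<kappa>))"
  using assms(2)
proof (induction k)
  case 0
  then show ?case using assms(1) by auto
next
  case (Suc k)
  obtain \<Psi> where \<Psi>: "profile (\<beta> + real k) (J - 2 * k) \<Psi>"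
    "\<And>e \<kappa> T. e > 0 \<Longrightarrow> 0 \<le> T \<Longrightarrow> \<kappa> \<le> T \<Longrightarrow> radial_chain N T k (\<Phi> e \<kappa>) (\<Psi> e \<kappa>)"
    using Suc by auto
  have J3: "3 \<le> J - 2 * k" using Suc.prems by simp
  obtain X where X: "profile (\<beta> + real k + 1) (J - 2 * k - 2) X"
    "\<And>e \<kappa>. e > 0 \<Longrightarrow> radial_step N (\<Psi> e \<kappa>) (X e \<kappa>)"
    using profile_radial_step[OF \<Psi>(1) J3, of N] by blast
  have "radial_chain N T (Suc k) (\<Phi> e \<kappa>) (X e \<kappa>)" if "e > 0" "0 \<le> T" "\<kappa> \<le> T" for e \<kappa> T
    using \<Psi>(2)[OF that] X(2)[OF that(1)] that profile_eq_0[OF \<Psi>(1)] Suc.prems by auto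
  moreover have "profile (\<beta> + real (Suc k)) (J - 2 * Suc k) X"
    by (rule profile_weaken[OF X(1)]) auto
  ultimately show ?case by blast
qed

section \<open>Iterated Laplacians of powers of \<open>\<bar>x\<bar>^2 + e\<close>\<close>

text \<open>The closed solution of the recursion coming from
  \<open>-\<Delta> s^(-c) = 4c(c+1) e s^(-c-2) + 4c(h-c-1) s^(-c-1)\<close> for
  \<open>s = \<bar>x\<bar>^2 + e\<close> in dimension \<open>2h\<close>. The factorised form shows
  at once that, for \<open>a > 0\<close>, all coefficients with \<open>j \<le> i\<close> are
  positive if \<open>a + i < h\<close>, and that only \<open>j = 0\<close> survives if
  \<open>a + i = h\<close>.\<close>

definition iter_coeff :: "real \<Rightarrow> real \<Rightarrow> nat \<Rightarrow> nat \<Rightarrow> real" where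
  "iter_coeff h a i j = 4 ^ i * real (i choose j) * pochhammer a (2 * i - j) * pochhammer (h - a - real i) j"

text \<open>\<open>iter_power h a i e\<close> is the profile of \<open>(-\<Delta>)\<^sup>i\<close> applied to \<open>(\<bar>x\<bar>\<^sup>2 + e) powr (-a)\<close> in dimension \<open>2h\<close>.\<close>

definition iter_power :: "real \<Rightarrow> real \<Rightarrow> nat \<Rightarrow> real \<Rightarrow> real \<Rightarrow> real" where
  "iter_power h a i e t = (\<Sum>j\<le>i. iter_coeff h a i j * e ^ (i - j) * (t + e) powr (- (a + 2 * real i - real j)))"

lemma iter_coeff_Suc_0:
  "iter_coeff h a (Suc i) 0 = iter_coeff h a i 0 * (4 * (a + 2 * real i) * (a + 2 * real i + 1))"
  by (simp add: iter_coeff_def pochhammer_Suc algebra_simps)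

text \<open>After removal of the common factors what is left is Pascal's rule combined with the
  absorption identity \<open>bin\<close>; see \<open>key\<close>.\<close>

lemma iter_coeff_Suc_Suc:
  assumes "j \<le> i"
  shows "iter_coeff h a (Suc i) (Suc j) =
    iter_coeff h a i (Suc j) * (4 * (a + 2 * real i - real (Suc j)) * (a + 2 * real i - real (Suc j) + 1))
    + iter_coeff h a i j * (4 * (a + 2 * real i - real j) * (h - (a + 2 * real i - real j) - 1))"
proof -
  define p where "p = 2 * i - j"
  define b where "b = h - a - real i"
  have p: "real p = 2 * real i - real j" using assms by (simp add: p_def of_nat_diff)
  have bin: "real (i choose Suc j) * (real j + 1) = real (i choose j) * (real i - real j)"
  proof -
    have "Suc j * (i choose Suc j) = (i - j) * (i choose j)"
      by (metis binomial_absorb_comp binomial_absorption mult.commute times_binomial_minus1_eq)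
    then have "real (Suc j * (i choose Suc j)) = real ((i - j) * (i choose j))" by (rule arg_cong)
    then show ?thesis using assms by (simp add: of_nat_diff algebra_simps)
  qed
  have po1: "pochhammer a (2 * Suc i - Suc j) = pochhammer a p * (a + real p)"
  proof -
    have "2 * Suc i - Suc j = Suc p" using assms by (simp add: p_def)
    then show ?thesis by (simp add: pochhammer_Suc)
  qed
  \<comment> \<open>The binomial factor stays on both sides because it vanishes for
    \<open>i = 0\<close>, where the truncated difference \<open>2 * i - Suc j\<close> would make the
    identity between Pochhammer symbols meaningless.\<close>
  have po2: "real (i choose Suc j) * pochhammer a (2 * i - Suc j) * (a + real p - 1) = real (i choose Suc j) * pochhammer a p"
  proof (cases "i = 0")
    case False
    then obtain p' where p': "p = Suc p'" using assms by (cases p) (auto simp: p_def)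
    then have "2 * i - Suc j = p'" by (simp add: p_def)
    then show ?thesis by (simp add: p' pochhammer_Suc)
  qed simp
  have po3: "pochhammer (h - a - real (Suc i)) (Suc j) = (b - 1) * pochhammer b j"
    by (simp add: pochhammer_rec b_def algebra_simps)
  have po4: "pochhammer b (Suc j) = pochhammer b j * (b + real j)" by (simp add: pochhammer_Suc)
  let ?P = "pochhammer a p" and ?B = "pochhammer b j"
  have c1: "a + 2 * real i - real (Suc j) = a + real p - 1" "a + 2 * real i - real j = a + real p"
    and c3: "a + real p - 1 + 1 = a + real p" by (simp_all add: p)
  have c2: "h - (a + real p) - 1 = b - real i + real j - 1" by (simp add: p b_def)
  have ch: "real (Suc i choose Suc j) = real (i choose j) + real (i choose Suc j)" by simp
  have L: "iter_coeff h a (Suc i) (Suc j) = 4 * 4 ^ i * (real (i choose j) + real (i choose Suc j)) * (?P * (a + real p)) * ((b - 1) * ?B)"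
    unfolding iter_coeff_def po1 po3 ch by simp
  have "iter_coeff h a i (Suc j) * (4 * (a + real p - 1) * (a + real p))
     = 4 * 4 ^ i * (real (i choose Suc j) * pochhammer a (2 * i - Suc j) * (a + real p - 1)) * (?B * (b + real j)) * (a + real p)"
    unfolding iter_coeff_def b_def[symmetric] po4 by simp
  also have "\<dots> = 4 * 4 ^ i * (real (i choose Suc j) * ?P) * (?B * (b + real j)) * (a + real p)"
    unfolding po2 ..
  finally have R1: "iter_coeff h a i (Suc j) * (4 * (a + real p - 1) * (a + real p)) = \<dots>" .
  have R2: "iter_coeff h a i j = 4 ^ i * real (i choose j) * ?P * ?B"
    unfolding iter_coeff_def b_def p_def ..
  have key: "(real (i choose j) + real (i choose Suc j)) * (b - 1)
      = real (i choose Suc j) * (b + real j) + real (i choose j) * (b - real i + real j - 1)"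
    using bin by (simp add: algebra_simps)
  have "4 * 4 ^ i * (real (i choose j) + real (i choose Suc j)) * (?P * (a + real p)) * ((b - 1) * ?B)
      = 4 * 4 ^ i * ?P * (a + real p) * ?B * ((real (i choose j) + real (i choose Suc j)) * (b - 1))"
    by (simp only: mult_ac)
  also have "\<dots> = 4 * 4 ^ i * (real (i choose Suc j) * ?P) * (?B * (b + real j)) * (a + real p)
      + 4 ^ i * real (i choose j) * ?P * ?B * (4 * (a + real p) * (b - real i + real j - 1))"
    unfolding key by (simp add: algebra_simps)
  finally show ?thesis
    unfolding c1 c2 c3 L R1 R2 .
qed

lemma sum_atMost_Suc_split:
  fixes A B :: "nat \<Rightarrow> real"
  assumes "A (Suc i) = 0"
  shows "(\<Sum>j\<le>i. A j) + (\<Sum>j\<le>i. B j) = A 0 + (\<Sum>j\<le>i. A (Suc j) + B j)"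
proof -
  have "(\<Sum>j\<le>i. A j) = (\<Sum>j\<le>Suc i. A j)" using assms by simp
  also have "\<dots> = A 0 + (\<Sum>j\<le>i. A (Suc j))" by (rule sum.atMost_Suc_shift)
  finally show ?thesis by (simp add: sum.distrib)
qed

definition iter_power' :: "real \<Rightarrow> real \<Rightarrow> nat \<Rightarrow> real \<Rightarrow> real \<Rightarrow> real" where
  "iter_power' h a i e t = (\<Sum>j\<le>i. iter_coeff h a i j * e ^ (i - j) * (- (a + 2 * real i - real j) * (t + e) powr (- (a + 2 * real i - real j) - 1)))"

definition iter_power'' :: "real \<Rightarrow> real \<Rightarrow> nat \<Rightarrow> real \<Rightarrow> real \<Rightarrow> real" where
  "iter_power'' h a i e t = (\<Sum>j\<le>i. iter_coeff h a i j * e ^ (i - j) *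
     (- (a + 2 * real i - real j) * ((- (a + 2 * real i - real j) - 1) * (t + e) powr (- (a + 2 * real i - real j) - 1 - 1))))"

lemma has_derivative_powr_shift:
  assumes "t > - e"
  shows "((\<lambda>t::real. (t + e) powr p) has_real_derivative p * (t + e) powr (p - 1)) (at t)"
proof -
  have "((\<lambda>t. (t + e) powr p) has_real_derivative p * (t + e) powr (p - real 1) * 1) (at t)"
    by (rule DERIV_fun_powr) (use assms in \<open>auto intro!: derivative_eq_intros\<close>)
  then show ?thesis by simp
qed

lemma has_derivative_iter_power:
  assumes "t > - e"
  shows "(iter_power h a i e has_real_derivative iter_power' h a i e t) (at t)"
    and "(iter_power' h a i e has_real_derivative iter_power'' h a i e t) (at t)"
  unfolding iter_power_def[abs_def] iter_power'_def iter_power'_def[abs_def] iter_power''_def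
  by (intro DERIV_sum DERIV_cmult has_derivative_powr_shift assms)+

text \<open>Substituting \<open>t = \<sigma> - e\<close> turns the image of the j-th term into
  \<open>A j + B j\<close>. \<open>A j\<close> keeps the index \<open>j\<close> at level
  \<open>Suc i\<close> while \<open>B j\<close> moves to \<open>Suc j\<close>, so
  \<open>A (Suc j)\<close> and \<open>B j\<close> carry the same power and their coefficients add
  up.\<close>

lemma iter_power_recursion:
  assumes "t > - e"
  shows "- (4 * t * iter_power'' h a i e t + 2 * (2 * h) * iter_power' h a i e t) = iter_power h a (Suc i) e t"
proof -
  define c where "c j = a + 2 * real i - real j" for j
  define \<sigma> where "\<sigma> = t + e"
  have \<sigma>: "\<sigma> > 0" using assms by (simp add: \<sigma>_def)
  define A where "A j = iter_coeff h a i j * (4 * c j * (c j + 1)) * e ^ (Suc i - j) * \<sigma> powr (- c j - 2)" for j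
  define B where "B j = iter_coeff h a i j * (4 * c j * (h - c j - 1)) * e ^ (i - j) * \<sigma> powr (- c j - 1)" for j
  have "- (4 * t * iter_power'' h a i e t + 2 * (2 * h) * iter_power' h a i e t) = (\<Sum>j\<le>i. A j + B j)"
  proof -
    have "- (4 * t * (iter_coeff h a i j * e ^ (i - j) * (- c j * ((- c j - 1) * \<sigma> powr (- c j - 1 - 1))))
        + 2 * (2 * h) * (iter_coeff h a i j * e ^ (i - j) * (- c j * \<sigma> powr (- c j - 1)))) = A j + B j" if "j \<le> i" for j
    proof -
      have "- c j - 1 = (- c j - 2) + 1" by simp
      then have 1: "\<sigma> powr (- c j - 1) = \<sigma> powr (- c j - 2) * \<sigma>"
        using \<sigma> by (simp only: powr_add powr_one)
      have 2: "e ^ (Suc i - j) = e ^ (i - j) * e" using that by (simp add: Suc_diff_le)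
      have 3: "- c j - 1 - 1 = - c j - 2" by simp
      have 4: "t = \<sigma> - e" by (simp add: \<sigma>_def)
      show ?thesis unfolding A_def B_def 3 1 2 4 by algebra
    qed
    then show ?thesis
      unfolding iter_power'_def iter_power''_def c_def[symmetric] \<sigma>_def[symmetric]
      by (simp only: sum_distrib_left sum.distrib[symmetric] sum_negf[symmetric]) (intro sum.cong, auto)
  qed
  also have "\<dots> = A 0 + (\<Sum>j\<le>i. A (Suc j) + B j)"
    unfolding sum.distrib[of A B] by (rule sum_atMost_Suc_split) (simp add: A_def iter_coeff_def)
  also have "\<dots> = (\<Sum>j\<le>Suc i. iter_coeff h a (Suc i) j * e ^ (Suc i - j) * \<sigma> powr (- (a + 2 * real (Suc i) - real j)))"
  proof -
    have z: "A 0 = iter_coeff h a (Suc i) 0 * e ^ (Suc i - 0) * \<sigma> powr (- (a + 2 * real (Suc i) - real 0))"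
      by (simp add: A_def iter_coeff_Suc_0 c_def algebra_simps)
    have s: "A (Suc j) + B j = iter_coeff h a (Suc i) (Suc j) * e ^ (Suc i - Suc j) * \<sigma> powr (- (a + 2 * real (Suc i) - real (Suc j)))"
      if "j \<le> i" for j
    proof -
      have 1: "- c (Suc j) - 2 = - (a + 2 * real (Suc i) - real (Suc j))" "- c j - 1 = - (a + 2 * real (Suc i) - real (Suc j))"
        by (simp_all add: c_def)
      show ?thesis unfolding A_def B_def 1 iter_coeff_Suc_Suc[OF that] c_def[symmetric]
        by (simp only: diff_Suc_Suc) algebra
    qed
    show ?thesis unfolding sum.atMost_Suc_shift z
      by (intro arg_cong2[of _ _ _ _ "(+)"] refl sum.cong s) simp
  qed
  also have "\<dots> = iter_power h a (Suc i) e t" by (simp add: iter_power_def \<sigma>_def)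
  finally show ?thesis .
qed

lemma iter_power_radial_step:
  assumes "e > 0"
  shows "radial_step (2 * h) (iter_power h a i e) (iter_power h a (Suc i) e)"
  unfolding radial_step_def
proof (intro exI conjI allI impI)
  fix t :: real assume "t \<ge> 0"
  then have t: "t > - e" using assms by simp
  show "(iter_power h a i e has_real_derivative iter_power' h a i e t) (at t)"
    "(iter_power' h a i e has_real_derivative iter_power'' h a i e t) (at t)"
    by (rule has_derivative_iter_power[OF t])+
  show "iter_power h a (Suc i) e t = - (4 * t * iter_power'' h a i e t + 2 * (2 * h) * iter_power' h a i e t)"
    by (rule iter_power_recursion[OF t, symmetric])
next
  show "continuous_on {0..} (iter_power'' h a i e)"
    unfolding iter_power''_def[abs_def] using assms by (auto intro!: continuous_intros)
qed

lemma radial_step_add: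
  assumes "radial_step N F G" "radial_step N F2 G2"
  shows "radial_step N (\<lambda>t. F t + F2 t) (\<lambda>t. G t + G2 t)"
proof -
  obtain F' F'' where 1: "\<And>t. t \<ge> 0 \<Longrightarrow> (F has_real_derivative F' t) (at t)"
      "\<And>t. t \<ge> 0 \<Longrightarrow> (F' has_real_derivative F'' t) (at t)" "continuous_on {0..} F''"
      "\<And>t. t \<ge> 0 \<Longrightarrow> G t = - (4 * t * F'' t + 2 * N * F' t)"
    using assms(1) by (auto simp: radial_step_def)
  obtain F2' F2'' where 2: "\<And>t. t \<ge> 0 \<Longrightarrow> (F2 has_real_derivative F2' t) (at t)"
      "\<And>t. t \<ge> 0 \<Longrightarrow> (F2' has_real_derivative F2'' t) (at t)" "continuous_on {0..} F2''"
      "\<And>t. t \<ge> 0 \<Longrightarrow> G2 t = - (4 * t * F2'' t + 2 * N * F2' t)"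
    using assms(2) by (auto simp: radial_step_def)
  show ?thesis
    unfolding radial_step_def
    by (rule exI[of _ "\<lambda>t. F' t + F2' t"], rule exI[of _ "\<lambda>t. F'' t + F2'' t"], intro conjI allI impI DERIV_add
        continuous_on_add 1(1-3) 2(1-3)) (simp_all add: 1(4) 2(4) algebra_simps)
qed

lemma profile_sum:
  "finite I \<Longrightarrow> (\<And>i. i \<in> I \<Longrightarrow> profile \<beta> J (\<Phi> i)) \<Longrightarrow> profile \<beta> J (\<lambda>e \<kappa> t. \<Sum>i\<in>I. \<Phi> i e \<kappa> t)"
proof (induction I rule: finite_induct)
  case empty
  have "profile \<beta> J (\<lambda>e \<kappa> t. 0)"
    by (rule profile.cong[OF profile.mono[of \<beta> \<beta> J J 0 0]]) auto
  then show ?case by simp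
next
  case (insert x F)
  then show ?case by (simp add: profile.add)
qed

text \<open>The j-th term exceeds the order \<open>a + i\<close> by \<open>i - j\<close> in the
  exponent, and its factor \<open>e ^ (i - j)\<close> compensates exactly this excess.\<close>

lemma profile_iter_power: "profile (a + real i) 0 (\<lambda>e \<kappa> t. iter_power h a i e t)"
  unfolding iter_power_def
proof (intro profile_sum)
  fix j assume "j \<in> {..i}"
  then have *: "- (a + real i) - real (i - j) = - (a + 2 * real i - real j)" by (simp add: of_nat_diff)
  show "profile (a + real i) 0 (\<lambda>e \<kappa> t. iter_coeff h a i j * e ^ (i - j) * (t + e) powr (- (a + 2 * real i - real j)))"
    using profile.mono[of "a + real i" "a + real i" 0 0 "iter_coeff h a i j" "i - j"] unfolding * by simp
qed auto

lemma profile_iter_power': "profile (a + real i + 1) 0 (\<lambda>e \<kappa> t. iter_power' h a i e t)"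
  unfolding iter_power'_def
proof (intro profile_sum)
  fix j assume "j \<in> {..i}"
  then have *: "- (a + real i + 1) - real (i - j) = - (a + 2 * real i - real j) - 1" by (simp add: of_nat_diff)
  show "profile (a + real i + 1) 0 (\<lambda>e \<kappa> t. iter_coeff h a i j * e ^ (i - j) * (- (a + 2 * real i - real j) * (t + e) powr (- (a + 2 * real i - real j) - 1)))"
    unfolding *[symmetric]
    by (rule profile.cong[OF profile.mono[of "a + real i + 1" "a + real i + 1" 0 0 "- (a + 2 * real i - real j) * iter_coeff h a i j" "i - j"]])
       simp_all
qed auto

text \<open>The derivatives that fall on the cutoff cost one order of singularity less than those of the main term.\<close>

lemma iter_power_cutoff_step:
  assumes "3 \<le> m"
  shows "\<exists>E. profile (a + real i) (m - 2) E \<and> (\<forall>e \<kappa>. e > 0 \<longrightarrow>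
    radial_step (2 * h) (\<lambda>t. iter_power h a i e t * max 0 (\<kappa> - t) ^ m)
      (\<lambda>t. iter_power h a (Suc i) e t * max 0 (\<kappa> - t) ^ m + E e \<kappa> t))"
proof -
  obtain j where m: "m = Suc (Suc (Suc j))" using assms by (metis Suc_le_D numeral_3_eq_3 Suc_le_mono)
  let ?\<tau> = "\<lambda>\<kappa> t::real. max 0 (\<kappa> - t)"
  define E where "E e \<kappa> t = (8 * real m) * ((t * iter_power' h a i e t) * ?\<tau> \<kappa> t ^ (m - 1))
     + ((- 4 * real m * real (m - 1)) * ((t * iter_power h a i e t) * ?\<tau> \<kappa> t ^ (m - 2))
     + (4 * h * real m) * (iter_power h a i e t * ?\<tau> \<kappa> t ^ (m - 1)))" for e \<kappa> t
  have "profile (a + real i) (m - 2) E"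
    unfolding E_def
    by (intro profile.add profile_cmult profile_weaken[OF profile_mult_tau[OF profile_mult_t[OF profile_iter_power']]]
        profile_weaken[OF profile_mult_tau[OF profile_mult_t[OF profile_iter_power]]] profile_weaken[OF profile_mult_tau[OF profile_iter_power]]) auto
  moreover have "radial_step (2 * h) (\<lambda>t. iter_power h a i e t * ?\<tau> \<kappa> t ^ m)
      (\<lambda>t. iter_power h a (Suc i) e t * ?\<tau> \<kappa> t ^ m + E e \<kappa> t)" if e: "e > 0" for e \<kappa>
  proof -
    define F' where "F' t = iter_power' h a i e t * ?\<tau> \<kappa> t ^ m + (- real m * ?\<tau> \<kappa> t ^ (m - 1)) * iter_power h a i e t" for t
    define F'' where "F'' t = (iter_power'' h a i e t * ?\<tau> \<kappa> t ^ m + (- real m * ?\<tau> \<kappa> t ^ (m - 1)) * iter_power' h a i e t)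
      + ((- real m * (- real (m - 1) * ?\<tau> \<kappa> t ^ (m - 2))) * iter_power h a i e t + iter_power' h a i e t * (- real m * ?\<tau> \<kappa> t ^ (m - 1)))" for t
    have d1: "((\<lambda>t. ?\<tau> \<kappa> t ^ m) has_real_derivative - real m * ?\<tau> \<kappa> t ^ (m - 1)) (at t)" for t
      using has_derivative_max_power[of \<kappa> "Suc j" t] by (simp add: m)
    have d2: "((\<lambda>t. ?\<tau> \<kappa> t ^ (m - 1)) has_real_derivative - real (m - 1) * ?\<tau> \<kappa> t ^ (m - 2)) (at t)" for t
      using has_derivative_max_power[of \<kappa> j t] by (simp add: m)
    have D1: "((\<lambda>t. iter_power h a i e t * ?\<tau> \<kappa> t ^ m) has_real_derivative F' t) (at t)" if "t \<ge> 0" for t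
      unfolding F'_def by (intro DERIV_mult has_derivative_iter_power d1) (use that e in auto)
    have D2: "(F' has_real_derivative F'' t) (at t)" if "t \<ge> 0" for t
      unfolding F'_def[abs_def] F''_def
      by (intro DERIV_add DERIV_mult DERIV_cmult has_derivative_iter_power d1 d2) (use that e in auto)
    have cc: "continuous_on {0..} (iter_power h a i e)" "continuous_on {0..} (iter_power' h a i e)" "continuous_on {0..} (iter_power'' h a i e)"
      unfolding iter_power_def[abs_def] iter_power'_def[abs_def] iter_power''_def[abs_def] using e by (auto intro!: continuous_intros)
    have D3: "continuous_on {0..} F''"
      unfolding F''_def by (intro continuous_intros cc)
    have D4: "iter_power h a (Suc i) e t * ?\<tau> \<kappa> t ^ m + E e \<kappa> t = - (4 * t * F'' t + 2 * (2 * h) * F' t)" if "t \<ge> 0" for t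
    proof -
      have t: "t > - e" using that e by simp
      show ?thesis
        unfolding iter_power_recursion[OF t, symmetric] E_def F'_def F''_def by algebra
    qed
    show ?thesis unfolding radial_step_def
      by (rule exI[of _ F'], rule exI[of _ F''], intro conjI allI impI D1 D2 D3 D4)
  qed
  ultimately show ?thesis by blast
qed

text \<open>At each step the new error consists of the fresh cutoff term \<open>E1\<close> and of
  the image \<open>E2\<close> of the old error. Both remain one order less singular than
  \<open>a + k\<close>, the order of the main term.\<close>

lemma iter_power_cutoff_chain:
  assumes "2 * k + 1 \<le> m"
  shows "\<exists>E. profile (a + real k - 1) (m - 2 * k) E \<and> (\<forall>e \<kappa> T. e > 0 \<longrightarrow> 0 \<le> T \<longrightarrow> \<kappa> \<le> T \<longrightarrow>
    radial_chain (2 * h) T k (\<lambda>t. iter_power h a 0 e t * max 0 (\<kappa> - t) ^ m)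
      (\<lambda>t. iter_power h a k e t * max 0 (\<kappa> - t) ^ m + E e \<kappa> t))"
  using assms
proof (induction k)
  case 0
  have "profile (a + real 0 - 1) (m - 2 * 0) (\<lambda>e \<kappa> t. 0)"
    using profile_sum[of "{}"] by simp
  then show ?case by (intro exI[of _ "\<lambda>e \<kappa> t. 0"]) simp
next
  case (Suc k)
  obtain E where E: "profile (a + real k - 1) (m - 2 * k) E"
    "\<And>e \<kappa> T. e > 0 \<Longrightarrow> 0 \<le> T \<Longrightarrow> \<kappa> \<le> T \<Longrightarrow>
    radial_chain (2 * h) T k (\<lambda>t. iter_power h a 0 e t * max 0 (\<kappa> - t) ^ m)
      (\<lambda>t. iter_power h a k e t * max 0 (\<kappa> - t) ^ m + E e \<kappa> t)"
    using Suc by auto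
  have m3: "3 \<le> m" "3 \<le> m - 2 * k" using Suc.prems by auto
  obtain E1 where E1: "profile (a + real k) (m - 2) E1" "\<And>e \<kappa>. e > 0 \<Longrightarrow>
    radial_step (2 * h) (\<lambda>t. iter_power h a k e t * max 0 (\<kappa> - t) ^ m)
      (\<lambda>t. iter_power h a (Suc k) e t * max 0 (\<kappa> - t) ^ m + E1 e \<kappa> t)"
    using iter_power_cutoff_step[OF m3(1), of a k h] by blast
  obtain E2 where E2: "profile (a + real k - 1 + 1) (m - 2 * k - 2) E2"
    "\<And>e \<kappa>. e > 0 \<Longrightarrow> radial_step (2 * h) (E e \<kappa>) (E2 e \<kappa>)"
    using profile_radial_step[OF E(1) m3(2), of "2 * h"] by blast
  have A: "profile (a + real (Suc k) - 1) (m - 2 * Suc k) (\<lambda>e \<kappa> t. E1 e \<kappa> t + E2 e \<kappa> t)"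
    by (intro profile.add profile_weaken[OF E1(1)] profile_weaken[OF E2(1)]) auto
  have B: "radial_chain (2 * h) T (Suc k) (\<lambda>t. iter_power h a 0 e t * max 0 (\<kappa> - t) ^ m)
      (\<lambda>t. iter_power h a (Suc k) e t * max 0 (\<kappa> - t) ^ m + (E1 e \<kappa> t + E2 e \<kappa> t))"
    if *: "e > 0" "0 \<le> T" "\<kappa> \<le> T" for e \<kappa> T
  proof -
    have "radial_step (2 * h) (\<lambda>t. iter_power h a k e t * max 0 (\<kappa> - t) ^ m + E e \<kappa> t)
      (\<lambda>t. iter_power h a (Suc k) e t * max 0 (\<kappa> - t) ^ m + (E1 e \<kappa> t + E2 e \<kappa> t))"
      using radial_step_add[OF E1(2)[OF *(1)] E2(2)[OF *(1)]] by (simp add: add.assoc)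
    moreover have "iter_power h a k e t * max 0 (\<kappa> - t) ^ m + E e \<kappa> t = 0" if "t \<ge> T" for t
      using that * profile_eq_0[OF E(1), of e t \<kappa>] m3 by (simp add: max_def)
    ultimately show ?thesis using E(2)[OF *] by (auto simp only: radial_chain.simps)
  qed
  show ?case by (intro exI[of _ "\<lambda>e \<kappa> t. E1 e \<kappa> t + E2 e \<kappa> t"] conjI allI impI A B)
qed

section \<open>Existence\<close>

text \<open>A class closed under partial derivatives. Since \<open>C_class\<close> iterates partial
  derivatives, closure and differentiability give every order of smoothness at once.\<close>

inductive smooth_fun :: "(real ^ 'n::finite \<Rightarrow> real) \<Rightarrow> bool" where
  const: "smooth_fun (\<lambda>x. c)"
| coord: "smooth_fun (\<lambda>x. x $ i)"
| powr: "smooth_fun (\<lambda>x. (x \<bullet> x + 1) powr b)"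
| add: "smooth_fun f \<Longrightarrow> smooth_fun g \<Longrightarrow> smooth_fun (\<lambda>x. f x + g x)"
| mult: "smooth_fun f \<Longrightarrow> smooth_fun g \<Longrightarrow> smooth_fun (\<lambda>x. f x * g x)"

lemma inner_self_plus_1_pos: "(x :: 'a::real_inner) \<bullet> x + 1 > 0"
  using inner_ge_zero[of x] by linarith

lemma inner_self_plus_1_powr_pos: "((x :: 'a::real_inner) \<bullet> x + 1) powr b > 0"
  using inner_self_plus_1_pos[of x] by simp

lemma smooth_fun_differentiable: "smooth_fun f \<Longrightarrow> f differentiable (at x)"
proof (induction rule: smooth_fun.induct)
  case (powr b)
  have "((\<lambda>s. s powr b) has_real_derivative b * (x \<bullet> x + 1) powr (b - 1)) (at (x \<bullet> x + 1))"
    using inner_self_plus_1_pos by (auto intro!: derivative_eq_intros)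
  then have "(\<lambda>s. s powr b) differentiable (at (x \<bullet> x + 1))"
    unfolding real_differentiable_def by blast
  moreover have "(\<lambda>x. x \<bullet> x + 1) differentiable (at x)"
    by (rule differentiableI[where f' = "\<lambda>h. x \<bullet> h + h \<bullet> x"]) (auto intro!: derivative_eq_intros)
  ultimately show ?case by (rule differentiable_compose[of "\<lambda>s. s powr b"])
next
  case (coord i)
  show ?case by (rule bounded_linear_imp_differentiable) (rule bounded_linear_vec_nth)
qed (auto intro: derivative_intros)

lemma smooth_fun_partial_derivative: "smooth_fun f \<Longrightarrow> smooth_fun (partial_derivative i f)"
proof (induction rule: smooth_fun.induct)
  case (const c)
  have "partial_derivative i (\<lambda>x. c) = (\<lambda>x. 0)" by (intro ext partial_derivativeI) simp
  then show ?case by (simp add: smooth_fun.const)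
next
  case (coord j)
  have "partial_derivative i (\<lambda>x. x $ j) = (\<lambda>x. axis i 1 $ j)"
    by (intro ext partial_derivativeI) (auto intro!: derivative_eq_intros)
  then show ?case by (simp add: smooth_fun.const)
next
  case (powr b)
  have "partial_derivative i (\<lambda>x. (x \<bullet> x + 1) powr b) = (\<lambda>x. (b * (x \<bullet> x + 1) powr (b - 1)) * (2 * x $ i))"
    by (intro ext partial_derivativeI radial_directional_derivative[where F = "\<lambda>s. (s + 1) powr b"] has_derivative_powr_shift)
       (simp add: minus_less_iff less_le_trans[OF _ inner_ge_zero])
  then show ?case by (simp only:) (intro smooth_fun.intros)
next
  case (add f g)
  have "partial_derivative i (\<lambda>x. f x + g x) = (\<lambda>x. partial_derivative i f x + partial_derivative i g x)"
    by (intro ext partial_derivativeI DERIV_add has_partial_derivative smooth_fun_differentiable add)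
  then show ?case using add by (simp add: smooth_fun.add)
next
  case (mult f g)
  have "partial_derivative i (\<lambda>x. f x * g x) = (\<lambda>x. partial_derivative i f x * g x + partial_derivative i g x * f x)"
  proof (intro ext partial_derivativeI)
    fix x
    show "((\<lambda>t. f (x + t *\<^sub>R axis i 1) * g (x + t *\<^sub>R axis i 1)) has_real_derivative
       partial_derivative i f x * g x + partial_derivative i g x * f x) (at 0)"
      using DERIV_mult[OF has_partial_derivative[OF smooth_fun_differentiable[OF mult(1)]]
        has_partial_derivative[OF smooth_fun_differentiable[OF mult(2)]], of x i x i]
      by simp
  qed
  then show ?case using mult by (simp add: smooth_fun.add smooth_fun.mult)
qed

lemma smooth_fun_C_class: "smooth_fun f \<Longrightarrow> C_class m f"
proof (induction m arbitrary: f)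
  case 0
  have "continuous_on UNIV f"
    by (intro differentiable_imp_continuous_on) (simp add: differentiable_on_def smooth_fun_differentiable[OF 0])
  then show ?case by simp
qed (simp add: smooth_fun_differentiable smooth_fun_partial_derivative)

lemma iter_power_0: "iter_power h a 0 e t = (t + e) powr - a"
  by (simp add: iter_power_def iter_coeff_def)

lemma neg_laplacian_power_iter_power:
  fixes h :: real
  assumes h: "2 * h = real CARD('n::finite)"
  shows "neg_laplacian_power k (\<lambda>x :: real ^ 'n. iter_power h a i 1 (x \<bullet> x)) = (\<lambda>x. iter_power h a (i + k) 1 (x \<bullet> x))"
proof (induction k arbitrary: i)
  case (Suc k)
  have "(\<lambda>x :: real ^ 'n. - laplacian (\<lambda>x. iter_power h a i 1 (x \<bullet> x)) x) = (\<lambda>x. iter_power h a (Suc i) 1 (x \<bullet> x))"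
    using radial_step_laplacian[of "iter_power h a i 1" "iter_power h a (Suc i) 1" "0 :: real ^ 'n"] iter_power_radial_step[of 1 h a i]
    by (simp add: h)
  then show ?case by (simp add: neg_laplacian_power_Suc Suc.IH del: power_Suc)
qed simp

text \<open>Dividing the closed formula by its slowest decaying power leaves \<open>R s\<close>, a
  combination of nonpositive powers of \<open>s \<ge> 1\<close> with positive coefficients. It lies
  between its constant term, the coefficient with \<open>j = k\<close>, and the sum of all
  coefficients.\<close>

lemma exists_double_bounded_coefficient:
  fixes a :: real
  assumes a: "0 < a" and ak: "2 * a + 2 * real k < real CARD('n::finite)"
  obtains c where "double_bounded c"
    "\<And>x :: real ^ 'n. neg_laplacian_power k (\<lambda>x. (x \<bullet> x + 1) powr - a) x = c x * (x \<bullet> x + 1) powr - (a + real k)"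
proof -
  define h where "h = real CARD('n) / 2"
  have h: "2 * h = real CARD('n)" by (simp add: h_def)
  define R where "R s = (\<Sum>j\<le>k. iter_coeff h a k j * s powr - real (k - j))" for s
  have cpos: "iter_coeff h a k j > 0" if "j \<le> k" for j
    unfolding iter_coeff_def using a ak that h by (intro mult_pos_pos pochhammer_pos) auto
  have eq: "neg_laplacian_power k (\<lambda>x :: real ^ 'n. (x \<bullet> x + 1) powr - a) x = R (x \<bullet> x + 1) * (x \<bullet> x + 1) powr - (a + real k)"
    for x :: "real ^ 'n"
  proof -
    have "neg_laplacian_power k (\<lambda>x :: real ^ 'n. (x \<bullet> x + 1) powr - a) x = iter_power h a k 1 (x \<bullet> x)"
      using neg_laplacian_power_iter_power[OF h, of k a 0] by (simp add: iter_power_0)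
    also have "\<dots> = (\<Sum>j\<le>k. iter_coeff h a k j * (x \<bullet> x + 1) powr - real (k - j) * (x \<bullet> x + 1) powr - (a + real k))"
      unfolding iter_power_def
    proof (rule sum.cong[OF refl])
      fix j assume "j \<in> {..k}"
      then have *: "- (a + 2 * real k - real j) = - real (k - j) + - (a + real k)" by (simp add: of_nat_diff)
      show "iter_coeff h a k j * 1 ^ (k - j) * (x \<bullet> x + 1) powr - (a + 2 * real k - real j) =
         iter_coeff h a k j * (x \<bullet> x + 1) powr - real (k - j) * (x \<bullet> x + 1) powr - (a + real k)"
        unfolding * powr_add by (simp only: power_one mult_1_right mult.assoc)
    qed
    also have "\<dots> = R (x \<bullet> x + 1) * (x \<bullet> x + 1) powr - (a + real k)"
      unfolding R_def sum_distrib_right ..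
    finally show ?thesis .
  qed
  define A where "A = iter_coeff h a k k"
  define B where "B = (\<Sum>j\<le>k. iter_coeff h a k j)"
  have A: "A > 0" using cpos by (simp add: A_def)
  have AB: "A \<le> B" unfolding A_def B_def using cpos by (intro member_le_sum) (auto intro: less_imp_le)
  have lo: "A \<le> R s" if "s \<ge> 1" for s
  proof -
    have "A = iter_coeff h a k k * s powr - real (k - k)" using that by (simp add: A_def)
    also have "\<dots> \<le> R s" unfolding R_def using cpos
      by (intro member_le_sum) (auto intro!: mult_nonneg_nonneg intro: less_imp_le)
    finally show ?thesis .
  qed
  have up: "R s \<le> B" if s: "s \<ge> 1" for s
    unfolding R_def B_def
  proof (rule sum_mono)
    fix j assume j: "j \<in> {..k}"
    have "s powr - real (k - j) \<le> s powr 0" using s by (intro powr_mono) auto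
    then have "s powr - real (k - j) \<le> 1" using s by simp
    then show "iter_coeff h a k j * s powr - real (k - j) \<le> iter_coeff h a k j"
      using cpos[of j] j by (simp add: mult_left_le)
  qed
  have "double_bounded (\<lambda>x :: real ^ 'n. R (x \<bullet> x + 1))"
    unfolding double_bounded_def
  proof (intro exI[of _ "max B (1 / A)"] conjI allI)
    show "max B (1 / A) > 0" using A AB by (simp add: less_max_iff_disj)
    fix x :: "real ^ 'n"
    have s: "x \<bullet> x + 1 \<ge> 1" by simp
    have "1 / max B (1 / A) \<le> 1 / (1 / A)" using A AB by (intro divide_left_mono) (auto simp: zero_less_divide_iff less_max_iff_disj)
    then show "1 / max B (1 / A) \<le> R (x \<bullet> x + 1)" using lo[OF s] by simp
    show "R (x \<bullet> x + 1) \<le> max B (1 / A)" using up[OF s] by simp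
  qed
  from that[OF this eq] show ?thesis .
qed

text \<open>The clause for \<open>p = q\<close> lets the scalar equation be read off from the
  diagonal case.\<close>

lemma exists_positive_system_solution:
  assumes p: "p > 0" "q > 0" "p * q > 1"
    and ex: "max (2 * real k * (p + 1) / (p * q - 1)) (2 * real k * (q + 1) / (p * q - 1)) < real CARD('n::finite) - 2 * real k"
    and k: "1 \<le> k"
  shows "\<exists>c1 c2 u v :: real ^ 'n \<Rightarrow> real. double_bounded c1 \<and> double_bounded c2 \<and>
            positive_system_solution k p q c1 c2 u v \<and> (p = q \<longrightarrow> u = v)"
proof -
  \<comment> \<open>\<open>a\<close> and \<open>b\<close> solve \<open>a + k = b q\<close> and
    \<open>b + k = a p\<close>, which match the decay of the two sides of each equation. The
    hypothesis \<open>ex\<close> says that \<open>a + k\<close> and \<open>b + k\<close> are below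
    \<open>n/2\<close>, the range in which the coefficients are positive.\<close>
  define a where "a = real k * (q + 1) / (p * q - 1)"
  define b where "b = real k * (p + 1) / (p * q - 1)"
  have a0: "a > 0" "b > 0" using p k by (simp_all add: a_def b_def)
  have a1: "2 * a + 2 * real k < real CARD('n)" "2 * b + 2 * real k < real CARD('n)"
    using ex by (simp_all add: a_def b_def)
  have ap: "- b * q = - (a + real k)" "- a * p = - (b + real k)" using p by (simp_all add: a_def b_def field_simps)
  obtain c1 where c1: "double_bounded c1"
    "\<And>x :: real ^ 'n. neg_laplacian_power k (\<lambda>x. (x \<bullet> x + 1) powr - a) x = c1 x * (x \<bullet> x + 1) powr - (a + real k)"
    using exists_double_bounded_coefficient[OF a0(1) a1(1)] by blast
  obtain c2 where c2: "double_bounded c2"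
    "\<And>x :: real ^ 'n. neg_laplacian_power k (\<lambda>x. (x \<bullet> x + 1) powr - b) x = c2 x * (x \<bullet> x + 1) powr - (b + real k)"
    using exists_double_bounded_coefficient[OF a0(2) a1(2)] by blast
  have "positive_system_solution k p q c1 c2 (\<lambda>x. (x \<bullet> x + 1) powr - a) (\<lambda>x. (x \<bullet> x + 1) powr - b)"
    unfolding positive_system_solution_def
    by (intro conjI allI smooth_fun_C_class smooth_fun.powr)
       (simp_all only: c1(2) c2(2) powr_powr ap inner_self_plus_1_powr_pos)
  moreover have "p = q \<longrightarrow> (\<lambda>x :: real ^ 'n. (x \<bullet> x + 1) powr - a) = (\<lambda>x. (x \<bullet> x + 1) powr - b)"
    by (simp add: a_def b_def)
  ultimately show ?thesis using c1(1) c2(1) by blast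
qed

section \<open>Integral inequalities\<close>

lemma set_integrable_compact:
  fixes f :: "'a::euclidean_space \<Rightarrow> real"
  shows "compact S \<Longrightarrow> continuous_on S f \<Longrightarrow> set_integrable lborel S f"
  unfolding set_integrable_def by (rule borel_integrable_compact)

lemma set_integral_nonneg:
  fixes f :: "'a \<Rightarrow> real"
  assumes "\<And>x. x \<in> S \<Longrightarrow> 0 \<le> f x"
  shows "0 \<le> (LINT x:S|M. f x)"
  unfolding set_lebesgue_integral_def
  by (intro integral_nonneg_AE AE_I2) (use assms in \<open>auto simp: indicator_def\<close>)

lemma set_integral_mono_subset:
  fixes f :: "'a \<Rightarrow> real"
  assumes "set_integrable M T f" "set_integrable M S f" "S \<subseteq> T" "\<And>x. x \<in> T \<Longrightarrow> 0 \<le> f x"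
  shows "(LINT x:S|M. f x) \<le> (LINT x:T|M. f x)"
  unfolding set_lebesgue_integral_def
  by (rule integral_mono) (use assms in \<open>auto simp: indicator_def set_integrable_def\<close>)

lemma set_integral_cball_const:
  "(LINT x:cball y r|lborel. c) = measure lborel (cball y r) * (c :: real)"
  unfolding set_lebesgue_integral_def using emeasure_lborel_cball_finite[of y r] by simp

lemma set_integral_cball_pos:
  fixes f :: "'a::euclidean_space \<Rightarrow> real"
  assumes "continuous_on (cball y r) f" "r > 0" "\<And>x. x \<in> cball y r \<Longrightarrow> f x > 0"
  shows "0 < (LINT x:cball y r|lborel. f x)"
proof -
  have "cball y r \<noteq> {}" using assms(2) by auto
  then obtain z where z: "z \<in> cball y r" "\<And>x. x \<in> cball y r \<Longrightarrow> f z \<le> f x"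
    using continuous_attains_inf[OF compact_cball _ assms(1)] by blast
  have "0 < measure lborel (cball y r) * f z" using assms z(1) content_cball_gt_0_iff[of y r]
    by (simp del: mem_cball)
  also have "\<dots> = (LINT x:cball y r|lborel. f z)" by (simp add: set_integral_cball_const)
  also have "\<dots> \<le> (LINT x:cball y r|lborel. f x)"
    by (intro set_integral_mono set_integrable_compact assms(1) z(2)) auto
  finally show ?thesis .
qed

text \<open>Young's inequality applied pointwise to \<open>f / A\<close> and \<open>g / B\<close>,
  both of integral 1, and integrated. Exponents that sum to 1 fit the later interpolations.\<close>

lemma set_integral_Hoelder:
  fixes f g :: "'a::euclidean_space \<Rightarrow> real"
  assumes S: "compact S" and f: "continuous_on S f" "\<And>x. x \<in> S \<Longrightarrow> f x > 0"
    and g: "continuous_on S g" "\<And>x. x \<in> S \<Longrightarrow> g x > 0"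
    and \<theta>: "0 \<le> \<theta>" "\<theta> \<le> 1"
    and A: "0 < (LINT x:S|lborel. f x)" and B: "0 < (LINT x:S|lborel. g x)"
  shows "(LINT x:S|lborel. f x powr \<theta> * g x powr (1 - \<theta>))
     \<le> (LINT x:S|lborel. f x) powr \<theta> * (LINT x:S|lborel. g x) powr (1 - \<theta>)"
proof -
  define A where "A = (LINT x:S|lborel. f x)"
  define B where "B = (LINT x:S|lborel. g x)"
  define D where "D = A powr \<theta> * B powr (1 - \<theta>)"
  have A0: "A > 0" and B0: "B > 0" using assms by (simp_all add: A_def B_def)
  have D0: "D > 0" using A0 B0 by (simp add: D_def)
  have fi: "set_integrable lborel S f" "set_integrable lborel S g"
    by (intro set_integrable_compact S f g)+
  have fgi: "set_integrable lborel S (\<lambda>x. f x powr \<theta> * g x powr (1 - \<theta>))"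
    using f(2) g(2) by (intro set_integrable_compact S continuous_intros f g) (auto simp: less_imp_neq[symmetric])
  have "(LINT x:S|lborel. f x powr \<theta> * g x powr (1 - \<theta>))
     \<le> (LINT x:S|lborel. (D * \<theta> / A) * f x + (D * (1 - \<theta>) / B) * g x)"
  proof (rule set_integral_mono[OF fgi])
    show "set_integrable lborel S (\<lambda>x. (D * \<theta> / A) * f x + (D * (1 - \<theta>) / B) * g x)"
      by (intro set_integral_add set_integrable_mult_right fi)
    fix x assume x: "x \<in> S"
    have "(f x / A) powr \<theta> * (g x / B) powr (1 - \<theta>) \<le> \<theta> * (f x / A) + (1 - \<theta>) * (g x / B)"
      by (rule Youngs_inequality_0) (use \<theta> f(2)[OF x] g(2)[OF x] A0 B0 in auto)
    moreover have "(f x / A) powr \<theta> * (g x / B) powr (1 - \<theta>) = f x powr \<theta> * g x powr (1 - \<theta>) / D"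
      using f(2)[OF x] g(2)[OF x] A0 B0 by (simp add: powr_divide D_def)
    ultimately show "f x powr \<theta> * g x powr (1 - \<theta>) \<le> (D * \<theta> / A) * f x + (D * (1 - \<theta>) / B) * g x"
      using D0 by (simp add: pos_divide_le_eq) (simp add: algebra_simps)
  qed
  also have "\<dots> = (D * \<theta> / A) * A + (D * (1 - \<theta>) / B) * B"
    by (subst set_integral_add(2)) (auto intro!: set_integrable_mult_right fi simp: A_def B_def)
  also have "\<dots> = D" using A0 B0 by (simp add: field_simps)
  finally show ?thesis by (simp add: D_def A_def B_def)
qed

lemma
  fixes F :: "'a::euclidean_space \<Rightarrow> 'b::euclidean_space \<Rightarrow> real"
  assumes S: "compact S" and T: "compact T" and F: "continuous_on (S \<times> T) (\<lambda>(x, y). F x y)"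
  shows set_integral_Fubini: "(LINT x:S|lborel. LINT y:T|lborel. F x y) = (LINT y:T|lborel. LINT x:S|lborel. F x y)"
    and set_integrable_fst: "set_integrable lborel S (\<lambda>x. LINT y:T|lborel. F x y)"
    and set_integrable_snd: "set_integrable lborel T (\<lambda>y. LINT x:S|lborel. F x y)"
proof -
  define G where "G x y = indicator S x *\<^sub>R (indicator T y *\<^sub>R F x y)" for x y
  have "integrable lborel (\<lambda>z. indicator (S \<times> T) z *\<^sub>R (\<lambda>(x, y). F x y) z)"
    by (intro borel_integrable_compact compact_Times S T F)
  also have "(\<lambda>z. indicator (S \<times> T) z *\<^sub>R (\<lambda>(x, y). F x y) z) = case_prod G"
    by (auto simp: G_def indicator_def fun_eq_iff)
  finally have int: "integrable (lborel \<Otimes>\<^sub>M lborel) (case_prod G)"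
    by (simp add: lborel_prod)
  have 1: "indicator S x *\<^sub>R (\<integral>y. indicator T y *\<^sub>R F x y \<partial>lborel) = (\<integral>y. G x y \<partial>lborel)" for x
    by (simp add: G_def)
  have 2: "indicator T y *\<^sub>R (\<integral>x. indicator S x *\<^sub>R F x y \<partial>lborel) = (\<integral>x. G x y \<partial>lborel)" for y
  proof -
    have "(\<integral>x. G x y \<partial>lborel) = (\<integral>x. indicator T y *\<^sub>R (indicator S x *\<^sub>R F x y) \<partial>lborel)"
      unfolding G_def by (intro Bochner_Integration.integral_cong) (auto simp: mult_ac)
    then show ?thesis by simp
  qed
  show "(LINT x:S|lborel. LINT y:T|lborel. F x y) = (LINT y:T|lborel. LINT x:S|lborel. F x y)"
    unfolding set_lebesgue_integral_def 1 2
    using lborel_pair.Fubini_integral[OF int] by simp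
  show "set_integrable lborel S (\<lambda>x. LINT y:T|lborel. F x y)"
    unfolding set_lebesgue_integral_def set_integrable_def 1
    by (rule lborel_pair.integrable_fst[OF int])
  show "set_integrable lborel T (\<lambda>y. LINT x:S|lborel. F x y)"
    unfolding set_lebesgue_integral_def set_integrable_def 2
    by (rule lborel_pair.integrable_snd[OF int])
qed

lemma set_integral_cball_affine:
  fixes f :: "'a::euclidean_space \<Rightarrow> real"
  assumes f: "continuous_on UNIV f" and r: "r > 0"
  shows "(LINT x:cball z \<rho>|lborel. f (y + r *\<^sub>R x)) = (LINT x:cball (y + r *\<^sub>R z) (r * \<rho>)|lborel. f x) / r ^ DIM('a)"
proof -
  have "indicator (cball z \<rho>) x = (indicator (cball (y + r *\<^sub>R z) (r * \<rho>)) (y + r *\<^sub>R x) :: real)" for x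
  proof -
    have "dist (y + r *\<^sub>R z) (y + r *\<^sub>R x) = r * dist z x"
      using r by (simp add: dist_norm scaleR_diff_right[symmetric])
    then show ?thesis using r by (simp add: indicator_def)
  qed
  then have "(LINT x:cball z \<rho>|lborel. f (y + r *\<^sub>R x))
    = (\<integral>x. (\<lambda>x. indicator (cball (y + r *\<^sub>R z) (r * \<rho>)) x *\<^sub>R f x) (y + r *\<^sub>R x) \<partial>lborel)"
    by (simp add: set_lebesgue_integral_def)
  also have "\<dots> = (LINT x:cball (y + r *\<^sub>R z) (r * \<rho>)|lborel. f x) / r ^ DIM('a)"
    unfolding set_lebesgue_integral_def
    by (intro integral_lborel_affine r borel_measurable_scaleR borel_measurable_indicator borel_measurable_continuous_onI f) auto
  finally show ?thesis .
qed

text \<open>Splitting off the ball of half the radius and rescaling it shows \<open>I \<le> I / 2 + const\<close> for the integral \<open>I\<close>.\<close>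

lemma regularized_kernel_integral_bound:
  fixes \<rho> :: real
  defines "b \<equiv> (real DIM('a::euclidean_space) - 1) / 2"
  assumes e: "e > 0" and \<rho>: "\<rho> > 0"
  shows "(LINT z:cball (0 :: 'a) \<rho>|lborel. (z \<bullet> z + e) powr - b) \<le> 2 * (measure lborel (cball (0 :: 'a) \<rho>) * (\<rho> / 2) powr - (2 * b))"
proof -
  have pos: "z \<bullet> z + e > 0" if "e > 0" for z :: 'a and e :: real
    using that inner_ge_zero[of z] by linarith
  have b0: "b \<ge> 0" using DIM_positive[where 'a = 'a] by (simp add: b_def)
  define K where "K e z = (z \<bullet> z + e) powr - b" for e and z :: 'a
  have cK: "continuous_on S (K e)" if "e > 0" for e S
    unfolding K_def using pos[OF that] by (intro continuous_intros) (auto simp: less_imp_neq[symmetric])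
  define I where "I = (LINT z:cball 0 \<rho>|lborel. K e z)"
  define C where "C = (\<rho> / 2) powr - (2 * b)"
  have half: "(LINT z:cball 0 (\<rho> / 2)|lborel. K e z) \<le> I / 2"
  proof -
    have "(LINT z:cball 0 \<rho>|lborel. K e (0 + (1/2) *\<^sub>R z)) = (LINT x:cball (0 + (1/2) *\<^sub>R (0::'a)) ((1/2) * \<rho>)|lborel. K e x) / (1/2) ^ DIM('a)"
      by (rule set_integral_cball_affine[OF cK[OF e]]) simp
    then have "(LINT z:cball 0 (\<rho> / 2)|lborel. K e z) = (1/2) ^ DIM('a) * (LINT z:cball 0 \<rho>|lborel. K e ((1/2) *\<^sub>R z))"
      by (simp add: field_simps)
    also have "(LINT z:cball 0 \<rho>|lborel. K e ((1/2) *\<^sub>R z)) \<le> (LINT z:cball 0 \<rho>|lborel. 2 powr (2 * b) * K e z)"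
    proof (rule set_integral_mono)
      show "set_integrable lborel (cball 0 \<rho>) (\<lambda>z. K e ((1/2) *\<^sub>R z))"
        by (intro set_integrable_compact continuous_on_compose2[OF cK[OF e, of UNIV]] continuous_intros) auto
      show "set_integrable lborel (cball 0 \<rho>) (\<lambda>z. 2 powr (2 * b) * K e z)"
        by (intro set_integrable_compact continuous_intros cK e) auto
      fix z :: 'a
      have "K e ((1/2) *\<^sub>R z) = ((1/4) * (z \<bullet> z + 4 * e)) powr - b" by (simp add: K_def algebra_simps)
      also have "\<dots> = (1/4) powr - b * (z \<bullet> z + 4 * e) powr - b"
        by (rule powr_mult)
      also have "(1/4::real) powr - b = 2 powr (2 * b)"
        by (simp add: powr_minus_divide powr_divide powr_powr[of 2 2 b, symmetric])
      \<comment> \<open>Rescaling has turned \<open>e\<close> into \<open>4 * e\<close>; a larger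
        regularization makes the kernel smaller, so the estimate returns to the same
        \<open>e\<close> and the final bound does not depend on it.\<close>
      also have "(z \<bullet> z + 4 * e) powr - b \<le> K e z"
        unfolding K_def using pos[OF e, of z] e b0 by (intro powr_mono2') auto
      finally show "K e ((1/2) *\<^sub>R z) \<le> 2 powr (2 * b) * K e z" by simp
    qed
    also have "(LINT z:cball 0 \<rho>|lborel. 2 powr (2 * b) * K e z) = 2 powr (2 * b) * I" by (simp add: I_def)
    \<comment> \<open>The kernel exponent \<open>2 * b\<close> is the dimension minus one, so the
      two scaling factors leave exactly 1/2.\<close>
    also have "(1/2) ^ DIM('a) * (2 powr (2 * b) * I) = I / 2"
    proof -
      have "2 * b + 1 = real DIM('a)" unfolding b_def by argo
      then have "(2::real) ^ DIM('a) = 2 powr (2 * b + 1)" by (simp only: powr_realpow)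
      then have "(2::real) ^ DIM('a) = 2 * 2 powr (2 * b)" by (simp add: powr_add)
      then show ?thesis by (simp add: power_one_over)
    qed
    finally show ?thesis by simp
  qed
  have "I \<le> (LINT z:cball 0 (\<rho> / 2)|lborel. K e z) + (LINT z:cball (0::'a) \<rho>|lborel. C)"
    unfolding I_def set_lebesgue_integral_def
  proof (subst Bochner_Integration.integral_add[symmetric])
    have i1: "set_integrable lborel (cball 0 (\<rho> / 2)) (K e)" "set_integrable lborel (cball 0 \<rho>) (K e)"
      "set_integrable lborel (cball (0::'a) \<rho>) (\<lambda>_. C)"
      by (intro set_integrable_compact cK e continuous_intros; simp)+
    show 1: "integrable lborel (\<lambda>z. indicator (cball 0 (\<rho> / 2)) z *\<^sub>R K e z)"
      and 2: "integrable lborel (\<lambda>z::'a. indicator (cball 0 \<rho>) z *\<^sub>R C)"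
      using i1 by (auto simp: set_integrable_def)
    show "(\<integral>z. indicator (cball 0 \<rho>) z *\<^sub>R K e z \<partial>lborel) \<le>
      (\<integral>z. indicator (cball 0 (\<rho> / 2)) z *\<^sub>R K e z + indicator (cball 0 \<rho>) z *\<^sub>R C \<partial>lborel)"
    proof (rule integral_mono)
      show "integrable lborel (\<lambda>z. indicator (cball 0 \<rho>) z *\<^sub>R K e z)" using i1 by (auto simp: set_integrable_def)
      show "integrable lborel (\<lambda>z. indicator (cball 0 (\<rho> / 2)) z *\<^sub>R K e z + indicator (cball 0 \<rho>) z *\<^sub>R C)"
        by (intro Bochner_Integration.integrable_add 1 2)
      fix z :: 'a
      have C0: "C \<ge> 0" and K0: "K e z \<ge> 0" by (simp_all add: C_def K_def)
      have "K e z \<le> C" if z: "z \<notin> cball 0 (\<rho> / 2)"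
      proof -
        have "\<rho> / 2 \<le> norm z" using z by simp
        then have "(\<rho> / 2)\<^sup>2 \<le> (norm z)\<^sup>2" using \<rho> by (intro power_mono) auto
        then have "(\<rho> / 2)\<^sup>2 \<le> z \<bullet> z + e" using e by (simp add: power2_norm_eq_inner)
        then have "K e z \<le> ((\<rho> / 2)\<^sup>2) powr - b" unfolding K_def using b0 \<rho> by (intro powr_mono2') auto
        also have "\<dots> = C" using \<rho> by (simp add: C_def powr_powr powr_numeral[symmetric] del: powr_numeral)
        finally show ?thesis .
      qed
      then show "indicator (cball 0 \<rho>) z *\<^sub>R K e z \<le> indicator (cball 0 (\<rho> / 2)) z *\<^sub>R K e z + indicator (cball 0 \<rho>) z *\<^sub>R C"
        using C0 K0 by (cases "z \<in> cball 0 (\<rho> / 2)"; cases "z \<in> cball 0 \<rho>") (simp_all del: mem_cball)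
    qed
  qed
  then have "I \<le> I / 2 + measure lborel (cball (0::'a) \<rho>) * C"
    using half by (simp add: set_integral_cball_const)
  then show ?thesis by (simp add: I_def K_def C_def)
qed

section \<open>Local estimates\<close>

lemma integral_eq_set_integral:
  fixes f :: "'a \<Rightarrow> real"
  assumes "\<And>x. x \<notin> S \<Longrightarrow> f x = 0"
  shows "integral\<^sup>L M f = (LINT x:S|M. f x)"
  unfolding set_lebesgue_integral_def
  by (rule Bochner_Integration.integral_cong) (use assms in \<open>auto simp: indicator_def\<close>)

lemma not_in_cball_iff_inner:
  fixes x y :: "'a::real_inner"
  assumes "r \<ge> 0"
  shows "y \<notin> cball x r \<longleftrightarrow> r\<^sup>2 < (y - x) \<bullet> (y - x)"
proof -
  have "y \<notin> cball x r \<longleftrightarrow> r < norm (y - x)" by (simp add: dist_norm norm_minus_commute not_le)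
  also have "\<dots> \<longleftrightarrow> r\<^sup>2 < (norm (y - x))\<^sup>2" using assms by (auto intro: power_strict_mono dest: power_less_imp_less_base)
  finally show ?thesis by (simp add: power2_norm_eq_inner)
qed

lemma profile_continuous_radial:
  fixes x :: "'a::real_inner"
  assumes "profile \<beta> J \<Phi>" "e > 0"
  shows "continuous_on S (\<lambda>y. \<Phi> e \<kappa> ((y - x) \<bullet> (y - x)))"
  by (rule continuous_on_compose2[OF profile_continuous[OF assms]])
     (use assms(2) in \<open>auto intro!: continuous_intros intro: less_le_trans[OF _ inner_ge_zero]\<close>)

lemma radial_chain_Green_cball:
  fixes x :: "real ^ 'n::finite"
  assumes w: "C_class (2 * k) w" and chain: "radial_chain (real CARD('n)) (d\<^sup>2) k F G" and d: "0 \<le> d"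
    and F: "\<And>t. d\<^sup>2 \<le> t \<Longrightarrow> F t = 0" and G: "\<And>t. d\<^sup>2 \<le> t \<Longrightarrow> G t = 0"
  shows "(LINT y:cball x d|lborel. F ((y - x) \<bullet> (y - x)) * neg_laplacian_power k w y)
       = (LINT y:cball x d|lborel. G ((y - x) \<bullet> (y - x)) * w y)"
proof -
  have out: "d\<^sup>2 \<le> (y - x) \<bullet> (y - x)" if "y \<notin> cball x d" for y
    using that not_in_cball_iff_inner[OF d, of y x] by simp
  have "(\<integral>y. F ((y - x) \<bullet> (y - x)) * neg_laplacian_power k w y \<partial>lborel)
      = (LINT y:cball x d|lborel. F ((y - x) \<bullet> (y - x)) * neg_laplacian_power k w y)"
    by (rule integral_eq_set_integral) (simp add: F[OF out] del: mem_cball)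
  moreover have "(\<integral>y. G ((y - x) \<bullet> (y - x)) * w y \<partial>lborel) = (LINT y:cball x d|lborel. G ((y - x) \<bullet> (y - x)) * w y)"
    by (rule integral_eq_set_integral) (simp add: G[OF out] del: mem_cball)
  ultimately show ?thesis using radial_chain_Green[OF w chain, of x] by simp
qed

text \<open>What the linear estimates use of either component of a solution; the nonlinearity enters
  only afterwards.\<close>

definition polysuper :: "nat \<Rightarrow> (real ^ 'n::finite \<Rightarrow> real) \<Rightarrow> bool" where
  "polysuper k u \<longleftrightarrow> C_class (2 * k) u \<and> (\<forall>x. u x > 0) \<and> (\<forall>x. neg_laplacian_power k u x \<ge> 0)"

lemma polysuperD:
  assumes "polysuper k u"
  shows "C_class (2 * k) u" "u x \<ge> 0" "neg_laplacian_power k u x \<ge> 0" "u x > 0"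
    and "continuous_on S u" "continuous_on S (neg_laplacian_power k u)" "continuous_on S (\<lambda>x. u x powr b)"
proof -
  have u: "C_class (2 * k) u" "\<And>x. u x > 0" using assms by (auto simp: polysuper_def)
  show "C_class (2 * k) u" "u x > 0" "u x \<ge> 0" "neg_laplacian_power k u x \<ge> 0"
    using assms by (auto simp: polysuper_def intro: less_imp_le)
  show c: "continuous_on S u" "continuous_on S (neg_laplacian_power k u)"
    using continuous_on_subset[OF C_class_imp_continuous[OF u(1)]]
      continuous_on_subset[OF continuous_neg_laplacian_power[OF u(1)]] by blast+
  show "continuous_on S (\<lambda>x. u x powr b)"
    using u(2) by (intro continuous_intros c) (auto simp: less_imp_neq[symmetric])
qed

text \<open>The test function is the truncated power of \<open>(r + d)^2 - \<bar>x\<bar>^2\<close>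
  with exponent \<open>m = 2k + 1\<close>, which leaves one order of vanishing after
  \<open>k\<close> Laplacians. It has no singularity, so the regularization is simply set to
  1.\<close>

lemma test_function_bound:
  shows "\<exists>C>0. \<forall>(u :: real ^ 'n::finite \<Rightarrow> real) r d. polysuper k u \<longrightarrow>
     0 < r \<longrightarrow> 0 < d \<longrightarrow> r + d \<le> 2 \<longrightarrow>
     d ^ (4 * k + 2) * (LINT x:cball 0 r|lborel. neg_laplacian_power k u x) \<le> C * (LINT x:cball 0 (r + d)|lborel. u x)"
proof -
  define m where "m = 2 * k + 1"
  define \<Phi> where "\<Phi> e \<kappa> t = max 0 (\<kappa> - t) ^ m" for e \<kappa> t :: real
  have \<Phi>: "profile 0 m \<Phi>"
    by (rule profile.cong[OF profile.mono[of 0 0 m m 1 0]]) (auto simp: \<Phi>_def)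
  obtain \<Psi> where \<Psi>: "profile (0 + real k) (m - 2 * k) \<Psi>"
    "\<And>e \<kappa> T. e > 0 \<Longrightarrow> 0 \<le> T \<Longrightarrow> \<kappa> \<le> T \<Longrightarrow> radial_chain (real CARD('n)) T k (\<Phi> e \<kappa>) (\<Psi> e \<kappa>)"
    using profile_radial_chain[OF \<Phi>, of k "real CARD('n)"] by (auto simp: m_def)
  have m1: "1 \<le> m - 2 * k" by (simp add: m_def)
  obtain C where C: "C \<ge> 0"
    "\<And>e \<kappa> t. 0 < e \<Longrightarrow> e \<le> 1 \<Longrightarrow> \<kappa> \<le> 4 \<Longrightarrow> 0 \<le> t \<Longrightarrow> \<bar>\<Psi> e \<kappa> t\<bar> \<le> C * (t + e) powr - (0 + real k)"
    using profile_bound[OF \<Psi>(1) m1] by blast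
  have main: "d ^ (4 * k + 2) * (LINT x:cball 0 r|lborel. neg_laplacian_power k u x) \<le> (C + 1) * (LINT x:cball 0 (r + d)|lborel. u x)"
    if sup: "polysuper k u" and r: "0 < r" "0 < d" "r + d \<le> 2"
    for u :: "real ^ 'n \<Rightarrow> real" and r d
  proof -
    define \<kappa> where "\<kappa> = (r + d)\<^sup>2"
    have \<kappa>: "0 \<le> \<kappa>" "\<kappa> \<le> 4" using r power_mono[of "r + d" 2 2] by (auto simp: \<kappa>_def)
    let ?f = "neg_laplacian_power k u"
    note u = polysuperD[OF sup] and cu = polysuperD(5)[OF sup] and cf = polysuperD(6)[OF sup]
    have c\<Phi>: "continuous_on S (\<lambda>y. \<Phi> 1 \<kappa> (y \<bullet> y))" and c\<Psi>: "continuous_on S (\<lambda>y. \<Psi> 1 \<kappa> (y \<bullet> y))" for S :: "(real ^ 'n) set"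
      using profile_continuous_radial[OF \<Phi>, of 1 S \<kappa> 0] profile_continuous_radial[OF \<Psi>(1), of 1 S \<kappa> 0] by simp_all
    have "\<Phi> 1 \<kappa> t = 0" "\<Psi> 1 \<kappa> t = 0" if "\<kappa> \<le> t" for t
    proof -
      have "t > - 1" using that \<kappa>(1) by linarith
      then show "\<Phi> 1 \<kappa> t = 0" "\<Psi> 1 \<kappa> t = 0"
        using that profile_eq_0[OF \<Phi>] profile_eq_0[OF \<Psi>(1) m1] by (simp_all add: m_def)
    qed
    then have eq: "(LINT y:cball 0 (r + d)|lborel. \<Phi> 1 \<kappa> (y \<bullet> y) * ?f y) = (LINT y:cball 0 (r + d)|lborel. \<Psi> 1 \<kappa> (y \<bullet> y) * u y)"
      using radial_chain_Green_cball[OF u(1) \<Psi>(2)[of 1 \<kappa> \<kappa>, unfolded \<kappa>_def], of 0] \<kappa> r by (simp add: \<kappa>_def)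
    have "d ^ (4 * k + 2) * (LINT x:cball 0 r|lborel. ?f x) = (LINT x:cball 0 r|lborel. d ^ (4 * k + 2) * ?f x)" by simp
    also have "\<dots> \<le> (LINT x:cball 0 r|lborel. \<Phi> 1 \<kappa> (x \<bullet> x) * ?f x)"
    proof (rule set_integral_mono)
      fix x :: "real ^ 'n" assume "x \<in> cball 0 r"
      then have "x \<bullet> x \<le> r\<^sup>2" using not_in_cball_iff_inner[of r x 0] r by simp
      moreover have "\<kappa> = r\<^sup>2 + d\<^sup>2 + 2 * r * d" "0 \<le> 2 * r * d" using r by (simp_all add: \<kappa>_def power2_sum)
      ultimately have "d\<^sup>2 \<le> \<kappa> - x \<bullet> x" by linarith
      \<comment> \<open>On the smaller ball the cutoff is at least \<open>(d^2)^m\<close>, which is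
        the origin of the exponent \<open>4 * k + 2\<close> throughout.\<close>
      then have "(d\<^sup>2) ^ m \<le> max 0 (\<kappa> - x \<bullet> x) ^ m" by (intro power_mono) auto
      also have "(d\<^sup>2) ^ m = d ^ (4 * k + 2)" by (simp add: m_def power_mult[symmetric] del: power_Suc)
      finally show "d ^ (4 * k + 2) * ?f x \<le> \<Phi> 1 \<kappa> (x \<bullet> x) * ?f x" unfolding \<Phi>_def by (intro mult_right_mono u(3))
    qed (intro set_integrable_compact continuous_intros cf c\<Phi>; simp)+
    also have "\<dots> \<le> (LINT y:cball 0 (r + d)|lborel. \<Phi> 1 \<kappa> (y \<bullet> y) * ?f y)"
      by (rule set_integral_mono_subset)
         (use r u(3) in \<open>auto intro!: set_integrable_compact continuous_intros cf c\<Phi> mult_nonneg_nonneg simp: \<Phi>_def\<close>)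
    also note eq
    also have "(LINT y:cball 0 (r + d)|lborel. \<Psi> 1 \<kappa> (y \<bullet> y) * u y) \<le> (LINT y:cball 0 (r + d)|lborel. (C + 1) * u y)"
    proof (rule set_integral_mono)
      fix y :: "real ^ 'n" assume "y \<in> cball 0 (r + d)"
      have "\<Psi> 1 \<kappa> (y \<bullet> y) \<le> C * (y \<bullet> y + 1) powr - (0 + real k)"
        using C(2)[of 1 \<kappa> "y \<bullet> y"] \<kappa> by auto
      also have "\<dots> \<le> C * (y \<bullet> y + 1) powr 0" using C(1) by (intro mult_left_mono powr_mono) auto
      also have "\<dots> \<le> C + 1" using C(1) inner_self_plus_1_pos[of y] by simp
      finally show "\<Psi> 1 \<kappa> (y \<bullet> y) * u y \<le> (C + 1) * u y" by (intro mult_right_mono u(2))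
    qed (intro set_integrable_compact continuous_intros cu c\<Psi>; simp)+
    finally show ?thesis by simp
  qed
  show ?thesis
    by (rule exI[of _ "C + 1"]) (use C(1) main in auto)
qed

text \<open>For \<open>a = h - k\<close>, the exponent of the fundamental solution, only one term survives; as \<open>e\<close> tends to 0 it is an
  approximate identity.\<close>

lemma iter_power_critical:
  assumes "a + real k = h"
  shows "iter_power h a k e t = 4 ^ k * pochhammer a (2 * k) * e ^ k * (t + e) powr - (a + 2 * real k)"
proof -
  have "iter_coeff h a k j = 0" if "j \<noteq> 0" for j
  proof -
    have "h - a - real k = 0" using assms by simp
    then show ?thesis using that by (simp add: iter_coeff_def pochhammer_0_left)
  qed
  then have "iter_power h a k e t = (\<Sum>j\<in>{0}. iter_coeff h a k j * e ^ (k - j) * (t + e) powr (- (a + 2 * real k - real j)))"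
    unfolding iter_power_def by (intro sum.mono_neutral_right) auto
  also have "\<dots> = 4 ^ k * pochhammer a (2 * k) * e ^ k * (t + e) powr - (a + 2 * real k)"
    by (simp add: iter_coeff_def)
  finally show ?thesis .
qed

text \<open>Green's identity for the truncated power with the critical exponent. The left side is an
  approximate identity acting on \<open>u\<close>. The potential of \<open>(-\<Delta>)^k u\<close>
  has order \<open>h - k\<close> and the cutoff error has order \<open>h - 1\<close>; both fit under
  one kernel of order \<open>h - 1\<close>, which behaves like the distance to the power
  \<open>-(n - 2)\<close>.\<close>

lemma regularized_representation:
  fixes k :: nat
  assumes k: "1 \<le> k" "2 * real k < real CARD('n::finite)"
  defines "h \<equiv> real CARD('n) / 2"
  defines "a \<equiv> h - real k"
  shows "\<exists>C>0. \<forall>(u :: real ^ 'n \<Rightarrow> real) x d e. polysuper k u \<longrightarrow>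
     0 < d \<longrightarrow> d \<le> 1 \<longrightarrow> 0 < e \<longrightarrow> e \<le> 1 \<longrightarrow>
     (LINT y:cball x d|lborel. e ^ k * ((y - x) \<bullet> (y - x) + e) powr - (a + 2 * real k) * max 0 (d\<^sup>2 - (y - x) \<bullet> (y - x)) ^ (2 * k + 1) * u y)
     \<le> C * (LINT y:cball x d|lborel. ((y - x) \<bullet> (y - x) + e) powr - (h - 1) * (neg_laplacian_power k u y + u y))"
proof -
  define m where "m = 2 * k + 1"
  have m1: "1 \<le> m - 2 * k" "1 \<le> m" by (simp_all add: m_def)
  define \<Phi> where "\<Phi> e \<kappa> t = iter_power h a 0 e t * max 0 (\<kappa> - t) ^ m" for e \<kappa> t :: real
  have a: "a > 0" "a + real k = h" using k by (simp_all add: a_def h_def)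
  define c0 where "c0 = 4 ^ k * pochhammer a (2 * k)"
  have c0: "c0 > 0" using a by (simp add: c0_def pochhammer_pos)
  obtain E where E: "profile (a + real k - 1) (m - 2 * k) E"
    "\<And>e \<kappa> T. e > 0 \<Longrightarrow> 0 \<le> T \<Longrightarrow> \<kappa> \<le> T \<Longrightarrow>
    radial_chain (2 * h) T k (\<Phi> e \<kappa>) (\<lambda>t. iter_power h a k e t * max 0 (\<kappa> - t) ^ m + E e \<kappa> t)"
    using iter_power_cutoff_chain[of k m a h] unfolding \<Phi>_def m_def by blast
  have \<Phi>': "profile (a + real 0) (0 + m) \<Phi>" unfolding \<Phi>_def by (rule profile_mult_tau[OF profile_iter_power])
    \<comment> \<open>Here \<open>1 \<le> k\<close> is used: the order \<open>h - k\<close> of the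
      potential may be raised to \<open>h - 1\<close>.\<close>
    have \<Phi>: "profile (h - 1) m \<Phi>" by (rule profile_weaken[OF \<Phi>']) (use a k in auto)
    have E1: "profile (h - 1) (m - 2 * k) E" using E(1) a by simp
    obtain C1 where C1: "C1 \<ge> 0"
      "\<And>e \<kappa> t. 0 < e \<Longrightarrow> e \<le> 1 \<Longrightarrow> \<kappa> \<le> 4 \<Longrightarrow> 0 \<le> t \<Longrightarrow> \<bar>\<Phi> e \<kappa> t\<bar> \<le> C1 * (t + e) powr - (h - 1)"
      using profile_bound[OF \<Phi> m1(2)] by blast
    obtain C2 where C2: "C2 \<ge> 0"
      "\<And>e \<kappa> t. 0 < e \<Longrightarrow> e \<le> 1 \<Longrightarrow> \<kappa> \<le> 4 \<Longrightarrow> 0 \<le> t \<Longrightarrow> \<bar>E e \<kappa> t\<bar> \<le> C2 * (t + e) powr - (h - 1)"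
      using profile_bound[OF E1 m1(1)] by blast
    define C where "C = (C1 + C2 + 1) / c0"
    have C: "C > 0" using C1(1) C2(1) c0 by (simp add: C_def)
    show ?thesis
    proof (rule exI[of _ C], intro conjI allI impI C)
      fix u :: "real ^ 'n \<Rightarrow> real" and x :: "real ^ 'n" and d e :: real
      assume sup: "polysuper k u" and d: "0 < d" "d \<le> 1" "0 < e" "e \<le> 1"
      let ?f = "neg_laplacian_power k u"
      let ?\<sigma> = "\<lambda>y. (y - x) \<bullet> (y - x)"
      define \<kappa> where "\<kappa> = d\<^sup>2"
      have \<kappa>: "0 \<le> \<kappa>" "\<kappa> \<le> 4" using d power_mono[of d 1 2] by (auto simp: \<kappa>_def)
      note u = polysuperD[OF sup] and cu = polysuperD(5)[OF sup] and cf = polysuperD(6)[OF sup]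
      have \<sigma>pos: "?\<sigma> y + e > 0" for y using d inner_ge_zero[of "y - x"] by linarith
      have c\<sigma>: "continuous_on S (\<lambda>y. (?\<sigma> y + e) powr b)" for S b
        using \<sigma>pos by (intro continuous_intros) (auto simp: less_imp_neq[symmetric])
      have c\<Phi>: "continuous_on S (\<lambda>y. \<Phi> e \<kappa> (?\<sigma> y))" and cE: "continuous_on S (\<lambda>y. E e \<kappa> (?\<sigma> y))" for S
        using profile_continuous_radial[OF \<Phi> d(3)] profile_continuous_radial[OF E1 d(3)] by auto
      define M where "M y = e ^ k * (?\<sigma> y + e) powr - (a + 2 * real k) * max 0 (\<kappa> - ?\<sigma> y) ^ m" for y
      have cM: "continuous_on S M" for S unfolding M_def by (intro continuous_intros c\<sigma>)
      have 0: "\<Phi> e \<kappa> t = 0" "E e \<kappa> t = 0" "max 0 (\<kappa> - t) ^ m = 0" if "\<kappa> \<le> t" for t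
      proof -
        have t: "- e < t" using that \<kappa>(1) d by linarith
        show "\<Phi> e \<kappa> t = 0" by (rule profile_eq_0[OF \<Phi> m1(2) d(3) t that])
        show "E e \<kappa> t = 0" by (rule profile_eq_0[OF E1 m1(1) d(3) t that])
        show "max 0 (\<kappa> - t) ^ m = 0" using that by (simp add: max_def m_def)
      qed
      have "(LINT y:cball x d|lborel. \<Phi> e \<kappa> (?\<sigma> y) * ?f y)
         = (LINT y:cball x d|lborel. (iter_power h a k e (?\<sigma> y) * max 0 (\<kappa> - ?\<sigma> y) ^ m + E e \<kappa> (?\<sigma> y)) * u y)"
        by (rule radial_chain_Green_cball[OF u(1)])
           (use E(2)[OF d(3) \<kappa>(1), of \<kappa>] d 0 in \<open>simp_all add: h_def \<kappa>_def\<close>)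
      moreover have "(iter_power h a k e (?\<sigma> y) * max 0 (\<kappa> - ?\<sigma> y) ^ m + E e \<kappa> (?\<sigma> y)) * u y = c0 * (M y * u y) + E e \<kappa> (?\<sigma> y) * u y" for y
        unfolding iter_power_critical[OF a(2)] M_def c0_def by (simp add: algebra_simps)
      moreover have iM: "set_integrable lborel (cball x d) (\<lambda>y. M y * u y)"
        and iE: "set_integrable lborel (cball x d) (\<lambda>y. E e \<kappa> (?\<sigma> y) * u y)"
        by (intro set_integrable_compact continuous_intros cM cu cE; simp)+
      ultimately have eq: "(LINT y:cball x d|lborel. \<Phi> e \<kappa> (?\<sigma> y) * ?f y)
          = c0 * (LINT y:cball x d|lborel. M y * u y) + (LINT y:cball x d|lborel. E e \<kappa> (?\<sigma> y) * u y)"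
        by (simp add: set_integral_add(2))
      let ?K = "\<lambda>y. (?\<sigma> y + e) powr - (h - 1)"
      have iPhi: "set_integrable lborel (cball x d) (\<lambda>y. \<Phi> e \<kappa> (?\<sigma> y) * ?f y)"
        by (intro set_integrable_compact continuous_intros c\<Phi> cf; simp)
      have iR: "set_integrable lborel (cball x d) (\<lambda>y. (C1 + C2 + 1) * (?K y * (?f y + u y)))"
        by (intro set_integrable_compact continuous_intros c\<sigma> cf cu; simp)
      have "c0 * (LINT y:cball x d|lborel. M y * u y) = (LINT y:cball x d|lborel. \<Phi> e \<kappa> (?\<sigma> y) * ?f y - E e \<kappa> (?\<sigma> y) * u y)"
        using eq iPhi iE by (simp add: set_integral_diff(2))
      also have "\<dots> \<le> (LINT y:cball x d|lborel. (C1 + C2 + 1) * (?K y * (?f y + u y)))"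
      proof (rule set_integral_mono[OF set_integral_diff(1)[OF iPhi iE] iR])
        fix y
        have K0: "?K y \<ge> 0" by simp
        have f0: "?f y \<ge> 0" "u y \<ge> 0" using u by auto
        have "\<Phi> e \<kappa> (?\<sigma> y) * ?f y \<le> C1 * ?K y * ?f y"
          using C1(2)[OF d(3,4) \<kappa>(2), of "?\<sigma> y"] f0 by (intro mult_right_mono) auto
        moreover have "- E e \<kappa> (?\<sigma> y) * u y \<le> C2 * ?K y * u y"
          using C2(2)[OF d(3,4) \<kappa>(2), of "?\<sigma> y"] f0 by (intro mult_right_mono) auto
        moreover have "C1 * ?K y * ?f y + C2 * ?K y * u y \<le> (C1 + C2 + 1) * (?K y * (?f y + u y))"
        proof -
          have "(C1 + C2 + 1) * (?K y * (?f y + u y)) - (C1 * ?K y * ?f y + C2 * ?K y * u y)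
            = (C2 + 1) * (?K y * ?f y) + (C1 + 1) * (?K y * u y)" by (simp add: algebra_simps)
          also have "\<dots> \<ge> 0" using C1(1) C2(1) K0 f0 by (intro add_nonneg_nonneg mult_nonneg_nonneg) auto
          finally show ?thesis by simp
        qed
        ultimately show "\<Phi> e \<kappa> (?\<sigma> y) * ?f y - E e \<kappa> (?\<sigma> y) * u y \<le> (C1 + C2 + 1) * (?K y * (?f y + u y))" by linarith
      qed
      also have "\<dots> = (C1 + C2 + 1) * (LINT y:cball x d|lborel. ?K y * (?f y + u y))" by simp
      finally have "(LINT y:cball x d|lborel. M y * u y) \<le> C * (LINT y:cball x d|lborel. ?K y * (?f y + u y))"
        using c0 by (simp add: C_def field_simps)
      then show "(LINT y:cball x d|lborel. e ^ k * (?\<sigma> y + e) powr - (a + 2 * real k) * max 0 (d\<^sup>2 - ?\<sigma> y) ^ (2 * k + 1) * u y)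
         \<le> C * (LINT y:cball x d|lborel. ?K y * (?f y + u y))"
        by (simp add: M_def \<kappa>_def m_def)
    qed
qed

text \<open>On the ball of radius \<open>sqrt e\<close> the approximate identity has mass bounded
  below independently of \<open>e\<close>. A lower bound \<open>w\<close> for \<open>u\<close> on
  that ball takes the place of the value \<open>u x\<close>, so that \<open>e\<close> can stay
  positive. The condition \<open>e \<le> d^2 / 2\<close> keeps the cutoff at least
  \<open>d^2 / 2\<close> there.\<close>

lemma regularized_pointwise_bound:
  fixes k :: nat
  assumes k: "1 \<le> k" "2 * real k < real CARD('n::finite)"
  defines "h \<equiv> real CARD('n) / 2"
  shows "\<exists>C>0. \<forall>(u :: real ^ 'n \<Rightarrow> real) x d e w. polysuper k u \<longrightarrow>
     0 < d \<longrightarrow> d \<le> 1 \<longrightarrow> 0 < e \<longrightarrow> e \<le> d\<^sup>2 / 2 \<longrightarrow> (\<forall>y\<in>cball x (sqrt e). w \<le> u y) \<longrightarrow>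
     d ^ (4 * k + 2) * w
     \<le> C * (LINT y:cball x d|lborel. ((y - x) \<bullet> (y - x) + e) powr - (h - 1) * (neg_laplacian_power k u y + u y))"
proof -
  define a where "a = h - real k"
  define m where "m = 2 * k + 1"
  have a: "a > 0" using k by (simp add: a_def h_def)
  obtain C where C: "C > 0" and rep: "\<And>(u :: real ^ 'n \<Rightarrow> real) x d e. polysuper k u \<Longrightarrow>
     0 < d \<Longrightarrow> d \<le> 1 \<Longrightarrow> 0 < e \<Longrightarrow> e \<le> 1 \<Longrightarrow>
     (LINT y:cball x d|lborel. e ^ k * ((y - x) \<bullet> (y - x) + e) powr - (a + 2 * real k) * max 0 (d\<^sup>2 - (y - x) \<bullet> (y - x)) ^ m * u y)
     \<le> C * (LINT y:cball x d|lborel. ((y - x) \<bullet> (y - x) + e) powr - (h - 1) * (neg_laplacian_power k u y + u y))"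
    using regularized_representation[OF k] unfolding a_def h_def m_def by blast
  define \<omega> where "\<omega> = unit_ball_vol (real CARD('n))"
  have \<omega>: "\<omega> > 0" by (simp add: \<omega>_def)
  define D where "D = C * 2 ^ m * 2 powr (a + 2 * real k) / \<omega>"
  have D: "D > 0" using C \<omega> by (simp add: D_def)
  show ?thesis
  proof (rule exI[of _ D], intro conjI allI impI D)
    fix u :: "real ^ 'n \<Rightarrow> real" and x :: "real ^ 'n" and d e w :: real
    assume sup: "polysuper k u"
      and d: "0 < d" "d \<le> 1" "0 < e" "e \<le> d\<^sup>2 / 2" and w: "\<forall>y\<in>cball x (sqrt e). w \<le> u y"
    note u = polysuperD[OF sup] and cu = polysuperD(5)[OF sup]
    let ?\<sigma> = "\<lambda>y. (y - x) \<bullet> (y - x)"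
    define I where "I = (LINT y:cball x d|lborel. (?\<sigma> y + e) powr - (h - 1) * (neg_laplacian_power k u y + u y))"
    have I0: "I \<ge> 0" unfolding I_def by (rule set_integral_nonneg) (use u in auto)
    have d1: "d\<^sup>2 \<le> 1" using d power_mono[of d 1 2] by auto
    have e1: "e \<le> 1" using d d1 by simp
    have sed: "sqrt e \<le> d" using d by (intro real_le_lsqrt) auto
    show "d ^ (4 * k + 2) * w \<le> D * I"
    \<comment> \<open>\<open>w\<close> will be \<open>u x\<close> minus a small number and may be
      negative, where the multiplication by the mass below would reverse the inequality.\<close>
    proof (cases "w \<le> 0")
      case True
      then have "d ^ (4 * k + 2) * w \<le> 0" using d by (intro mult_nonneg_nonpos) auto
      also have "0 \<le> D * I" using D I0 by simp
      finally show ?thesis .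
    next
      case False
      have \<sigma>pos: "?\<sigma> y + e > 0" for y using d inner_ge_zero[of "y - x"] by linarith
      define M where "M y = e ^ k * (?\<sigma> y + e) powr - (a + 2 * real k) * max 0 (d\<^sup>2 - ?\<sigma> y) ^ m" for y
      have cM: "continuous_on S M" for S
        unfolding M_def using \<sigma>pos by (intro continuous_intros) (auto simp: less_imp_neq[symmetric])
      have M0: "M y \<ge> 0" for y using d by (simp add: M_def)
      define c where "c = e ^ k * (2 * e) powr - (a + 2 * real k) * (d\<^sup>2 / 2) ^ m"
      have "measure lborel (cball x (sqrt e)) * (c * w) = (LINT y:cball x (sqrt e)|lborel. c * w)"
        by (simp add: set_integral_cball_const)
      also have "\<dots> \<le> (LINT y:cball x (sqrt e)|lborel. M y * u y)"
      proof (rule set_integral_mono)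
        fix y assume y: "y \<in> cball x (sqrt e)"
        then have \<sigma>: "?\<sigma> y \<le> e" using not_in_cball_iff_inner[of "sqrt e" y x] d by simp
        have "c \<le> M y" unfolding c_def M_def
        proof (intro mult_mono power_mono)
          show "(2 * e) powr - (a + 2 * real k) \<le> (?\<sigma> y + e) powr - (a + 2 * real k)"
            using \<sigma> \<sigma>pos[of y] a by (intro powr_mono2') auto
          show "d\<^sup>2 / 2 \<le> max 0 (d\<^sup>2 - ?\<sigma> y)" using \<sigma> d by simp
        qed (use d in auto)
        then show "c * w \<le> M y * u y" using w y False M0 by (intro mult_mono) auto
      qed (intro set_integrable_compact continuous_intros cM cu; simp)+
      also have "\<dots> \<le> (LINT y:cball x d|lborel. M y * u y)"
        by (rule set_integral_mono_subset)
          (use sed M0 u in \<open>auto intro!: set_integrable_compact continuous_intros cM cu mult_nonneg_nonneg\<close>)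
      also have "\<dots> \<le> C * I"
        using rep[OF sup d(1,2,3) e1] by (simp add: M_def I_def)
      finally have 1: "measure lborel (cball x (sqrt e)) * (c * w) \<le> C * I" .
      have "measure lborel (cball x (sqrt e)) = \<omega> * sqrt e ^ CARD('n)"
        using content_cball[of "sqrt e" x] d by (simp add: \<omega>_def)
      also have "sqrt e ^ CARD('n) = e powr h"
      proof -
        have "sqrt e ^ CARD('n) = (e powr (1 / 2)) powr real CARD('n)"
          using d by (simp add: powr_realpow powr_half_sqrt)
        also have "\<dots> = e powr h" by (simp add: powr_powr h_def)
        finally show ?thesis .
      qed
      finally have 2: "measure lborel (cball x (sqrt e)) = \<omega> * e powr h" .
      \<comment> \<open>The volume contributes \<open>e^h\<close>, the approximate identity
        \<open>e^k e^(-(a + 2k))\<close>; as \<open>a = h - k\<close>, all powers of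
        \<open>e\<close> cancel.\<close>
      have "e powr h * (e ^ k * (2 * e) powr - (a + 2 * real k))
        = 2 powr - (a + 2 * real k) * (e powr h * e powr real k * e powr - (a + 2 * real k))"
        using d by (simp add: powr_mult powr_realpow)
      also have "e powr h * e powr real k * e powr - (a + 2 * real k) = e powr (h + real k + - (a + 2 * real k))"
        by (simp only: powr_add)
      also have "h + real k + - (a + 2 * real k) = 0" by (simp add: a_def)
      also have "e powr 0 = 1" using d by simp
      finally have 3: "e powr h * (e ^ k * (2 * e) powr - (a + 2 * real k)) = 2 powr - (a + 2 * real k)" by simp
      have 4: "(d\<^sup>2 / 2) ^ m = d ^ (4 * k + 2) / 2 ^ m"
        by (simp add: m_def power_divide power_mult[symmetric] del: power_Suc)
      have "\<omega> * (2 powr - (a + 2 * real k) * (d ^ (4 * k + 2) / 2 ^ m)) * w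
         = \<omega> * (e powr h * (e ^ k * (2 * e) powr - (a + 2 * real k)) * (d\<^sup>2 / 2) ^ m) * w"
        by (simp only: 3 4)
      also have "\<dots> = measure lborel (cball x (sqrt e)) * (c * w)" unfolding 2 c_def by (simp only: mult_ac)
      also note 1
      finally have "\<omega> * (2 powr - (a + 2 * real k) * (d ^ (4 * k + 2) / 2 ^ m)) * w \<le> C * I" .
      moreover have "\<omega> * (2 powr - (a + 2 * real k) * (d ^ (4 * k + 2) / 2 ^ m)) * w
        = (d ^ (4 * k + 2) * w) * (\<omega> / (2 ^ m * 2 powr (a + 2 * real k)))"
        by (simp only: powr_minus_divide) (simp add: mult_ac)
      ultimately have "(d ^ (4 * k + 2) * w) * (\<omega> / (2 ^ m * 2 powr (a + 2 * real k))) \<le> C * I" by simp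
      then show ?thesis using \<omega> by (simp add: D_def field_simps)
    qed
  qed
qed

text \<open>This determines \<open>\<theta>\<close>: the kernel of order \<open>n - 2\<close> in the
  distance is the power \<open>1 - \<theta>\<close> of one of order \<open>n - 1\<close>, which is
  still integrable uniformly in \<open>e\<close>. Hoelder's inequality with weights
  \<open>\<theta>\<close> and \<open>1 - \<theta>\<close> then separates \<open>u\<close> from the
  kernel.\<close>

lemma kernel_Hoelder_bound:
  assumes N: "3 \<le> CARD('n::finite)"
  defines "\<theta> \<equiv> 1 / (real CARD('n) - 1)"
  shows "\<exists>C>0. \<forall>(u :: real ^ 'n \<Rightarrow> real) r y e. continuous_on UNIV u \<longrightarrow> (\<forall>x. u x > 0) \<longrightarrow> 0 < r \<longrightarrow> r \<le> 2 \<longrightarrow> 0 < e \<longrightarrow> y \<in> cball 0 2 \<longrightarrow>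
    (LINT x:cball 0 r|lborel. u x powr \<theta> * ((y - x) \<bullet> (y - x) + e) powr - (real CARD('n) / 2 - 1)) \<le> C * (LINT x:cball 0 r|lborel. u x) powr \<theta>"
proof -
  define b where "b = (real CARD('n) - 1) / 2"
  define B where "B = 2 * (measure lborel (cball (0 :: real ^ 'n) 4) * (4 / 2) powr - (2 * b))"
  define C where "C = (B + 1) powr (1 - \<theta>)"
  have \<theta>: "0 \<le> \<theta>" "\<theta> \<le> 1" using N by (auto simp: \<theta>_def)
  have b: "- b * (1 - \<theta>) = - (real CARD('n) / 2 - 1)" using N by (simp add: b_def \<theta>_def field_simps)
  have B0: "B \<ge> 0" by (simp add: B_def)
  show ?thesis
  proof (rule exI[of _ C], intro conjI allI impI)
    show "C > 0" using B0 by (simp add: C_def)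
    fix u :: "real ^ 'n \<Rightarrow> real" and r e :: real and y :: "real ^ 'n"
    assume u: "continuous_on UNIV u" "\<forall>x. u x > 0" and r: "0 < r" "r \<le> 2" and e: "0 < e" and y: "y \<in> cball 0 2"
    define K where "K z = (z \<bullet> z + e) powr - b" for z :: "real ^ 'n"
    have pos: "z \<bullet> z + e > 0" for z :: "real ^ 'n" using e inner_ge_zero[of z] by linarith
    have K0: "K z > 0" for z using pos[of z] by (simp add: K_def)
    have cK: "continuous_on S K" for S
      unfolding K_def using pos by (intro continuous_intros) (auto simp: less_imp_neq[symmetric])
    have cKy: "continuous_on S (\<lambda>x. K (y - x))" for S
      by (rule continuous_on_compose2[OF cK[of UNIV]]) (auto intro!: continuous_intros)
    have cu: "continuous_on S u" for S using continuous_on_subset[OF u(1)] by blast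
    have Kint: "(LINT x:cball 0 r|lborel. K (y - x)) \<le> B"
    proof -
      have sym: "K (y - x) = K (- y + x)" for x
      proof -
        have "- y + x = - (y - x)" by simp
        then show ?thesis unfolding K_def by (simp only: inner_minus_left inner_minus_right minus_minus)
      qed
      \<comment> \<open>Both \<open>x\<close> and \<open>y\<close> lie in the ball of radius 2, so
        \<open>x\<close> lies in the ball of radius 4 around \<open>y\<close>, over which the
        integral of the kernel no longer depends on \<open>y\<close>.\<close>
      have "(LINT x:cball 0 r|lborel. K (y - x)) \<le> (LINT x:cball y 4|lborel. K (y - x))"
      proof (rule set_integral_mono_subset)
        show "cball 0 r \<subseteq> cball y 4"
        proof
          fix x :: "real ^ 'n" assume "x \<in> cball 0 r"
          then have "norm x \<le> 2" "norm y \<le> 2" using r y by auto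
          then show "x \<in> cball y 4" using norm_triangle_ineq4[of y x] by (simp add: dist_norm)
        qed
      qed (use K0 in \<open>auto intro!: set_integrable_compact cKy intro: less_imp_le\<close>)
      also have "\<dots> = (LINT x:cball y 4|lborel. K (- y + x))" by (simp only: sym)
      also have "\<dots> = (LINT x:cball 0 4|lborel. K x)"
        using set_integral_cball_affine[OF cK, of 1 y 4 "- y"] by simp
      also have "\<dots> \<le> B"
        using regularized_kernel_integral_bound[where 'a = "real ^ 'n", OF e, of 4] by (simp add: K_def b_def B_def)
      finally show ?thesis .
    qed
    have Kpos: "0 < (LINT x:cball 0 r|lborel. K (y - x))"
      by (rule set_integral_cball_pos[OF cKy r(1)]) (rule K0)
    have upos: "0 < (LINT x:cball 0 r|lborel. u x)"
      by (rule set_integral_cball_pos[OF cu r(1)]) (use u in auto)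
    have "(LINT x:cball 0 r|lborel. u x powr \<theta> * ((y - x) \<bullet> (y - x) + e) powr - (real CARD('n) / 2 - 1))
      = (LINT x:cball 0 r|lborel. u x powr \<theta> * K (y - x) powr (1 - \<theta>))"
      by (simp only: K_def powr_powr b)
    also have "\<dots> \<le> (LINT x:cball 0 r|lborel. u x) powr \<theta> * (LINT x:cball 0 r|lborel. K (y - x)) powr (1 - \<theta>)"
      by (rule set_integral_Hoelder[OF compact_cball cu _ cKy _ \<theta> upos Kpos]) (use u K0 in auto)
    also have "\<dots> \<le> (LINT x:cball 0 r|lborel. u x) powr \<theta> * C"
      unfolding C_def using Kint Kpos \<theta> by (intro mult_left_mono powr_mono2) auto
    finally show "(LINT x:cball 0 r|lborel. u x powr \<theta> * ((y - x) \<bullet> (y - x) + e) powr - (real CARD('n) / 2 - 1))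
      \<le> C * (LINT x:cball 0 r|lborel. u x) powr \<theta>" by (simp add: mult.commute)
  qed
qed

text \<open>Multiply the pointwise bound for \<open>u x\<close> by \<open>u x powr \<theta>\<close>,
  integrate over \<open>x\<close> and exchange the integrals. The inner integral over
  \<open>x\<close> is then the one bounded in \<open>kernel_Hoelder_bound\<close>, uniformly in
  \<open>y\<close>.\<close>

lemma higher_integrability_step:
  fixes k :: nat
  assumes k: "1 \<le> k" "2 * real k < real CARD('n::finite)"
  defines "\<theta> \<equiv> 1 / (real CARD('n) - 1)"
  shows "\<exists>C>0. \<forall>(u :: real ^ 'n \<Rightarrow> real) r d. polysuper k u \<longrightarrow>
     0 < r \<longrightarrow> 0 < d \<longrightarrow> d \<le> 1 \<longrightarrow> r + d \<le> 2 \<longrightarrow>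
     d ^ (4 * k + 2) * (LINT x:cball 0 r|lborel. u x powr (1 + \<theta>))
     \<le> C * (LINT x:cball 0 r|lborel. u x) powr \<theta> * (LINT y:cball 0 (r + d)|lborel. neg_laplacian_power k u y + u y)"
proof -
  define h where "h = real CARD('n) / 2"
  have N3: "3 \<le> CARD('n)" using k by linarith
  obtain C1 where C1: "C1 > 0" and pw: "\<And>(u :: real ^ 'n \<Rightarrow> real) x d e w. polysuper k u \<Longrightarrow>
     0 < d \<Longrightarrow> d \<le> 1 \<Longrightarrow> 0 < e \<Longrightarrow> e \<le> d\<^sup>2 / 2 \<Longrightarrow> (\<forall>y\<in>cball x (sqrt e). w \<le> u y) \<Longrightarrow>
     d ^ (4 * k + 2) * w
     \<le> C1 * (LINT y:cball x d|lborel. ((y - x) \<bullet> (y - x) + e) powr - (h - 1) * (neg_laplacian_power k u y + u y))"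
    using regularized_pointwise_bound[OF k] unfolding h_def by blast
  obtain C2 where C2: "C2 > 0" and ker: "\<And>(u :: real ^ 'n \<Rightarrow> real) r y e. continuous_on UNIV u \<Longrightarrow> (\<forall>x. u x > 0) \<Longrightarrow> 0 < r \<Longrightarrow> r \<le> 2 \<Longrightarrow> 0 < e \<Longrightarrow> y \<in> cball 0 2 \<Longrightarrow>
    (LINT x:cball 0 r|lborel. u x powr \<theta> * ((y - x) \<bullet> (y - x) + e) powr - (h - 1)) \<le> C2 * (LINT x:cball 0 r|lborel. u x) powr \<theta>"
    using kernel_Hoelder_bound[OF N3] unfolding h_def \<theta>_def by blast
  show ?thesis
  proof (rule exI[of _ "C1 * C2"], intro conjI allI impI)
    show "C1 * C2 > 0" using C1 C2 by simp
    fix u :: "real ^ 'n \<Rightarrow> real" and r d :: real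
    assume sup: "polysuper k u"
      and r: "0 < r" "0 < d" "d \<le> 1" "r + d \<le> 2"
    let ?f = "neg_laplacian_power k u"
    let ?A = "cball (0 :: real ^ 'n) r" and ?B = "cball (0 :: real ^ 'n) (r + d)"
    note u = polysuperD[OF sup] and cu = polysuperD(5)[OF sup] and cf = polysuperD(6)[OF sup]
      and cup = polysuperD(7)[OF sup]
    define X where "X = (LINT x:?A|lborel. u x)"
    define P where "P = (LINT x:?A|lborel. u x powr \<theta>)"
    define S where "S = (LINT x:?A|lborel. u x powr (1 + \<theta>))"
    define Q where "Q = (LINT y:?B|lborel. ?f y + u y)"
    define D where "D = d ^ (4 * k + 2)"
    have D: "D > 0" using r by (simp add: D_def)
    have P: "P > 0" unfolding P_def by (rule set_integral_cball_pos[OF cup r(1)]) (use u(4) in \<open>simp add: less_imp_neq[symmetric]\<close>)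
    have main: "D * (S - \<omega> * P) \<le> C1 * C2 * X powr \<theta> * Q" if \<omega>: "\<omega> > 0" for \<omega>
    proof -
      have "uniformly_continuous_on (cball 0 2) u"
        by (intro compact_uniformly_continuous cu) auto
      then obtain \<delta> where \<delta>: "\<delta> > 0" "\<And>x y. x \<in> cball 0 2 \<Longrightarrow> y \<in> cball 0 2 \<Longrightarrow> dist y x < \<delta> \<Longrightarrow> dist (u y) (u x) < \<omega>"
        using \<omega> unfolding uniformly_continuous_on_def by blast
      \<comment> \<open>\<open>e\<close> depends on \<open>u\<close> through the modulus of
        continuity \<open>\<delta>\<close>, chosen so that \<open>u\<close> drops by less than
        \<open>\<omega>\<close> on the ball of radius \<open>sqrt e\<close>. This is harmless since
        \<open>C1\<close> and \<open>C2\<close> do not depend on \<open>e\<close>.\<close>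
      define e where "e = min (d\<^sup>2 / 2) ((\<delta> / 2)\<^sup>2)"
      have e: "0 < e" "e \<le> d\<^sup>2 / 2" using \<delta> r by (auto simp: e_def)
      have se1: "sqrt e \<le> \<delta> / 2" using \<delta> by (intro real_le_lsqrt) (auto simp: e_def)
      have "e \<le> d\<^sup>2" using e(2) zero_le_power2[of d] by linarith
      then have se2: "sqrt e \<le> d" using r by (intro real_le_lsqrt) auto
      define K where "K x y = ((y - x) \<bullet> (y - x) + e) powr - (h - 1)" for x y :: "real ^ 'n"
      have pos: "z \<bullet> z + e > 0" for z :: "real ^ 'n" using e inner_ge_zero[of z] by linarith
      have cK: "continuous_on T (\<lambda>(x, y). K x y)" for T
        unfolding K_def split_def using pos
        by (intro continuous_intros) (auto simp: less_imp_neq[symmetric])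
      have cKy: "continuous_on T (\<lambda>y. K x y)" for x T
        unfolding K_def using pos by (intro continuous_intros) (auto simp: less_imp_neq[symmetric])
      define F where "F x y = u x powr \<theta> * (C1 * (K x y * (?f y + u y)))" for x y
      have cF: "continuous_on (?A \<times> ?B) (\<lambda>(x, y). F x y)"
      proof -
        have 1: "continuous_on (?A \<times> ?B) (\<lambda>z. u (fst z) powr \<theta>)"
          by (rule continuous_on_compose2[OF cup[of UNIV]]) (auto intro!: continuous_intros)
        have 2: "continuous_on (?A \<times> ?B) (\<lambda>z. ?f (snd z))"
          by (rule continuous_on_compose2[OF cf[of UNIV]]) (auto intro!: continuous_intros)
        have 3: "continuous_on (?A \<times> ?B) (\<lambda>z. u (snd z))"
          by (rule continuous_on_compose2[OF cu[of UNIV]]) (auto intro!: continuous_intros)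
        have 4: "continuous_on (?A \<times> ?B) (\<lambda>z. K (fst z) (snd z))"
          using cK unfolding split_def .
        show ?thesis unfolding F_def split_def by (intro continuous_intros 1 2 3 4)
      qed
      have pt: "D * (u x powr (1 + \<theta>) - \<omega> * u x powr \<theta>) \<le> (LINT y:?B|lborel. F x y)" if x: "x \<in> ?A" for x
      proof -
        have w: "\<forall>y\<in>cball x (sqrt e). u x - \<omega> \<le> u y"
        proof
          fix y assume y: "y \<in> cball x (sqrt e)"
          have "norm y \<le> norm x + dist x y" using norm_triangle_ineq4[of x "x - y"] by (simp add: dist_norm)
          then have "y \<in> cball 0 2" "x \<in> cball 0 2" using x y se2 r by auto
          moreover have "dist y x < \<delta>" using y se1 \<delta>(1) by (simp add: dist_commute)
          ultimately have "dist (u y) (u x) < \<omega>" using \<delta>(2) by blast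
          then show "u x - \<omega> \<le> u y" by (simp add: dist_real_def)
        qed
        have "D * (u x - \<omega>) \<le> C1 * (LINT y:cball x d|lborel. K x y * (?f y + u y))"
          using pw[OF sup r(2,3) e w] by (simp add: D_def K_def)
        also have "\<dots> \<le> C1 * (LINT y:?B|lborel. K x y * (?f y + u y))"
        proof (intro mult_left_mono set_integral_mono_subset)
          show "cball x d \<subseteq> ?B"
          proof
            fix y assume "y \<in> cball x d"
            then show "y \<in> ?B" using x norm_triangle_ineq4[of x "x - y"] by (simp add: dist_norm)
          qed
          show "0 \<le> K x y * (?f y + u y)" for y using u(2,3) by (simp add: K_def)
        qed (use C1 in \<open>auto intro!: set_integrable_compact continuous_intros cKy cf cu\<close>)
        finally have "u x powr \<theta> * (D * (u x - \<omega>)) \<le> u x powr \<theta> * (C1 * (LINT y:?B|lborel. K x y * (?f y + u y)))"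
          by (intro mult_left_mono) auto
        moreover have "u x powr (1 + \<theta>) = u x powr \<theta> * u x"
          using u(4)[of x] by (simp add: powr_add mult.commute)
        moreover have "(LINT y:?B|lborel. F x y) = u x powr \<theta> * (C1 * (LINT y:?B|lborel. K x y * (?f y + u y)))"
          unfolding F_def set_integral_mult_right ..
        ultimately show ?thesis by (simp add: algebra_simps)
      qed
      have "D * (S - \<omega> * P) = (LINT x:?A|lborel. D * (u x powr (1 + \<theta>) - \<omega> * u x powr \<theta>))"
        unfolding S_def P_def
        by (subst set_integral_mult_right, subst set_integral_diff(2))
           (auto intro!: set_integrable_compact continuous_intros cup)
      also have "\<dots> \<le> (LINT x:?A|lborel. LINT y:?B|lborel. F x y)"
        by (rule set_integral_mono[OF _ set_integrable_fst[OF _ _ cF] pt])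
           (auto intro!: set_integrable_compact continuous_intros cup)
      also have "\<dots> = (LINT y:?B|lborel. LINT x:?A|lborel. F x y)"
        by (rule set_integral_Fubini[OF _ _ cF]) auto
      also have "\<dots> \<le> (LINT y:?B|lborel. (C1 * C2 * X powr \<theta>) * (?f y + u y))"
      proof (rule set_integral_mono[OF set_integrable_snd[OF _ _ cF]])
        fix y assume y: "y \<in> ?B"
        then have y2: "y \<in> cball 0 2" using r by auto
        have r2: "r \<le> 2" using r by simp
        have "(LINT x:?A|lborel. F x y) = (LINT x:?A|lborel. (C1 * (?f y + u y)) * (u x powr \<theta> * K x y))"
          unfolding F_def by (simp only: mult_ac)
        also have "\<dots> = (C1 * (?f y + u y)) * (LINT x:?A|lborel. u x powr \<theta> * K x y)"
          by (rule set_integral_mult_right)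
        also have "\<dots> \<le> (C1 * (?f y + u y)) * (C2 * X powr \<theta>)"
          unfolding K_def X_def using C1
          by (intro mult_left_mono ker[OF cu _ r(1) r2 e(1) y2] mult_nonneg_nonneg add_nonneg_nonneg u) (auto simp: u)
        finally show "(LINT x:?A|lborel. F x y) \<le> (C1 * C2 * X powr \<theta>) * (?f y + u y)" by (simp add: mult_ac)
      qed (auto intro!: set_integrable_compact continuous_intros cf cu)
      also have "\<dots> = C1 * C2 * X powr \<theta> * Q" unfolding Q_def by (rule set_integral_mult_right)
      finally show ?thesis .
    qed
    have "D * S \<le> C1 * C2 * X powr \<theta> * Q"
    proof (rule field_le_epsilon)
      fix \<epsilon> :: real assume \<epsilon>: "\<epsilon> > 0"
      \<comment> \<open>The choice \<open>\<omega> = \<epsilon> / (D * P)\<close> makes the loss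
        exactly \<open>\<epsilon>\<close>.\<close>
      have "D * (S - \<epsilon> / (D * P) * P) \<le> C1 * C2 * X powr \<theta> * Q" using D P \<epsilon> by (intro main) simp
      moreover have "D * (S - \<epsilon> / (D * P) * P) = D * S - \<epsilon>" using D P by (simp add: right_diff_distrib)
      ultimately show "D * S \<le> C1 * C2 * X powr \<theta> * Q + \<epsilon>" by linarith
    qed
    then show "d ^ (4 * k + 2) * (LINT x:?A|lborel. u x powr (1 + \<theta>))
     \<le> C1 * C2 * (LINT x:?A|lborel. u x) powr \<theta> * (LINT y:?B|lborel. ?f y + u y)"
      by (simp add: D_def S_def X_def Q_def)
  qed
qed

text \<open>A second gap \<open>d\<close> removes the iterated Laplacian by
  \<open>test_function_bound\<close>. Two factors \<open>d ^ (4 * k + 2)\<close> give the exponent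
  \<open>8 * k + 4\<close>.\<close>

lemma higher_integrability:
  fixes k :: nat
  assumes k: "1 \<le> k" "2 * real k < real CARD('n::finite)"
  defines "\<theta> \<equiv> 1 / (real CARD('n) - 1)"
  shows "\<exists>C>0. \<forall>(u :: real ^ 'n \<Rightarrow> real) r d. polysuper k u \<longrightarrow>
     0 < r \<longrightarrow> 0 < d \<longrightarrow> r + 2 * d \<le> 2 \<longrightarrow>
     d ^ (8 * k + 4) * (LINT x:cball 0 r|lborel. u x powr (1 + \<theta>)) \<le> C * (LINT x:cball 0 (r + 2 * d)|lborel. u x) powr (1 + \<theta>)"
proof -
  have \<theta>: "\<theta> \<ge> 0" using k by (simp add: \<theta>_def)
  obtain C1 where C1: "C1 > 0" and st: "\<And>(u :: real ^ 'n \<Rightarrow> real) r d. polysuper k u \<Longrightarrow>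
     0 < r \<Longrightarrow> 0 < d \<Longrightarrow> d \<le> 1 \<Longrightarrow> r + d \<le> 2 \<Longrightarrow>
     d ^ (4 * k + 2) * (LINT x:cball 0 r|lborel. u x powr (1 + \<theta>))
     \<le> C1 * (LINT x:cball 0 r|lborel. u x) powr \<theta> * (LINT y:cball 0 (r + d)|lborel. neg_laplacian_power k u y + u y)"
    using higher_integrability_step[OF k] unfolding \<theta>_def by blast
  obtain C2 where C2: "C2 > 0" and tf: "\<And>(u :: real ^ 'n \<Rightarrow> real) r d. polysuper k u \<Longrightarrow>
     0 < r \<Longrightarrow> 0 < d \<Longrightarrow> r + d \<le> 2 \<Longrightarrow>
     d ^ (4 * k + 2) * (LINT x:cball 0 r|lborel. neg_laplacian_power k u x) \<le> C2 * (LINT x:cball 0 (r + d)|lborel. u x)"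
    using test_function_bound[where 'n = 'n] by blast
  show ?thesis
  proof (rule exI[of _ "C1 * (C2 + 1)"], intro conjI allI impI)
    show "C1 * (C2 + 1) > 0" using C1 C2 by simp
    fix u :: "real ^ 'n \<Rightarrow> real" and r d :: real
    assume sup: "polysuper k u"
      and r: "0 < r" "0 < d" "r + 2 * d \<le> 2"
    let ?f = "neg_laplacian_power k u"
    note u = polysuperD[OF sup] and cu = polysuperD(5)[OF sup] and cf = polysuperD(6)[OF sup]
    define X where "X s = (LINT x:cball (0 :: real ^ 'n) s|lborel. u x)" for s
    have Xmono: "X s \<le> X t" if "s \<le> t" for s t
      unfolding X_def by (rule set_integral_mono_subset) (use that u(2) in \<open>auto intro!: set_integrable_compact cu\<close>)
    have X0: "X s \<ge> 0" for s unfolding X_def by (rule set_integral_nonneg) (use u(2) in auto)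
    define D where "D = d ^ (4 * k + 2)"
    have D: "0 < D" using r by (simp add: D_def)
    have D1: "D \<le> 1" unfolding D_def by (rule power_le_one) (use r in auto)
    let ?Q = "(LINT y:cball 0 (r + d)|lborel. ?f y + u y)"
    have "?Q = (LINT y:cball 0 (r + d)|lborel. ?f y) + X (r + d)"
      unfolding X_def by (intro set_integral_add(2) set_integrable_compact cf cu) auto
    moreover have "D * (LINT y:cball 0 (r + d)|lborel. ?f y) \<le> C2 * X (r + 2 * d)"
      using tf[OF sup, of "r + d" d] r by (simp add: D_def X_def add.assoc)
    moreover have "D * X (r + d) \<le> 1 * X (r + 2 * d)"
      using D D1 r by (intro mult_mono Xmono X0) auto
    ultimately have 1: "D * ?Q \<le> (C2 + 1) * X (r + 2 * d)"
      by (simp add: distrib_left distrib_right)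
    have "D * (LINT x:cball 0 r|lborel. u x powr (1 + \<theta>)) \<le> C1 * X r powr \<theta> * ?Q"
      using st[OF sup, of r d] r by (simp add: D_def X_def)
    then have "D * (D * (LINT x:cball 0 r|lborel. u x powr (1 + \<theta>))) \<le> D * (C1 * X r powr \<theta> * ?Q)"
      using D by (intro mult_left_mono) auto
    also have "\<dots> = C1 * X r powr \<theta> * (D * ?Q)" by (simp only: mult_ac)
    also have "\<dots> \<le> C1 * X (r + 2 * d) powr \<theta> * ((C2 + 1) * X (r + 2 * d))"
    proof (rule mult_mono[OF mult_left_mono[OF powr_mono2[OF \<theta> X0 Xmono]] 1])
      show "0 \<le> D * ?Q"
        using D u(2,3) by (intro mult_nonneg_nonneg set_integral_nonneg add_nonneg_nonneg) auto
    qed (use C1 r in auto)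
    also have "\<dots> = C1 * (C2 + 1) * X (r + 2 * d) powr (1 + \<theta>)"
      using X0[of "r + 2 * d"] by (simp add: powr_add powr_one_gt_zero_iff)
    finally have fin: "D * (D * (LINT x:cball 0 r|lborel. u x powr (1 + \<theta>))) \<le> C1 * (C2 + 1) * X (r + 2 * d) powr (1 + \<theta>)" .
    show "d ^ (8 * k + 4) * (LINT x:cball 0 r|lborel. u x powr (1 + \<theta>))
      \<le> C1 * (C2 + 1) * (LINT x:cball 0 (r + 2 * d)|lborel. u x) powr (1 + \<theta>)"
    proof -
      have "(4 * k + 2) + (4 * k + 2) = 8 * k + 4" by simp
      then have "D * D = d ^ (8 * k + 4)" unfolding D_def power_add[symmetric] by (simp only:)
      then show ?thesis using fin unfolding X_def mult.assoc[symmetric] by simp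
    qed
  qed
qed

section \<open>Universal bounds\<close>

text \<open>The supremum \<open>S\<close> of \<open>(2 - r) powr \<beta> * X r\<close> over \<open>1 \<le> r < 2\<close> satisfies \<open>S \<le> B * S powr \<gamma>\<close> for a suitable \<open>\<beta>\<close>.\<close>

lemma sublinear_iteration:
  fixes X :: "real \<Rightarrow> real"
  assumes A: "A > 0" and \<gamma>: "0 \<le> \<gamma>" "\<gamma> < 1" and \<mu>: "\<mu> \<ge> 0"
    and X0: "\<And>r. X r \<ge> 0" and mono: "\<And>r s. r \<le> s \<Longrightarrow> X r \<le> X s"
    and step: "\<And>r d. 1 \<le> r \<Longrightarrow> 0 < d \<Longrightarrow> r + 2 * d \<le> 2 \<Longrightarrow> X r \<le> A * d powr - \<mu> * X (r + 2 * d) powr \<gamma>"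
    and r: "1 \<le> r" "r < 2"
  shows "X r \<le> (2 - r) powr - (\<mu> / (1 - \<gamma>)) * (A * 4 powr (\<mu> / (1 - \<gamma>))) powr (1 / (1 - \<gamma>))"
proof -
  \<comment> \<open>\<open>\<beta>\<close> is the exponent for which
    \<open>\<beta> - \<mu> - \<beta>\<gamma> = 0\<close>, so that the powers of \<open>d\<close>
    cancel in \<open>WB\<close>.\<close>
  define \<beta> where "\<beta> = \<mu> / (1 - \<gamma>)"
  have \<beta>: "\<beta> \<ge> 0" "\<beta> * (1 - \<gamma>) = \<mu>" using \<mu> \<gamma> by (auto simp: \<beta>_def)
  define W where "W s = (2 - s) powr \<beta> * X s" for s
  define S where "S = (SUP s\<in>{1..<2}. W s)"
  \<comment> \<open>Finiteness of \<open>X 2\<close> is used only qualitatively, to make the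
    supremum finite; its value does not enter the bound.\<close>
  have bdd: "bdd_above (W ` {1..<2})"
  proof (rule bdd_aboveI2)
    fix s :: real assume s: "s \<in> {1..<2}"
    have "(2 - s) powr \<beta> \<le> 1" using s \<beta>(1) powr_mono2[of \<beta> "2 - s" 1] by auto
    then show "W s \<le> 1 * X 2" unfolding W_def using s by (intro mult_mono mono X0) auto
  qed
  have WS: "W s \<le> S" if "1 \<le> s" "s < 2" for s
    unfolding S_def by (rule cSUP_upper[OF _ bdd]) (use that in auto)
  have W0: "W s \<ge> 0" for s by (simp add: W_def X0)
  have S0: "S \<ge> 0" using WS[of 1] W0[of 1] by linarith
  define B where "B = A * 4 powr \<beta>"
  have WB: "W s \<le> B * S powr \<gamma>" if s: "1 \<le> s" "s < 2" for s
  proof -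
    \<comment> \<open>The step from \<open>s\<close> to \<open>s + 2 * d\<close> covers half of the
      distance to 2, so both distances, \<open>4 * d\<close> and \<open>2 * d\<close>, are
      comparable to \<open>d\<close>.\<close>
    define d where "d = (2 - s) / 4"
    have "2 - s = 4 * d" by (simp add: d_def)
    then have d: "0 < d" "s + 2 * d = 2 - 2 * d" "2 - s = 4 * d" "s + 2 * d < 2" using s by linarith+
    have "W (s + 2 * d) = (2 * d) powr \<beta> * X (s + 2 * d)" by (simp add: W_def d(2))
    moreover have "d powr \<beta> * X (s + 2 * d) \<le> (2 * d) powr \<beta> * X (s + 2 * d)"
      using d \<beta> by (intro mult_right_mono powr_mono2 X0) auto
    moreover have "W (s + 2 * d) \<le> S" by (rule WS) (use s d in linarith)+
    ultimately have "d powr \<beta> * X (s + 2 * d) \<le> S" by linarith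
    then have "X (s + 2 * d) \<le> S * d powr - \<beta>" using d by (simp add: powr_minus_divide field_simps)
    then have "X (s + 2 * d) powr \<gamma> \<le> (S * d powr - \<beta>) powr \<gamma>" using \<gamma> X0 by (intro powr_mono2) auto
    also have "\<dots> = S powr \<gamma> * d powr - (\<beta> * \<gamma>)" by (simp add: powr_mult powr_powr)
    finally have 1: "X (s + 2 * d) powr \<gamma> \<le> S powr \<gamma> * d powr - (\<beta> * \<gamma>)" .
    have "W s = (4 * d) powr \<beta> * X s" by (simp add: W_def d(3))
    also have "\<dots> \<le> (4 * d) powr \<beta> * (A * d powr - \<mu> * X (s + 2 * d) powr \<gamma>)"
      using s d by (intro mult_left_mono step) auto
    also have "\<dots> \<le> (4 * d) powr \<beta> * (A * d powr - \<mu> * (S powr \<gamma> * d powr - (\<beta> * \<gamma>)))"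
      using A by (intro mult_left_mono 1) auto
    also have "\<dots> = B * S powr \<gamma> * (d powr \<beta> * d powr - \<mu> * d powr - (\<beta> * \<gamma>))"
      by (simp add: powr_mult B_def mult_ac)
    also have "d powr \<beta> * d powr - \<mu> * d powr - (\<beta> * \<gamma>) = d powr (\<beta> + - \<mu> + - (\<beta> * \<gamma>))"
      by (simp only: powr_add)
    also have "\<beta> + - \<mu> + - (\<beta> * \<gamma>) = 0" using \<beta>(2) by (simp add: algebra_simps)
    finally show ?thesis using d by simp
  qed
  have "S \<le> B * S powr \<gamma>" unfolding S_def[of] by (rule cSUP_least) (use WB in \<open>auto simp: S_def\<close>)
  then have SB: "S \<le> B powr (1 / (1 - \<gamma>))"
  proof (cases "S = 0")
    case False
    then have S: "S > 0" using S0 by simp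
    have "S powr (1 - \<gamma>) * S powr \<gamma> = S powr 1" unfolding powr_add[symmetric] by simp
    also have "\<dots> \<le> B * S powr \<gamma>" using \<open>S \<le> B * S powr \<gamma>\<close> S by simp
    finally have "S powr (1 - \<gamma>) \<le> B" using S by (simp add: mult_le_cancel_right)
    then have "(S powr (1 - \<gamma>)) powr (1 / (1 - \<gamma>)) \<le> B powr (1 / (1 - \<gamma>))"
      using \<gamma> by (intro powr_mono2) auto
    then show ?thesis using \<gamma> S by (simp add: powr_powr)
  qed simp
  have "X r = (2 - r) powr - \<beta> * W r" using r by (simp add: W_def powr_minus_divide)
  also have "\<dots> \<le> (2 - r) powr - \<beta> * B powr (1 / (1 - \<gamma>))"
    using WS[OF r] SB by (intro mult_left_mono) auto
  finally show ?thesis by (simp add: \<beta>_def B_def)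
qed

section \<open>Supersolutions of the system\<close>

text \<open>The coefficient functions are replaced by one constant, which makes the class invariant
  under the rescaling of solutions with the same \<open>C\<close>.\<close>

definition supersolution :: "nat \<Rightarrow> real \<Rightarrow> real \<Rightarrow> real \<Rightarrow> (real ^ 'n::finite \<Rightarrow> real) \<Rightarrow> (real ^ 'n \<Rightarrow> real) \<Rightarrow> bool" where
  "supersolution k p q C u v \<longleftrightarrow> C_class (2 * k) u \<and> C_class (2 * k) v \<and> (\<forall>x. u x > 0) \<and> (\<forall>x. v x > 0) \<and>
     (\<forall>x. v x powr q \<le> C * neg_laplacian_power k u x) \<and> (\<forall>x. u x powr p \<le> C * neg_laplacian_power k v x)"

lemma set_integral_powr_le:
  fixes w :: "'a::euclidean_space \<Rightarrow> real"
  assumes w: "continuous_on UNIV w" "\<And>x. w x > 0" and r: "0 < r" "r \<le> 2" and s: "0 < s" "s \<le> t"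
  shows "(LINT x:cball 0 r|lborel. w x powr s)
     \<le> (measure lborel (cball (0::'a) 2) + 1) powr (1 - s / t) * (LINT x:cball 0 r|lborel. w x powr t) powr (s / t)"
proof -
  have t: "t > 0" using s by simp
  have \<theta>: "0 \<le> s / t" "s / t \<le> 1" using s by auto
  have cw: "continuous_on S (\<lambda>x. w x powr b)" for S b
    using continuous_on_subset[OF w(1)] w(2) by (intro continuous_intros) (auto simp: less_imp_neq[symmetric])
  have wpos: "w x powr b > 0" for x b using w(2)[of x] by simp
  have m: "measure lborel (cball (0::'a) r) \<le> measure lborel (cball (0::'a) 2) + 1"
  proof -
    have "(LINT x:cball (0::'a) r|lborel. 1) \<le> (LINT x:cball (0::'a) 2|lborel. (1::real))"
      by (rule set_integral_mono_subset) (use r in \<open>auto intro!: set_integrable_compact\<close>)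
    then show ?thesis by (simp add: set_integral_cball_const)
  qed
  have "(LINT x:cball 0 r|lborel. w x powr s) = (LINT x:cball 0 r|lborel. (w x powr t) powr (s / t) * 1 powr (1 - s / t))"
    using t by (simp add: powr_powr)
  also have "\<dots> \<le> (LINT x:cball 0 r|lborel. w x powr t) powr (s / t) * (LINT x:cball (0::'a) r|lborel. 1) powr (1 - s / t)"
    by (rule set_integral_Hoelder[OF compact_cball cw wpos continuous_on_const _ \<theta>
       set_integral_cball_pos[OF cw r(1) wpos] set_integral_cball_pos[OF continuous_on_const r(1)]]) auto
  also have "\<dots> \<le> (LINT x:cball 0 r|lborel. w x powr t) powr (s / t) * (measure lborel (cball (0::'a) 2) + 1) powr (1 - s / t)"
    using m \<theta> by (intro mult_left_mono powr_mono2) (auto simp: set_integral_cball_const)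
  finally show ?thesis by (simp only: mult.commute)
qed

lemma supersolution_polysuper:
  assumes "supersolution k p q C u v" "C > 0"
  shows "polysuper k u" "polysuper k v"
proof -
  have "0 \<le> C * neg_laplacian_power k u x" "0 \<le> C * neg_laplacian_power k v x" for x
    using assms(1) order_trans[OF powr_ge_zero] unfolding supersolution_def by blast+
  then show "polysuper k u" "polysuper k v"
    using assms by (auto simp: supersolution_def polysuper_def zero_le_mult_iff)
qed

text \<open>The cycle goes from \<open>u\<close> to \<open>v powr q\<close>, then to
  \<open>v\<close>, to \<open>u powr p\<close>, and back to \<open>u\<close> by interpolation. The
  two inequalities are kept apart instead of being composed, because the critical case needs the
  bound of \<open>u\<close> in terms of the integral of \<open>v powr q\<close>.\<close>

lemma supersolution_chain:
  fixes k :: nat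
  assumes k: "1 \<le> k" "2 * real k < real CARD('n::finite)" and p: "p > 0" and q: "q > 1" and pq: "p * q > 1" and C: "C > 0"
  shows "\<exists>A \<mu> \<eta> \<zeta>. A > 0 \<and> \<mu> \<ge> 0 \<and> \<eta> > 0 \<and> \<zeta> \<ge> 0 \<and> \<eta> + \<zeta> < 1 \<and> (\<forall>(u :: real ^ 'n \<Rightarrow> real) v r d. supersolution k p q C u v \<longrightarrow>
     1 \<le> r \<longrightarrow> 0 < d \<longrightarrow> r + 2 * d \<le> 2 \<longrightarrow>
     (LINT x:cball 0 r|lborel. u x) \<le> A * d powr - \<mu> * (LINT x:cball 0 (r + d)|lborel. v x powr q) powr \<eta>
         * (LINT x:cball 0 (r + 2 * d)|lborel. u x) powr \<zeta> \<and>
     (LINT x:cball 0 (r + d)|lborel. v x powr q) \<le> A * d powr - \<mu> * (LINT x:cball 0 (r + 2 * d)|lborel. u x))"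
proof -
  define \<theta> where "\<theta> = 1 / (real CARD('n) - 1)"
  have \<theta>: "\<theta> > 0" using k by (simp add: \<theta>_def)
  define s where "s = 1 + \<theta>"
  \<comment> \<open>Interpolation needs 1 strictly between the two exponents. \<open>p'\<close> is
    below 1 and at most \<open>p\<close>, so its integral is controlled by that of
    \<open>u powr p\<close> whether \<open>p\<close> is small or large.\<close>
  define p' where "p' = min p (1 / 2)"
  have p': "0 < p'" "p' \<le> p" "p' < 1" "p' < s" using p \<theta> by (auto simp: p'_def s_def)
  \<comment> \<open>The weight that makes 1 the combination of \<open>p'\<close> and
    \<open>s\<close>, as \<open>interp\<close> records.\<close>
  define \<tau> where "\<tau> = \<theta> / (s - p')"
  have \<tau>: "0 < \<tau>" "\<tau> < 1" using \<theta> p' by (auto simp: \<tau>_def s_def field_simps)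
  have interp: "p' * \<tau> + s * (1 - \<tau>) = 1"
  proof -
    have "\<tau> * (s - p') = \<theta>" using p' by (simp add: \<tau>_def)
    then show ?thesis by (simp add: s_def algebra_simps)
  qed
  define \<theta>0 where "\<theta>0 = p' / p"
  have \<theta>0: "0 < \<theta>0" "\<theta>0 \<le> 1" using p p' by (auto simp: \<theta>0_def)
  define \<eta> where "\<eta> = \<theta>0 / q * \<tau>"
  define \<zeta> where "\<zeta> = s * (1 - \<tau>)"
  have \<eta>: "\<eta> > 0" using \<theta>0 q \<tau> by (simp add: \<eta>_def)
  have \<zeta>: "\<zeta> \<ge> 0" using \<tau> \<theta> by (simp add: \<zeta>_def s_def)
  \<comment> \<open>\<open>\<zeta> = 1 - p' * \<tau>\<close> and
    \<open>\<eta> = p' * \<tau> / (p * q)\<close>, so sublinearity is precisely the condition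
    \<open>p * q > 1\<close>.\<close>
  have sum1: "\<eta> + \<zeta> < 1"
  proof -
    have "\<eta> = p' * \<tau> * (1 / (p * q))" by (simp add: \<eta>_def \<theta>0_def)
    also have "\<dots> < p' * \<tau> * 1" using pq p' \<tau> by (intro mult_strict_left_mono) auto
    finally show ?thesis using interp by (simp add: \<zeta>_def)
  qed
  obtain C2 where C2: "C2 > 0" and tf: "\<And>(u :: real ^ 'n \<Rightarrow> real) r d. polysuper k u \<Longrightarrow>
     0 < r \<Longrightarrow> 0 < d \<Longrightarrow> r + d \<le> 2 \<Longrightarrow>
     d ^ (4 * k + 2) * (LINT x:cball 0 r|lborel. neg_laplacian_power k u x) \<le> C2 * (LINT x:cball 0 (r + d)|lborel. u x)"
    using test_function_bound[where 'n = 'n] by blast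
  obtain C3 where C3: "C3 > 0" and hi: "\<And>(u :: real ^ 'n \<Rightarrow> real) r d. polysuper k u \<Longrightarrow>
     0 < r \<Longrightarrow> 0 < d \<Longrightarrow> r + 2 * d \<le> 2 \<Longrightarrow>
     d ^ (8 * k + 4) * (LINT x:cball 0 r|lborel. u x powr s) \<le> C3 * (LINT x:cball 0 (r + 2 * d)|lborel. u x) powr s"
    using higher_integrability[OF k] unfolding s_def \<theta>_def by blast
  define m where "m = real (4 * k + 2)"
  define \<omega> where "\<omega> = measure lborel (cball (0 :: real ^ 'n) 2) + 1"
  have \<omega>: "\<omega> > 0" unfolding \<omega>_def using measure_nonneg[of lborel "cball (0 :: real ^ 'n) 2"] by linarith
  define c4 where "c4 = \<omega> powr (1 - 1 / q)"
  define c5 where "c5 = \<omega> powr (1 - \<theta>0)"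
  have c45: "c4 > 0" "c5 > 0" using \<omega> by (simp_all add: c4_def c5_def)
  define \<mu>' where "\<mu>' = m * \<theta>0 * \<tau> + 2 * m * (1 - \<tau>)"
  define A' where "A' = (c5 * (C * C2 * c4) powr \<theta>0) powr \<tau> * C3 powr (1 - \<tau>)"
  \<comment> \<open>As \<open>d \<le> 1\<close>, the larger of the two exponents serves both
    inequalities.\<close>
  define \<mu> where "\<mu> = max \<mu>' m"
  define A where "A = max A' (C * C2)"
  have m0: "m \<ge> 0" by (simp add: m_def)
  have A: "A > 0" using C C2 by (simp add: A_def less_max_iff_disj)
  have main: "(LINT x:cball 0 r|lborel. u x) \<le> A' * d powr - \<mu>' * (LINT x:cball 0 (r + d)|lborel. v x powr q) powr \<eta>
         * (LINT x:cball 0 (r + 2 * d)|lborel. u x) powr \<zeta>" (is ?th1)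
    and main2: "(LINT x:cball 0 (r + d)|lborel. v x powr q) \<le> (C * C2) * d powr - m * (LINT x:cball 0 (r + 2 * d)|lborel. u x)" (is ?th2)
    if sol: "supersolution k p q C u v" and r: "1 \<le> r" "0 < d" "r + 2 * d \<le> 2" for u v :: "real ^ 'n \<Rightarrow> real" and r d
  proof -
    have ineq: "\<And>x. v x powr q \<le> C * neg_laplacian_power k u x" "\<And>x. u x powr p \<le> C * neg_laplacian_power k v x"
      using sol by (auto simp: supersolution_def)
    have sup: "polysuper k u" "polysuper k v" by (rule supersolution_polysuper[OF sol C])+
    note U = polysuperD[OF sup(1)] and W = polysuperD[OF sup(2)]
    note cu = U(5) W(5) U(6) W(6) U(7) W(7)
    have dm: "d ^ (4 * k + 2) = d powr m" using r by (simp only: m_def powr_realpow)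
    have dm2: "d ^ (8 * k + 4) = d powr (2 * m)"
    proof -
      have "2 * m = real (8 * k + 4)" by (simp add: m_def)
      then show ?thesis using r by (simp only: powr_realpow)
    qed
    define X2 where "X2 = (LINT x:cball 0 (r + 2 * d)|lborel. u x)"
    define V where "V = (LINT x:cball 0 (r + d)|lborel. v x powr q)"
    define Y where "Y = (LINT x:cball 0 (r + d)|lborel. v x)"
    have test: "(LINT x:cball 0 \<rho>|lborel. neg_laplacian_power k w x) \<le> C2 * d powr - m * (LINT x:cball 0 (\<rho> + d)|lborel. w x)"
      if w: "polysuper k w" "0 < \<rho>" "\<rho> + d \<le> 2" for w :: "real ^ 'n \<Rightarrow> real" and \<rho>
    proof -
      have "d powr m * (LINT x:cball 0 \<rho>|lborel. neg_laplacian_power k w x) \<le> C2 * (LINT x:cball 0 (\<rho> + d)|lborel. w x)"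
        using tf[OF w(1,2) r(2) w(3)] unfolding dm .
      then show ?thesis using r by (simp add: powr_minus_divide field_simps)
    qed
    have "V \<le> (LINT x:cball 0 (r + d)|lborel. C * neg_laplacian_power k u x)"
      unfolding V_def by (intro set_integral_mono set_integrable_compact continuous_intros cu ineq) auto
    also have "\<dots> = C * (LINT x:cball 0 (r + d)|lborel. neg_laplacian_power k u x)" by simp
    also have "\<dots> \<le> C * (C2 * d powr - m * (LINT x:cball 0 (r + d + d)|lborel. u x))"
      using C r by (intro mult_left_mono test sup) auto
    also have "r + d + d = r + 2 * d" by simp
    finally show ?th2 by (simp only: V_def mult.assoc)
    let ?P = "(LINT x:cball 0 r|lborel. u x powr p)"
    have "?P \<le> (LINT x:cball 0 r|lborel. C * neg_laplacian_power k v x)"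
      by (intro set_integral_mono set_integrable_compact continuous_intros cu ineq) auto
    also have "\<dots> = C * (LINT x:cball 0 r|lborel. neg_laplacian_power k v x)" by simp
    also have "\<dots> \<le> C * (C2 * d powr - m * Y)"
      unfolding Y_def using C r by (intro mult_left_mono test sup) auto
    also have "Y \<le> c4 * V powr (1 / q)"
    proof -
      have "Y = (LINT x:cball 0 (r + d)|lborel. v x powr 1)" using W by (simp add: Y_def)
      also have "\<dots> \<le> c4 * V powr (1 / q)"
        unfolding V_def c4_def \<omega>_def by (rule set_integral_powr_le) (use r q cu W in auto)
      finally show ?thesis .
    qed
    finally have "?P \<le> C * (C2 * d powr - m * (c4 * V powr (1 / q)))"
      using C C2 by (simp add: mult_left_mono)
    then have up: "?P \<le> (C * C2 * c4) * d powr - m * V powr (1 / q)"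
      by (simp add: mult_ac)
    have "(LINT x:cball 0 r|lborel. u x powr p') \<le> c5 * ?P powr \<theta>0"
      unfolding c5_def \<omega>_def \<theta>0_def by (rule set_integral_powr_le) (use r p' cu U in auto)
    also have "\<dots> \<le> c5 * ((C * C2 * c4) * d powr - m * V powr (1 / q)) powr \<theta>0"
      using up c45 \<theta>0 by (intro mult_left_mono powr_mono2 set_integral_nonneg) auto
    also have "\<dots> = (c5 * (C * C2 * c4) powr \<theta>0) * d powr - (m * \<theta>0) * V powr (\<theta>0 / q)"
      by (simp add: powr_mult powr_powr)
    finally have up': "(LINT x:cball 0 r|lborel. u x powr p') \<le> (c5 * (C * C2 * c4) powr \<theta>0) * d powr - (m * \<theta>0) * V powr (\<theta>0 / q)" .
    have us: "(LINT x:cball 0 r|lborel. u x powr s) \<le> C3 * d powr - (2 * m) * X2 powr s"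
    proof -
      have "d powr (2 * m) * (LINT x:cball 0 r|lborel. u x powr s) \<le> C3 * X2 powr s"
        using hi[OF sup(1), of r d] r unfolding dm2 X2_def by simp
      then show ?thesis using r by (simp add: powr_minus_divide field_simps)
    qed
    have r0: "0 < r" using r by simp
    have ppos: "u x powr b > 0" for x b using U(4)[of x] by simp
    have ipos: "0 < (LINT x:cball 0 r|lborel. u x powr b)" for b
      by (rule set_integral_cball_pos[OF U(7) r0 ppos])
    have "(LINT x:cball 0 r|lborel. u x) = (LINT x:cball 0 r|lborel. (u x powr p') powr \<tau> * (u x powr s) powr (1 - \<tau>))"
      using U by (simp add: powr_powr powr_add[symmetric] interp)
    also have "\<dots> \<le> (LINT x:cball 0 r|lborel. u x powr p') powr \<tau> * (LINT x:cball 0 r|lborel. u x powr s) powr (1 - \<tau>)"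
      by (rule set_integral_Hoelder[OF compact_cball U(7) ppos U(7) ppos _ _ ipos ipos]) (use \<tau> in auto)
    also have "\<dots> \<le> ((c5 * (C * C2 * c4) powr \<theta>0) * d powr - (m * \<theta>0) * V powr (\<theta>0 / q)) powr \<tau> * (C3 * d powr - (2 * m) * X2 powr s) powr (1 - \<tau>)"
      using \<tau> ipos by (intro mult_mono powr_mono2 up' us) (auto intro: less_imp_le)
    also have "\<dots> = A' * (d powr - (m * \<theta>0 * \<tau>) * d powr - (2 * m * (1 - \<tau>))) * V powr \<eta> * X2 powr \<zeta>"
      by (simp add: powr_mult powr_powr A'_def \<eta>_def \<zeta>_def mult_ac)
    also have "d powr - (m * \<theta>0 * \<tau>) * d powr - (2 * m * (1 - \<tau>)) = d powr - \<mu>'"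
      by (simp add: powr_add[symmetric] \<mu>'_def)
    finally show ?th1 by (simp add: V_def X2_def)
  qed
  show ?thesis
  proof (rule exI[of _ A], rule exI[of _ \<mu>], rule exI[of _ \<eta>], rule exI[of _ \<zeta>], intro conjI allI impI A \<eta> \<zeta> sum1)
    show "\<mu> \<ge> 0" using m0 by (simp add: \<mu>_def)
    fix u v :: "real ^ 'n \<Rightarrow> real" and r d :: real
    assume *: "supersolution k p q C u v" "1 \<le> r" "0 < d" "r + 2 * d \<le> 2"
    have d1: "d \<le> 1" using * by simp
    have u0: "\<forall>x. u x \<ge> 0" using polysuperD(2)[OF supersolution_polysuper(1)[OF *(1) C]] by blast
    have pw: "d powr - \<mu>' \<le> d powr - \<mu>" "d powr - m \<le> d powr - \<mu>"
      using * d1 by (auto intro!: powr_mono' simp: \<mu>_def)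
    have X0: "0 \<le> (LINT x:cball 0 (r + 2 * d)|lborel. u x)" by (rule set_integral_nonneg) (use u0 in auto)
    show "(LINT x:cball 0 r|lborel. u x) \<le> A * d powr - \<mu> * (LINT x:cball 0 (r + d)|lborel. v x powr q) powr \<eta>
         * (LINT x:cball 0 (r + 2 * d)|lborel. u x) powr \<zeta>"
      by (rule order_trans[OF main[OF *]]) (intro mult_right_mono mult_mono pw, use A in \<open>auto simp: A_def\<close>)
    show "(LINT x:cball 0 (r + d)|lborel. v x powr q) \<le> A * d powr - \<mu> * (LINT x:cball 0 (r + 2 * d)|lborel. u x)"
      by (rule order_trans[OF main2[OF *]]) (intro mult_right_mono mult_mono pw X0, use A in \<open>auto simp: A_def\<close>)
  qed
qed

text \<open>Inserting the second inequality of the chain into the first gives the hypothesis of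
  \<open>sublinear_iteration\<close> with \<open>\<gamma> = \<eta> + \<zeta>\<close>. The second
  bound keeps the factor coming from \<open>v powr q\<close> and estimates only the remaining power
  of the integral of \<open>u\<close> by the universal bound.\<close>

lemma supersolution_local_bounds:
  fixes k :: nat
  assumes k: "1 \<le> k" "2 * real k < real CARD('n::finite)" and p: "p > 0" and q: "q > 1" and pq: "p * q > 1" and C: "C > 0"
  shows "\<exists>K \<eta>. K > 0 \<and> \<eta> > 0 \<and> (\<forall>u v :: real ^ 'n \<Rightarrow> real. supersolution k p q C u v \<longrightarrow>
     (LINT x:cball 0 1|lborel. u x) \<le> K \<and>
     (LINT x:cball 0 1|lborel. u x) \<le> K * (LINT x:cball 0 2|lborel. v x powr q) powr \<eta> \<and>
     (LINT x:cball 0 1|lborel. v x powr q) \<le> K * (LINT x:cball 0 2|lborel. u x))"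
proof -
  obtain A \<mu> \<eta> \<zeta> where *: "A > 0" "\<mu> \<ge> 0" "\<eta> > 0" "\<zeta> \<ge> 0" "\<eta> + \<zeta> < 1" and chain:
    "\<And>(u :: real ^ 'n \<Rightarrow> real) v r d. supersolution k p q C u v \<Longrightarrow> 1 \<le> r \<Longrightarrow> 0 < d \<Longrightarrow> r + 2 * d \<le> 2 \<Longrightarrow>
     (LINT x:cball 0 r|lborel. u x) \<le> A * d powr - \<mu> * (LINT x:cball 0 (r + d)|lborel. v x powr q) powr \<eta>
         * (LINT x:cball 0 (r + 2 * d)|lborel. u x) powr \<zeta> \<and>
     (LINT x:cball 0 (r + d)|lborel. v x powr q) \<le> A * d powr - \<mu> * (LINT x:cball 0 (r + 2 * d)|lborel. u x)"
    using supersolution_chain[OF k p q pq C] by blast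
  define A1 where "A1 = A * A powr \<eta>"
  define \<mu>1 where "\<mu>1 = \<mu> + \<mu> * \<eta>"
  define \<gamma> where "\<gamma> = \<eta> + \<zeta>"
  have A1: "A1 > 0" and \<mu>1: "\<mu>1 \<ge> 0" and \<gamma>: "0 \<le> \<gamma>" "\<gamma> < 1" using * by (auto simp: A1_def \<mu>1_def \<gamma>_def)
  define \<kappa> where "\<kappa> r = (2 - r) powr - (\<mu>1 / (1 - \<gamma>)) * (A1 * 4 powr (\<mu>1 / (1 - \<gamma>))) powr (1 / (1 - \<gamma>))" for r
  \<comment> \<open>One constant for each bound: \<open>\<kappa> 1\<close>; the chain with gap 1/4,
    which ends at radius 3/2 where the universal bound still applies; and the chain with gap 1/2,
    which ends at radius 2.\<close>
  define K where "K = max (\<kappa> 1) (max (A * (1 / 4) powr - \<mu> * \<kappa> (3 / 2) powr \<zeta>) (A * (1 / 2) powr - \<mu>))"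
  have \<kappa>: "\<kappa> r \<ge> 0" for r by (simp add: \<kappa>_def)
  have K: "K > 0" using * by (simp add: K_def less_max_iff_disj)
  show ?thesis
  proof (rule exI[of _ K], rule exI[of _ \<eta>], intro conjI allI impI K *(3))
    fix u v :: "real ^ 'n \<Rightarrow> real"
    assume sol: "supersolution k p q C u v"
    note U = polysuperD[OF supersolution_polysuper(1)[OF sol C]] and W = polysuperD[OF supersolution_polysuper(2)[OF sol C]]
    define X where "X r = (LINT x:cball (0 :: real ^ 'n) r|lborel. u x)" for r
    define V where "V r = (LINT x:cball (0 :: real ^ 'n) r|lborel. v x powr q)" for r
    have X0: "X r \<ge> 0" for r unfolding X_def by (rule set_integral_nonneg) (rule U(2))
    have V0: "V r \<ge> 0" for r unfolding V_def by (rule set_integral_nonneg) simp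
    have Xmono: "X r \<le> X s" if "r \<le> s" for r s
      unfolding X_def by (rule set_integral_mono_subset)
        (use that U(2) in \<open>auto intro!: set_integrable_compact U(5)\<close>)
    have Vmono: "V r \<le> V s" if "r \<le> s" for r s
      unfolding V_def by (rule set_integral_mono_subset)
        (use that in \<open>auto intro!: set_integrable_compact W(7)\<close>)
    have c1: "X r \<le> A * d powr - \<mu> * V (r + d) powr \<eta> * X (r + 2 * d) powr \<zeta>"
      and c2: "V (r + d) \<le> A * d powr - \<mu> * X (r + 2 * d)" if "1 \<le> r" "0 < d" "r + 2 * d \<le> 2" for r d
      using chain[OF sol that] by (auto simp: X_def V_def)
    have step: "X r \<le> A1 * d powr - \<mu>1 * X (r + 2 * d) powr \<gamma>" if r: "1 \<le> r" "0 < d" "r + 2 * d \<le> 2" for r d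
    proof -
      have "X r \<le> A * d powr - \<mu> * V (r + d) powr \<eta> * X (r + 2 * d) powr \<zeta>" by (rule c1[OF r])
      also have "\<dots> \<le> A * d powr - \<mu> * (A * d powr - \<mu> * X (r + 2 * d)) powr \<eta> * X (r + 2 * d) powr \<zeta>"
        using * c2[OF r] V0 by (intro mult_right_mono mult_left_mono powr_mono2) auto
      also have "\<dots> = A1 * (d powr - \<mu> * d powr - (\<mu> * \<eta>)) * (X (r + 2 * d) powr \<eta> * X (r + 2 * d) powr \<zeta>)"
        by (simp add: powr_mult powr_powr A1_def mult_ac)
      also have "\<dots> = A1 * d powr - \<mu>1 * X (r + 2 * d) powr \<gamma>"
        by (simp add: powr_add[symmetric] \<mu>1_def \<gamma>_def)
      finally show ?thesis .
    qed
    have X\<kappa>: "X r \<le> \<kappa> r" if "1 \<le> r" "r < 2" for r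
      unfolding \<kappa>_def by (rule sublinear_iteration[where X = X, OF A1 \<gamma> \<mu>1 X0 Xmono step that])
    show "(LINT x:cball 0 1|lborel. u x) \<le> K"
      using X\<kappa>[of 1] by (simp add: X_def K_def le_max_iff_disj)
    have "X 1 \<le> A * (1 / 4) powr - \<mu> * V (1 + 1 / 4) powr \<eta> * X (1 + 2 * (1 / 4)) powr \<zeta>"
      by (rule c1) auto
    also have "\<dots> \<le> A * (1 / 4) powr - \<mu> * V 2 powr \<eta> * \<kappa> (3 / 2) powr \<zeta>"
    proof -
      have a: "V (1 + 1 / 4) powr \<eta> \<le> V 2 powr \<eta>" using * by (intro powr_mono2 Vmono V0) auto
      have b: "X (1 + 2 * (1 / 4)) powr \<zeta> \<le> \<kappa> (3 / 2) powr \<zeta>"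
        using * X\<kappa>[of "3 / 2"] X0 by (intro powr_mono2) auto
      show ?thesis by (rule mult_mono[OF mult_left_mono[OF a] b]) (use * in auto)
    qed
    also have "\<dots> = (A * (1 / 4) powr - \<mu> * \<kappa> (3 / 2) powr \<zeta>) * V 2 powr \<eta>" by (simp only: mult_ac)
    also have "\<dots> \<le> K * V 2 powr \<eta>" by (intro mult_right_mono) (auto simp: K_def)
    finally show "(LINT x:cball 0 1|lborel. u x) \<le> K * (LINT x:cball 0 2|lborel. v x powr q) powr \<eta>"
      by (simp add: X_def V_def)
    have "V 1 \<le> V (1 + 1 / 2)" by (rule Vmono) simp
    also have "\<dots> \<le> A * (1 / 2) powr - \<mu> * X (1 + 2 * (1 / 2))" by (rule c2) auto
    also have "\<dots> \<le> K * X 2" using X0 by (simp add: K_def mult_right_mono)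
    finally show "(LINT x:cball 0 1|lborel. v x powr q) \<le> K * (LINT x:cball 0 2|lborel. u x)"
      by (simp add: X_def V_def)
  qed
qed

section \<open>Scaling\<close>

lemma supersolution_rescale:
  assumes sol: "supersolution k p q C u v" and r: "r > 0" and pq: "p * q \<noteq> 1"
  defines "\<alpha> \<equiv> 2 * real k * (q + 1) / (p * q - 1)" and "\<beta> \<equiv> 2 * real k * (p + 1) / (p * q - 1)"
  shows "supersolution k p q C (\<lambda>x. r powr \<alpha> * u (y + r *\<^sub>R x)) (\<lambda>x. r powr \<beta> * v (y + r *\<^sub>R x))"
proof -
  \<comment> \<open>These two relations characterise \<open>\<alpha>\<close> and
    \<open>\<beta>\<close>: the factor \<open>r^(2k)\<close> from the Laplacians balances the powers
    on the right in both equations.\<close>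
  have e: "\<beta> * q = \<alpha> + 2 * real k" "\<alpha> * p = \<beta> + 2 * real k"
    using pq by (simp_all add: \<alpha>_def \<beta>_def field_simps)
  have r2: "r ^ (2 * k) = r powr (2 * real k)" using r powr_realpow[OF r, of "2 * k"] by simp
  have C: "C_class (2 * k) u" "C_class (2 * k) v" and ineq: "\<And>x. v x powr q \<le> C * neg_laplacian_power k u x" "\<And>x. u x powr p \<le> C * neg_laplacian_power k v x"
    using sol by (auto simp: supersolution_def)
  have 1: "(r powr \<beta> * v (y + r *\<^sub>R x)) powr q \<le> C * (r powr \<alpha> * r ^ (2 * k) * neg_laplacian_power k u (y + r *\<^sub>R x))" for x
  proof -
    have "(r powr \<beta> * v (y + r *\<^sub>R x)) powr q = (r powr \<alpha> * r ^ (2 * k)) * v (y + r *\<^sub>R x) powr q"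
      by (simp add: powr_mult powr_powr e powr_add r2)
    also have "\<dots> \<le> (r powr \<alpha> * r ^ (2 * k)) * (C * neg_laplacian_power k u (y + r *\<^sub>R x))"
      using r by (intro mult_left_mono ineq) auto
    finally show ?thesis by (simp only: mult_ac)
  qed
  have 2: "(r powr \<alpha> * u (y + r *\<^sub>R x)) powr p \<le> C * (r powr \<beta> * r ^ (2 * k) * neg_laplacian_power k v (y + r *\<^sub>R x))" for x
  proof -
    have "(r powr \<alpha> * u (y + r *\<^sub>R x)) powr p = (r powr \<beta> * r ^ (2 * k)) * u (y + r *\<^sub>R x) powr p"
      by (simp add: powr_mult powr_powr e powr_add r2)
    also have "\<dots> \<le> (r powr \<beta> * r ^ (2 * k)) * (C * neg_laplacian_power k v (y + r *\<^sub>R x))"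
      using r by (intro mult_left_mono ineq) auto
    finally show ?thesis by (simp only: mult_ac)
  qed
  show ?thesis
    unfolding supersolution_def neg_laplacian_power_affine[OF C(1)] neg_laplacian_power_affine[OF C(2)]
    using 1 2 sol r by (auto intro!: C_class_affine C simp: supersolution_def)
qed

text \<open>The local bounds for the rescaled pair, carried back to the ball around \<open>y\<close>
  of radius \<open>r\<close>. In the critical case \<open>\<alpha> = n - 2k\<close> the inner power
  \<open>r powr (\<alpha> + 2k - n)\<close> disappears, so smallness of the integral of
  \<open>v powr q\<close> is felt equally at every scale.\<close>

lemma supersolution_ball_bounds:
  fixes k :: nat
  assumes k: "1 \<le> k" "2 * real k < real CARD('n::finite)" and p: "p > 0" and q: "q > 1" and pq: "p * q > 1" and C: "C > 0"
  defines "N \<equiv> real CARD('n)" and "\<alpha> \<equiv> 2 * real k * (q + 1) / (p * q - 1)"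
  shows "\<exists>K \<eta>. K > 0 \<and> \<eta> > 0 \<and> (\<forall>(u :: real ^ 'n \<Rightarrow> real) v y r. supersolution k p q C u v \<longrightarrow> r > 0 \<longrightarrow>
     (LINT x:cball y r|lborel. u x) \<le> K * r powr (N - \<alpha>) \<and>
     (LINT x:cball y r|lborel. u x) \<le> K * r powr (N - \<alpha>) * (r powr (\<alpha> + 2 * real k - N) * (LINT x:cball y (2 * r)|lborel. v x powr q)) powr \<eta> \<and>
     (LINT x:cball y r|lborel. v x powr q) \<le> K * r powr - (2 * real k) * (LINT x:cball y (2 * r)|lborel. u x))"
proof -
  obtain K \<eta> where K: "K > 0" "\<eta> > 0" and loc: "\<And>u v :: real ^ 'n \<Rightarrow> real. supersolution k p q C u v \<Longrightarrow>
     (LINT x:cball 0 1|lborel. u x) \<le> K \<and>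
     (LINT x:cball 0 1|lborel. u x) \<le> K * (LINT x:cball 0 2|lborel. v x powr q) powr \<eta> \<and>
     (LINT x:cball 0 1|lborel. v x powr q) \<le> K * (LINT x:cball 0 2|lborel. u x)"
    using supersolution_local_bounds[OF k p q pq C] by blast
  define \<beta> where "\<beta> = 2 * real k * (p + 1) / (p * q - 1)"
  have e: "\<beta> * q = \<alpha> + 2 * real k" using pq by (simp add: \<alpha>_def \<beta>_def field_simps)
  show ?thesis
  proof (rule exI[of _ K], rule exI[of _ \<eta>], intro conjI allI impI K)
    fix u v :: "real ^ 'n \<Rightarrow> real" and y :: "real ^ 'n" and r :: real
    assume sol: "supersolution k p q C u v" and r: "r > 0"
    note U = polysuperD[OF supersolution_polysuper(1)[OF sol C]] and W = polysuperD[OF supersolution_polysuper(2)[OF sol C]]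
    define u' where "u' x = r powr \<alpha> * u (y + r *\<^sub>R x)" for x
    define v' where "v' x = r powr \<beta> * v (y + r *\<^sub>R x)" for x
    have sol': "supersolution k p q C u' v'"
      unfolding u'_def v'_def \<alpha>_def \<beta>_def using pq by (intro supersolution_rescale[OF sol r]) auto
    have rN: "r ^ CARD('n) = r powr N" using r by (simp add: N_def powr_realpow)
    have Iu: "(LINT x:cball 0 s|lborel. u' x) = r powr (\<alpha> - N) * (LINT x:cball y (r * s)|lborel. u x)" for s
      using set_integral_cball_affine[OF U(5) r, of 0 s y]
      by (simp add: u'_def rN powr_diff)
    have Iv: "(LINT x:cball 0 s|lborel. v' x powr q) = r powr (\<alpha> + 2 * real k - N) * (LINT x:cball y (r * s)|lborel. v x powr q)" for s
    proof -
      have "(LINT x:cball 0 s|lborel. v' x powr q) = r powr (\<beta> * q) * (LINT x:cball 0 s|lborel. v (y + r *\<^sub>R x) powr q)"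
        by (simp add: v'_def powr_mult powr_powr)
      also have "(LINT x:cball 0 s|lborel. v (y + r *\<^sub>R x) powr q) = (LINT x:cball y (r * s)|lborel. v x powr q) / r powr N"
        using set_integral_cball_affine[OF W(7) r, of 0 s y] by (simp add: rN)
      finally show ?thesis by (simp add: powr_diff e)
    qed
    have inv: "r powr (N - \<alpha>) * (r powr (\<alpha> - N) * z) = z" for z
      using r by (simp add: mult.assoc[symmetric] powr_add[symmetric])
    have mm: "z \<le> r powr (N - \<alpha>) * w" if "r powr (\<alpha> - N) * z \<le> w" for z w
      using mult_left_mono[OF that, of "r powr (N - \<alpha>)"] by (simp add: inv)
    show "(LINT x:cball y r|lborel. u x) \<le> K * r powr (N - \<alpha>)"
      using mm[of "LINT x:cball y r|lborel. u x" K] loc[OF sol'] unfolding Iu by (simp add: mult.commute)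
    show "(LINT x:cball y r|lborel. u x) \<le> K * r powr (N - \<alpha>) * (r powr (\<alpha> + 2 * real k - N) * (LINT x:cball y (2 * r)|lborel. v x powr q)) powr \<eta>"
      using mm[of "LINT x:cball y r|lborel. u x" "K * (r powr (\<alpha> + 2 * real k - N) * (LINT x:cball y (2 * r)|lborel. v x powr q)) powr \<eta>"]
        loc[OF sol'] unfolding Iu Iv by (simp add: mult_ac)
    have "r powr (\<alpha> + 2 * real k - N) * (LINT x:cball y r|lborel. v x powr q) \<le> K * (r powr (\<alpha> - N) * (LINT x:cball y (2 * r)|lborel. u x))"
      using loc[OF sol'] unfolding Iu Iv by (simp add: mult.commute)
    moreover have "\<alpha> + 2 * real k - N = (\<alpha> - N) + 2 * real k" by simp
    ultimately have "r powr (\<alpha> - N) * (r powr (2 * real k) * (LINT x:cball y r|lborel. v x powr q))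
       \<le> K * (r powr (\<alpha> - N) * (LINT x:cball y (2 * r)|lborel. u x))"
      by (simp only: powr_add mult.assoc)
    then have "r powr (2 * real k) * (LINT x:cball y r|lborel. v x powr q) \<le> K * (LINT x:cball y (2 * r)|lborel. u x)"
      using r mult_le_cancel_left_pos[of "r powr (\<alpha> - N)"] by (simp add: mult.left_commute)
    then show "(LINT x:cball y r|lborel. v x powr q) \<le> K * r powr - (2 * real k) * (LINT x:cball y (2 * r)|lborel. u x)"
      using r by (simp add: powr_minus_divide field_simps)
  qed
qed

section \<open>Classification\<close>

lemma set_integral_le_cover:
  fixes f :: "'a \<Rightarrow> real"
  assumes "finite I" "set_integrable M S f" "set_integrable M T f" "\<And>i. i \<in> I \<Longrightarrow> set_integrable M (U i) f"
    and sub: "S \<subseteq> T \<union> (\<Union>i\<in>I. U i)" and nn: "\<And>x. 0 \<le> f x"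
  shows "(LINT x:S|M. f x) \<le> (LINT x:T|M. f x) + (\<Sum>i\<in>I. LINT x:U i|M. f x)"
proof -
  have int: "integrable M (\<lambda>x. indicator S x *\<^sub>R f x)" "integrable M (\<lambda>x. indicator T x *\<^sub>R f x)"
     "\<And>i. i \<in> I \<Longrightarrow> integrable M (\<lambda>x. indicator (U i) x *\<^sub>R f x)"
    using assms by (auto simp: set_integrable_def)
  have "(\<integral>x. indicator S x *\<^sub>R f x \<partial>M) \<le> (\<integral>x. indicator T x *\<^sub>R f x + (\<Sum>i\<in>I. indicator (U i) x *\<^sub>R f x) \<partial>M)"
  proof (rule integral_mono)
    fix x
    show "indicator S x *\<^sub>R f x \<le> indicator T x *\<^sub>R f x + (\<Sum>i\<in>I. indicator (U i) x *\<^sub>R f x)"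
    proof (cases "x \<in> S")
      case False
      then show ?thesis using nn[of x] by (auto intro!: add_nonneg_nonneg sum_nonneg)
    next
      case True
      then consider "x \<in> T" | i where "i \<in> I" "x \<in> U i" using sub by auto
      then show ?thesis
      proof cases
        case 1
        then show ?thesis using True nn[of x] by (auto intro!: sum_nonneg)
      next
        case 2
        have "indicator (U i) x *\<^sub>R f x \<le> (\<Sum>i\<in>I. indicator (U i) x *\<^sub>R f x)"
          by (rule member_le_sum) (use 2 assms(1) nn[of x] in auto)
        then have "f x \<le> (\<Sum>i\<in>I. indicator (U i) x *\<^sub>R f x)" using 2 by simp
        moreover have "0 \<le> indicator T x *\<^sub>R f x" using nn[of x] by simp
        ultimately show ?thesis using True by (simp add: add_increasing)
      qed
    qed
  qed (use int in auto)
  then show ?thesis using int unfolding set_lebesgue_integral_def by simp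
qed

lemma set_integral_disjoint_le:
  fixes f :: "'a \<Rightarrow> real"
  assumes "set_integrable M S f" "set_integrable M T f" "set_integrable M U f"
    and sub: "S \<subseteq> U" "T \<subseteq> U" "S \<inter> T = {}" and nn: "\<And>x. 0 \<le> f x"
  shows "(LINT x:S|M. f x) + (LINT x:T|M. f x) \<le> (LINT x:U|M. f x)"
proof -
  have int: "integrable M (\<lambda>x. indicator S x *\<^sub>R f x)" "integrable M (\<lambda>x. indicator T x *\<^sub>R f x)" "integrable M (\<lambda>x. indicator U x *\<^sub>R f x)"
    using assms by (auto simp: set_integrable_def)
  have "(\<integral>x. indicator S x *\<^sub>R f x + indicator T x *\<^sub>R f x \<partial>M) \<le> (\<integral>x. indicator U x *\<^sub>R f x \<partial>M)"
    by (rule integral_mono) (use int sub nn in \<open>auto simp: indicator_def\<close>)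
  then show ?thesis using int unfolding set_lebesgue_integral_def by simp
qed

lemma powr_neg_tendsto_0: "a < 0 \<Longrightarrow> ((\<lambda>x::real. x powr a) \<longlongrightarrow> 0) at_top"
  by (rule tendsto_neg_powr) (auto intro: filterlim_ident)

text \<open>At the critical exponent the bounds \<open>b1\<close> and \<open>b3\<close> only show
  that \<open>J\<close> is bounded. The improvement comes from splitting the ball of radius
  \<open>R\<close>: near the origin \<open>b1\<close> on the ball of radius
  \<open>\<epsilon>R\<close> gains \<open>\<epsilon>\<close>, and on the rest \<open>b2\<close> on
  small balls gains a power of the tail of \<open>J\<close>. Returning through \<open>b3\<close>
  gives at most \<open>J 1 / 2\<close> as a bound for \<open>J 1\<close>.\<close>

lemma no_supersolution:
  fixes k :: nat and u v :: "real ^ 'n::finite \<Rightarrow> real"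
  assumes k: "1 \<le> k" "2 * real k < real CARD('n)" and p: "p > 0" and q: "q > 1" and pq: "p * q > 1" and C: "C > 0"
    and crit: "real CARD('n) - 2 * real k \<le> 2 * real k * (q + 1) / (p * q - 1)"
  shows "\<not> supersolution k p q C u v"
proof
  assume sol: "supersolution k p q C u v"
  define N where "N = real CARD('n)"
  define \<alpha> where "\<alpha> = 2 * real k * (q + 1) / (p * q - 1)"
  obtain K \<eta> where K: "K > 0" and \<eta>: "\<eta> > 0" and
    b1: "\<And>y r. r > 0 \<Longrightarrow> (LINT x:cball y r|lborel. u x) \<le> K * r powr (N - \<alpha>)" and
    b2: "\<And>y r. r > 0 \<Longrightarrow> (LINT x:cball y r|lborel. u x) \<le> K * r powr (N - \<alpha>) * (r powr (\<alpha> + 2 * real k - N) * (LINT x:cball y (2 * r)|lborel. v x powr q)) powr \<eta>" and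
    b3: "\<And>y r. r > 0 \<Longrightarrow> (LINT x:cball y r|lborel. v x powr q) \<le> K * r powr - (2 * real k) * (LINT x:cball y (2 * r)|lborel. u x)"
    using supersolution_ball_bounds[OF k p q pq C] sol unfolding N_def \<alpha>_def by metis
  note U = polysuperD[OF supersolution_polysuper(1)[OF sol C]] and W = polysuperD[OF supersolution_polysuper(2)[OF sol C]]
  have iu: "set_integrable lborel (cball y r) u" for y r
    by (intro set_integrable_compact U(5)) auto
  have iv: "set_integrable lborel (cball y r) (\<lambda>x. v x powr q)" for y r
    by (intro set_integrable_compact W(7)) auto
  define J where "J r = (LINT x:cball (0 :: real ^ 'n) r|lborel. v x powr q)" for r
  have Jmono: "J r \<le> J s" if "r \<le> s" for r s
    unfolding J_def by (rule set_integral_mono_subset[OF iv iv]) (use that in auto)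
  have J1: "J 1 > 0" unfolding J_def
    by (rule set_integral_cball_pos[OF W(7)])
       (use W(4) in \<open>auto simp: less_imp_neq[symmetric]\<close>)
  have Jbound: "J R \<le> (K * K * 2 powr (N - \<alpha>)) * R powr (N - 2 * real k - \<alpha>)" if R: "R > 0" for R
  proof -
    have "J R \<le> K * R powr - (2 * real k) * (LINT x:cball (0 :: real ^ 'n) (2 * R)|lborel. u x)"
      unfolding J_def by (rule b3[OF R])
    also have "\<dots> \<le> K * R powr - (2 * real k) * (K * (2 * R) powr (N - \<alpha>))"
      using R K by (intro mult_left_mono b1) auto
    also have "\<dots> = (K * K * 2 powr (N - \<alpha>)) * (R powr - (2 * real k) * R powr (N - \<alpha>))"
      by (simp add: powr_mult mult_ac)
    also have "R powr - (2 * real k) * R powr (N - \<alpha>) = R powr (N - 2 * real k - \<alpha>)"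
      by (simp add: powr_add[symmetric] algebra_simps)
    finally show ?thesis .
  qed
  show False
  proof (cases "N - 2 * real k < \<alpha>")
    case True
    have "((\<lambda>R. (K * K * 2 powr (N - \<alpha>)) * R powr (N - 2 * real k - \<alpha>)) \<longlongrightarrow> (K * K * 2 powr (N - \<alpha>)) * 0) at_top"
      by (intro tendsto_mult tendsto_const powr_neg_tendsto_0) (use True in simp)
    then have "((\<lambda>R. (K * K * 2 powr (N - \<alpha>)) * R powr (N - 2 * real k - \<alpha>)) \<longlongrightarrow> 0) at_top" by simp
    moreover have "\<forall>\<^sub>F R in at_top. J 1 \<le> (K * K * 2 powr (N - \<alpha>)) * R powr (N - 2 * real k - \<alpha>)"
      using eventually_ge_at_top[of "1 :: real"]
    proof eventually_elim
      case (elim R)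
      then have "J 1 \<le> J R" by (intro Jmono) auto
      also have "\<dots> \<le> (K * K * 2 powr (N - \<alpha>)) * R powr (N - 2 * real k - \<alpha>)" using elim by (intro Jbound) auto
      finally show ?case .
    qed
    ultimately have "J 1 \<le> 0" by (rule tendsto_lowerbound) simp
    then show False using J1 by simp
  next
    case False
    then have \<alpha>: "\<alpha> = N - 2 * real k" using crit by (simp add: \<alpha>_def N_def)
    have e1: "N - \<alpha> = 2 * real k" "\<alpha> + 2 * real k - N = 0" by (simp_all add: \<alpha>)
    define M where "M = K * K * 2 powr (2 * real k)"
    have M: "M > 0" using K by (simp add: M_def)
    have bdd: "bdd_above (J ` {0<..})"
      by (rule bdd_aboveI2[where M = M]) (use Jbound in \<open>simp add: \<alpha> M_def\<close>)
    define L where "L = (SUP R\<in>{0<..}. J R)"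
    have JL: "J R \<le> L" if "R > 0" for R unfolding L_def by (rule cSUP_upper[OF _ bdd]) (use that in auto)
    \<comment> \<open>Makes the contribution of the central ball at most
      \<open>J 1 / 4\<close>.\<close>
    define \<epsilon> where "\<epsilon> = min (1 / 2) (J 1 / (4 * M))"
    have \<epsilon>: "0 < \<epsilon>" "\<epsilon> < 1" "M * \<epsilon> \<le> J 1 / 4"
    proof -
      show "0 < \<epsilon>" "\<epsilon> < 1" using J1 M by (auto simp: \<epsilon>_def)
      have "M * \<epsilon> \<le> M * (J 1 / (4 * M))" using M by (intro mult_left_mono) (auto simp: \<epsilon>_def)
      then show "M * \<epsilon> \<le> J 1 / 4" using M by simp
    qed
    \<comment> \<open>The cover is taken in the unit annulus and dilated by \<open>R\<close>
      afterwards, so the number of balls depends on \<open>\<epsilon>\<close> alone. This allows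
      \<open>\<delta>\<close> to depend on \<open>card Y\<close>, and \<open>R\<close> in turn on
      \<open>\<delta>\<close>.\<close>
    have cS: "compact (cball 0 1 - ball 0 \<epsilon> :: (real ^ 'n) set)" by (intro compact_diff) auto
    obtain Y where Y: "Y \<subseteq> cball 0 1 - ball 0 \<epsilon>" "finite Y" "cball 0 1 - ball 0 \<epsilon> \<subseteq> (\<Union>y\<in>Y. ball y (\<epsilon> / 4) :: (real ^ 'n) set)"
      by (rule compactE_image[OF cS, of "cball 0 1 - ball 0 \<epsilon>" "\<lambda>y. ball y (\<epsilon> / 4)"]) (use \<epsilon> in auto)
    \<comment> \<open>The added 1 keeps \<open>c\<close> positive even for empty \<open>Y\<close>;
      \<open>\<delta>\<close> is then chosen so that all small balls together contribute at most
      \<open>J 1 / 4\<close>.\<close>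
    define c where "c = M * (real (card Y) + 1)"
    have c: "c > 0" using M by (simp add: c_def add_nonneg_pos)
    define \<delta> where "\<delta> = (J 1 / (4 * c)) powr (1 / \<eta>)"
    have \<delta>: "\<delta> > 0" "\<delta> powr \<eta> = J 1 / (4 * c)" using J1 c \<eta> by (auto simp: \<delta>_def powr_powr)
    obtain R0 where R0: "R0 > 0" "L - \<delta> < J R0"
      using less_cSUP_iff[OF _ bdd, of "L - \<delta>"] \<delta>(1) unfolding L_def by auto
    \<comment> \<open>The ball of radius \<open>R * \<epsilon> / 4\<close> must already carry all of
      \<open>L\<close> up to \<open>\<delta>\<close>, and \<open>R / 2\<close> must be at least 1
      for the final comparison with \<open>J 1\<close>.\<close>
    define R where "R = max 2 (4 * R0 / \<epsilon>)"
    have R: "R \<ge> 2" "R * \<epsilon> / 4 \<ge> R0" "R > 0"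
    proof -
      have "4 * R0 / \<epsilon> \<le> R" by (simp add: R_def)
      then show "R * \<epsilon> / 4 \<ge> R0" using \<epsilon> by (simp add: field_simps)
      show "R \<ge> 2" "R > 0" by (simp_all add: R_def)
    qed
    have \<Delta>: "J (2 * R) - J (R * \<epsilon> / 4) \<le> \<delta>"
      using JL[of "2 * R"] Jmono[OF R(2)] R0 R by linarith
    have small: "(LINT x:cball (R *\<^sub>R y) (R * \<epsilon> / 4)|lborel. u x) \<le> K * R powr (2 * real k) * \<delta> powr \<eta>" if y: "y \<in> Y" for y
    proof -
      have ny: "\<epsilon> \<le> norm y" "norm y \<le> 1" using y Y(1) by auto
      \<comment> \<open>\<open>b2\<close> doubles the radius. Since
        \<open>norm y \<ge> \<epsilon>\<close>, the doubled ball of radius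
        \<open>R * \<epsilon> / 2\<close> still avoids the central ball of radius
        \<open>R * \<epsilon> / 4\<close>, so it sees only the tail of the integral.\<close>
      have "(LINT x:cball (R *\<^sub>R y) (2 * (R * \<epsilon> / 4))|lborel. v x powr q) + J (R * \<epsilon> / 4) \<le> J (2 * R)"
        unfolding J_def
      proof (rule set_integral_disjoint_le[OF iv iv iv])
        have rr: "R * \<epsilon> \<le> R" "R * \<epsilon> > 0" using R \<epsilon> by auto
        show "cball (R *\<^sub>R y) (2 * (R * \<epsilon> / 4)) \<subseteq> cball 0 (2 * R)"
        proof
          fix x assume "x \<in> cball (R *\<^sub>R y) (2 * (R * \<epsilon> / 4))"
          then have "norm (R *\<^sub>R y - x) \<le> R * \<epsilon> / 2" by (simp add: dist_norm)
          moreover have "norm (R *\<^sub>R y) \<le> R * 1" using R ny by simp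
          moreover have "norm x \<le> norm (R *\<^sub>R y) + norm (R *\<^sub>R y - x)"
            using norm_triangle_ineq4[of "R *\<^sub>R y" "R *\<^sub>R y - x"] by simp
          ultimately have "norm x \<le> 2 * R" using rr by linarith
          then show "x \<in> cball 0 (2 * R)" by simp
        qed
        show "cball 0 (R * \<epsilon> / 4) \<subseteq> cball (0 :: real ^ 'n) (2 * R)" by (rule subset_cball) (use rr R in linarith)
        show "cball (R *\<^sub>R y) (2 * (R * \<epsilon> / 4)) \<inter> cball 0 (R * \<epsilon> / 4) = {}"
        proof (rule ccontr)
          assume "cball (R *\<^sub>R y) (2 * (R * \<epsilon> / 4)) \<inter> cball 0 (R * \<epsilon> / 4) \<noteq> {}"
          then obtain x where x: "norm (R *\<^sub>R y - x) \<le> R * \<epsilon> / 2" "norm x \<le> R * \<epsilon> / 4" by (auto simp: dist_norm)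
          have "norm (R *\<^sub>R y) \<le> norm (R *\<^sub>R y - x) + norm x" using norm_triangle_ineq[of "R *\<^sub>R y - x" x] by simp
          moreover have "R * \<epsilon> \<le> norm (R *\<^sub>R y)" using R ny by simp
          ultimately show False using x rr by linarith
        qed
      qed simp
      then have tail: "(LINT x:cball (R *\<^sub>R y) (2 * (R * \<epsilon> / 4))|lborel. v x powr q) \<le> \<delta>" using \<Delta> by linarith
      have pos: "R * \<epsilon> / 4 > 0" using R \<epsilon> by simp
      have one: "(R * \<epsilon> / 4) powr 0 = 1" using R \<epsilon> by (subst powr_zero_eq_one) auto
      have le: "R * \<epsilon> / 4 \<le> R"
      proof -
        have "R * \<epsilon> \<le> R * 1" using R \<epsilon> by (intro mult_left_mono) auto
        then show ?thesis using R by simp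
      qed
      have "(LINT x:cball (R *\<^sub>R y) (R * \<epsilon> / 4)|lborel. u x)
        \<le> K * (R * \<epsilon> / 4) powr (2 * real k) * (LINT x:cball (R *\<^sub>R y) (2 * (R * \<epsilon> / 4))|lborel. v x powr q) powr \<eta>"
        using b2[OF pos, of "R *\<^sub>R y"] unfolding e1 one mult_1_left .
      also have "\<dots> \<le> K * R powr (2 * real k) * \<delta> powr \<eta>"
        using K \<eta> tail pos le by (intro mult_mono mult_left_mono powr_mono2 set_integral_nonneg) auto
      finally show ?thesis .
    qed
    have cover: "cball (0 :: real ^ 'n) R \<subseteq> cball 0 (R * \<epsilon>) \<union> (\<Union>y\<in>Y. cball (R *\<^sub>R y) (R * \<epsilon> / 4))"
    proof
      fix x :: "real ^ 'n" assume x: "x \<in> cball 0 R"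
      show "x \<in> cball 0 (R * \<epsilon>) \<union> (\<Union>y\<in>Y. cball (R *\<^sub>R y) (R * \<epsilon> / 4))"
      proof (cases "norm x \<le> R * \<epsilon>")
        case False
        define z where "z = (1 / R) *\<^sub>R x"
        have xz: "x = R *\<^sub>R z" using R by (simp add: z_def)
        have "norm z \<le> 1" "\<epsilon> \<le> norm z" using x False R by (auto simp: z_def field_simps)
        then have "z \<in> cball 0 1 - ball 0 \<epsilon>" by simp
        then obtain y where y: "y \<in> Y" "dist y z < \<epsilon> / 4" using Y(3) by fastforce
        have "dist (R *\<^sub>R y) x = R * dist y z"
          using R by (simp add: xz dist_norm scaleR_diff_right[symmetric])
        also have "\<dots> \<le> R * (\<epsilon> / 4)" using y R by (intro mult_left_mono) auto
        finally have "x \<in> cball (R *\<^sub>R y) (R * \<epsilon> / 4)" by simp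
        then show ?thesis using y(1) by blast
      qed simp
    qed
    have "(LINT x:cball (0 :: real ^ 'n) R|lborel. u x)
       \<le> (LINT x:cball (0 :: real ^ 'n) (R * \<epsilon>)|lborel. u x) + (\<Sum>y\<in>Y. LINT x:cball (R *\<^sub>R y) (R * \<epsilon> / 4)|lborel. u x)"
      by (rule set_integral_le_cover[OF Y(2) iu iu iu cover U(2)])
    also have "(LINT x:cball (0 :: real ^ 'n) (R * \<epsilon>)|lborel. u x) \<le> K * R powr (2 * real k) * \<epsilon>"
    proof -
      have "(LINT x:cball (0 :: real ^ 'n) (R * \<epsilon>)|lborel. u x) \<le> K * (R * \<epsilon>) powr (2 * real k)"
        using b1[of "R * \<epsilon>" 0] R \<epsilon> unfolding e1 by simp
      also have "(R * \<epsilon>) powr (2 * real k) = R powr (2 * real k) * \<epsilon> powr (2 * real k)"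
        by (simp add: powr_mult)
      also have "\<epsilon> powr (2 * real k) \<le> \<epsilon> powr 1" using \<epsilon> k by (intro powr_mono') auto
      finally show ?thesis using K \<epsilon> by (simp add: mult.assoc mult_left_mono)
    qed
    also have "(\<Sum>y\<in>Y. LINT x:cball (R *\<^sub>R y) (R * \<epsilon> / 4)|lborel. u x) \<le> (\<Sum>y\<in>Y. K * R powr (2 * real k) * \<delta> powr \<eta>)"
      by (rule sum_mono) (rule small)
    finally have U: "(LINT x:cball (0 :: real ^ 'n) R|lborel. u x) \<le> K * R powr (2 * real k) * (\<epsilon> + real (card Y) * \<delta> powr \<eta>)"
      by (simp add: algebra_simps)
    have "J 1 \<le> J (R / 2)" using R by (intro Jmono) auto
    also have "\<dots> \<le> K * (R / 2) powr - (2 * real k) * (LINT x:cball (0 :: real ^ 'n) R|lborel. u x)"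
      using b3[of "R / 2" 0] R by (simp add: J_def)
    also have "\<dots> \<le> K * (R / 2) powr - (2 * real k) * (K * R powr (2 * real k) * (\<epsilon> + real (card Y) * \<delta> powr \<eta>))"
      using K by (intro mult_left_mono U) auto
    also have "\<dots> = M * (\<epsilon> + real (card Y) * \<delta> powr \<eta>)"
    proof -
      have "(R / 2) powr - (2 * real k) * R powr (2 * real k) = 2 powr (2 * real k)"
        using R by (simp add: powr_divide powr_minus_divide)
      then show ?thesis by (simp add: M_def mult_ac)
    qed
    also have "\<dots> = M * \<epsilon> + M * real (card Y) * \<delta> powr \<eta>" by (simp add: algebra_simps)
    also have "M * real (card Y) * \<delta> powr \<eta> \<le> c * \<delta> powr \<eta>"
      using M by (intro mult_right_mono) (auto simp: c_def)
    also have "c * \<delta> powr \<eta> = J 1 / 4" using c \<delta>(2) by simp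
    finally show False using \<epsilon>(3) J1 by simp
  qed
qed

section \<open>From solutions to the exponent condition\<close>

text \<open>Both orders of the pair are recorded because the nonexistence result wants an exponent
  above 1 in the place of \<open>q\<close>.\<close>

lemma double_bounded_positive_system_solution_imp_supersolution:
  fixes u v :: "real ^ 'n::finite \<Rightarrow> real"
  assumes c: "double_bounded c1" "double_bounded c2" and sol: "positive_system_solution k p q c1 c2 u v"
  obtains C where "C > 0" "supersolution k p q C u v" "supersolution k q p C v u"
proof -
  obtain C1 where C1: "C1 > 0" "\<And>x. 1 / C1 \<le> c1 x" using c(1) by (auto simp: double_bounded_def)
  obtain C2 where C2: "C2 > 0" "\<And>x. 1 / C2 \<le> c2 x" using c(2) by (auto simp: double_bounded_def)
  define C where "C = max C1 C2"
  have C: "C > 0" using C1 by (simp add: C_def)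
  have "1 / C \<le> 1 / C1" "1 / C \<le> 1 / C2" using C C1(1) C2(1) by (auto simp: C_def intro!: divide_left_mono)
  then have lo: "1 / C \<le> c1 x" "1 / C \<le> c2 x" for x using C1(2)[of x] C2(2)[of x] by linarith+
  have le: "z \<le> C * (d * z)" if "1 / C \<le> d" "z \<ge> 0" for d z
  proof -
    have "1 \<le> C * d" using that C by (simp add: field_simps)
    then have "1 * z \<le> (C * d) * z" using that by (intro mult_right_mono) auto
    then show ?thesis by (simp add: mult.assoc)
  qed
  have "supersolution k p q C u v" "supersolution k q p C v u"
    using sol le[OF lo(1)] le[OF lo(2)] by (auto simp: supersolution_def positive_system_solution_def)
  with C that show ?thesis by blast
qed

text \<open>By the symmetry of the system the larger exponent can be put in the place of
  \<open>q\<close>. It exceeds 1 because \<open>p * q > 1\<close>, and it is also the one that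
  realises the maximum.\<close>

lemma system_solution_exponents:
  fixes k :: nat and u v :: "real ^ 'n::finite \<Rightarrow> real"
  assumes k: "1 \<le> k" "2 * real k < real CARD('n)" and p: "p > 0" "q > 0" "p * q > 1"
    and c: "double_bounded c1" "double_bounded c2" and sol: "positive_system_solution k p q c1 c2 u v"
  shows "max (2 * real k * (p + 1) / (p * q - 1)) (2 * real k * (q + 1) / (p * q - 1)) < real CARD('n) - 2 * real k"
proof (rule ccontr)
  assume contra: "\<not> ?thesis"
  obtain C where C: "C > 0" "supersolution k p q C u v" "supersolution k q p C v u"
    using double_bounded_positive_system_solution_imp_supersolution[OF c sol] .
  have larger: "1 < b" if "a \<le> b" "a * b > 1" "a > 0" for a b :: real
  proof (rule ccontr)
    assume "\<not> 1 < b"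
    then have "a * b \<le> 1 * 1" using that by (intro mult_mono) auto
    then show False using that by simp
  qed
  have mono: "2 * real k * (a + 1) / (p * q - 1) \<le> 2 * real k * (b + 1) / (p * q - 1)" if "a \<le> b" for a b
    using that p by (intro divide_right_mono mult_left_mono) auto
  show False
  proof (cases "p \<le> q")
    case True
    have "real CARD('n) - 2 * real k \<le> 2 * real k * (q + 1) / (p * q - 1)"
      using contra mono[OF True] by auto
    then show False using no_supersolution[OF k p(1) larger[OF True p(3,1)] p(3) C(1)] C(2) by blast
  next
    case False
    then have qp: "q \<le> p" by simp
    have pq': "q * p > 1" using p by (simp add: mult.commute)
    have "real CARD('n) - 2 * real k \<le> 2 * real k * (p + 1) / (q * p - 1)"
      using contra mono[OF qp] by (auto simp: mult.commute)
    then show False using no_supersolution[OF k p(2) larger[OF qp pq' p(2)] pq' C(1)] C(3) by blast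
  qed
qed

theorem corollary1p6:
  fixes k :: nat
  assumes "1 \<le> k" and "real k < real CARD('n::finite) / 2"
  shows
    "(\<forall>p::real. p > 1 \<longrightarrow>
        ((\<exists>c u :: real ^ 'n \<Rightarrow> real. double_bounded c \<and> positive_solution k p c u)
         \<longleftrightarrow> p > real CARD('n) / (real CARD('n) - 2 * real k)))
     \<and>
     (\<forall>p q::real. p > 0 \<and> q > 0 \<and> p * q > 1 \<longrightarrow>
        ((\<exists>c1 c2 u v :: real ^ 'n \<Rightarrow> real. double_bounded c1 \<and> double_bounded c2 \<and>
            positive_system_solution k p q c1 c2 u v)
         \<longleftrightarrow> max (2 * real k * (p + 1) / (p * q - 1)) (2 * real k * (q + 1) / (p * q - 1))
             < real CARD('n) - 2 * real k))"
proof -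
  have k2: "2 * real k < real CARD('n)" using assms(2) by simp
  note k = assms(1) k2
  \<comment> \<open>On the diagonal the factor \<open>p + 1\<close> cancels against
    \<open>p * p - 1\<close>, so the condition becomes \<open>2k / (p - 1) < n - 2k\<close>.\<close>
  have equiv: "2 * real k * (p + 1) / (p * p - 1) < real CARD('n) - 2 * real k \<longleftrightarrow> p > real CARD('n) / (real CARD('n) - 2 * real k)"
    if p: "p > 1" for p
  proof -
    have "p * p - 1 = (p - 1) * (p + 1)" by (simp add: algebra_simps)
    then have "2 * real k * (p + 1) / (p * p - 1) = 2 * real k / (p - 1)" using p by simp
    then have "2 * real k * (p + 1) / (p * p - 1) < real CARD('n) - 2 * real k
        \<longleftrightarrow> 2 * real k < (real CARD('n) - 2 * real k) * (p - 1)"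
      using p by (simp add: pos_divide_less_eq)
    also have "\<dots> \<longleftrightarrow> real CARD('n) < p * (real CARD('n) - 2 * real k)" by (simp add: algebra_simps)
    finally show ?thesis using k2 by (simp add: pos_divide_less_eq)
  qed
  have pp: "p > 0" "p * p > 1" if "p > 1" for p :: real using that by (auto simp: less_1_mult)
  show ?thesis
  proof (intro conjI allI impI iffI)
    fix p :: real
    assume p: "p > 1" and "\<exists>c u :: real ^ 'n \<Rightarrow> real. double_bounded c \<and> positive_solution k p c u"
    then obtain c and u :: "real ^ 'n \<Rightarrow> real" where c: "double_bounded c" and u: "positive_solution k p c u" by blast
    have sol: "positive_system_solution k p p c c u u"
      using u by (auto simp: positive_solution_def positive_system_solution_def)
    show "p > real CARD('n) / (real CARD('n) - 2 * real k)"
      using system_solution_exponents[OF k pp(1)[OF p] pp(1)[OF p] pp(2)[OF p] c c sol] equiv[OF p] by simp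
  next
    fix p :: real
    assume p: "p > 1" "p > real CARD('n) / (real CARD('n) - 2 * real k)"
    then have "max (2 * real k * (p + 1) / (p * p - 1)) (2 * real k * (p + 1) / (p * p - 1)) < real CARD('n) - 2 * real k"
      using equiv by simp
    \<comment> \<open>With \<open>p = q\<close> the constructed components coincide, so the first
      equation of the system alone is the scalar equation.\<close>
    from exists_positive_system_solution[OF pp(1)[OF p(1)] pp(1)[OF p(1)] pp(2)[OF p(1)] this assms(1)]
    obtain c and u :: "real ^ 'n \<Rightarrow> real" where "double_bounded c" "\<exists>c'. positive_system_solution k p p c c' u u" by blast
    then show "\<exists>c u :: real ^ 'n \<Rightarrow> real. double_bounded c \<and> positive_solution k p c u"
      by (auto simp: positive_solution_def positive_system_solution_def)
  next
    fix p q :: real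
    assume "p > 0 \<and> q > 0 \<and> p * q > 1"
      and "\<exists>c1 c2 u v :: real ^ 'n \<Rightarrow> real. double_bounded c1 \<and> double_bounded c2 \<and> positive_system_solution k p q c1 c2 u v"
    then show "max (2 * real k * (p + 1) / (p * q - 1)) (2 * real k * (q + 1) / (p * q - 1)) < real CARD('n) - 2 * real k"
      using system_solution_exponents[OF k] by blast
  next
    fix p q :: real
    assume "p > 0 \<and> q > 0 \<and> p * q > 1"
      and "max (2 * real k * (p + 1) / (p * q - 1)) (2 * real k * (q + 1) / (p * q - 1)) < real CARD('n) - 2 * real k"
    then show "\<exists>c1 c2 u v :: real ^ 'n \<Rightarrow> real. double_bounded c1 \<and> double_bounded c2 \<and> positive_system_solution k p q c1 c2 u v"
      using exists_positive_system_solution[OF _ _ _ _ assms(1)] by blast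
  qed
qed

end
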